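(* Let $\mathcal W\subset L^2(\mathbb R^k)$ be a finitely generated shift invariant subspace and let $d(x)=\dim J_{\mathcal W}(x)$ for $x\in\mathbb T^k$. Given measurable functions $\alpha_j:\mathbb T^k\to\mathbb R_+$ for $j\in\mathbb I_n$ and $\lambda_j:\mathbb T^k\to\mathbb R_+$ for $j\in\mathbb N$, the following conditions are equivalent: 1. There exists $\mathcal F=\{f_j\}_{j\in\mathbb I_n}\in\mathcal W^n$ such that $E(\mathcal F)$ is a Bessel sequence and: (a) $\|\Gamma f_j(x)\|^2=\alpha_j(x)$ for $j\in\mathbb I_n$ and a.e. $x\in\mathbb T^k$; (b) $\lambda_j([S_{E(\mathcal F)}]_x)=\lambda_j(x)$ for $j\in\mathbb N$ and a.e. $x\in\mathbb T^k$. 2. The following admissibility conditions hold: (a) $\lambda_j(x)=0$ for a.e. $x\in\mathbb T^k$ such that $j\ge\min\{d(x),n\}+1$; (b) $(\alpha_j(x))_{j\in\mathbb I_n}\prec(\lambda_j(x))_{j\in\mathbb I_{d(x)}}$ for a.e. $x\in\mathbb T^k$.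
   Context: Notation: $\mathbb R_+=[0,\infty)$; $n\in\mathbb N$; $\mathbb I_m=\{1,\dots,m\}$ and $\mathbb I_0=\emptyset$; $\mathbb T=[-1/2,1/2)$, and $\mathbb T^k$ carries Lebesgue measure. A closed subspace $\mathcal W\subset L^2(\mathbb R^k)$ is shift invariant (SI) if $T_\ell f\in\mathcal W$ for all $f\in\mathcal W$ and $\ell\in\mathbb Z^k$, where $T_yf(x)=f(x-y)$. It is finitely generated (FSI) if there is a finite set $\mathcal A\subset L^2(\mathbb R^k)$ with $\mathcal W=\overline{\mathrm{span}}\{T_\ell f: f\in\mathcal A,\ \ell\in\mathbb Z^k\}$. $\Gamma:L^2(\mathbb R^k)\to L^2(\mathbb T^k,\ell^2(\mathbb Z^k))$ is the isometric isomorphism extending $\Gamma f(x)=(\hat f(x+\ell))_{\ell\in\mathbb Z^k}$ for $f\in L^1\cap L^2$, where $\hat f(x)=\int_{\mathbb R^k}f(y)e^{-2\pi i\langle y,x\rangle}dy$. If $\mathcal W$ is the SI subspace generated by a finite set $\{h_i\}_i$, its range function is $J_{\mathcal W}(x)=\mathrm{span}\{\Gamma h_i(x)\}_i\subset\ell^2(\mathbb Z^k)$ (a.e. $x$). It is independent of the generators up to null sets, and $\mathcal W=\{f: \Gamma f(x)\in J_{\mathcal W}(x)\text{ for a.e. }x\in\mathbb T^k\}$. For $\mathcal F=\{f_i\}_{i\in\mathbb I_n}\in\mathcal W^n$, $E(\mathcal F)=\{T_\ell f_i\}_{(\ell,i)\in\mathbb Z^k\times\mathbb I_n}$. It is a Bessel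 sequence if there is $b>0$ with $\sum_{\ell,i}|\langle f,T_\ell f_i\rangle|^2\le b\|f\|^2$ for all $f\in L^2(\mathbb R^k)$. Its frame operator is $S_{E(\mathcal F)}f=\sum_{\ell,i}\langle f,T_\ell f_i\rangle T_\ell f_i$. This operator commutes with integer translations and acts fiberwise, $\Gamma(S_{E(\mathcal F)}f)(x)=[S_{E(\mathcal F)}]_x\,\Gamma f(x)$ for a.e. $x$, where $[S_{E(\mathcal F)}]_x=S_{\Gamma\mathcal F(x)}$ is the finite rank positive operator on $\ell^2(\mathbb Z^k)$ given by $\xi\mapsto\sum_{i\in\mathbb I_n}\langle\xi,\Gamma f_i(x)\rangle\,\Gamma f_i(x)$. For a positive finite rank operator $T$, $(\lambda_j(T))_{j\in\mathbb N}$ denotes its eigenvalues, counting multiplicities, arranged in non-increasing order and completed with zeros. The function $x\mapsto(\lambda_j([S_{E(\mathcal F)}]_x))_{j\in\mathbb N}$ is called the fine spectral structure of $E(\mathcal F)$. Vector majorization: for $a\in\mathbb R^n$ and $b\in\mathbb R^m$ (possibly $n\ne m$), $a\prec b$ means $\sum_{i=1}^ka_i^\downarrow\le\sum_{i=1}^kb_i^\downarrow$ for $1\le k\le\min\{n,m\}$ and $\sum_{i=1}^na_i=\sum_{i=1}^mb_i$, where $a^\downarrow$ is the non-increasing rearrangement of $a$ (an empty vector has sum $0$).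
   Formalization: (1)⇒(2) is proved as stated; (2)⇒(1) is proved when λ_j(x) is a.e. non-increasing in j and the α_j are essentially bounded. Both are necessary for (1), and without either one (2)⇒(1) is false. *)

theory Defs
  imports "HOL-Analysis.Analysis" "HOL-Library.Function_Algebras"
begin

text \<open>
  Elements of L^2 spaces are represented by functions; equality in L^2 is equality almost
  everywhere. Complex-valued functions on any set (functions on R^k, sequences indexed by Z^k)
  form a complex vector space under the pointwise operations.
\<close>

definition cscale :: "complex \<Rightarrow> ('a \<Rightarrow> complex) \<Rightarrow> 'a \<Rightarrow> complex" where
  "cscale c f = (\<lambda>x. c * f x)"

global_interpretation cfun: vector_space cscale
  by unfold_locales (auto simp: cscale_def fun_eq_iff algebra_simps)


text \<open>The Hilbert space L^2(R^k)\<close>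

definition L2 :: "(real ^ 'k \<Rightarrow> complex) set" where
  "L2 = {f. f \<in> borel_measurable lebesgue \<and> integrable lebesgue (\<lambda>x. (cmod (f x))\<^sup>2)}"

definition L2_inner :: "(real ^ 'k \<Rightarrow> complex) \<Rightarrow> (real ^ 'k \<Rightarrow> complex) \<Rightarrow> complex" where
  "L2_inner f g = (LINT x|lebesgue. f x * cnj (g x))"

definition L2_norm :: "(real ^ 'k \<Rightarrow> complex) \<Rightarrow> real" where
  "L2_norm f = sqrt (LINT x|lebesgue. (cmod (f x))\<^sup>2)"

definition L2_closure :: "(real ^ 'k \<Rightarrow> complex) set \<Rightarrow> (real ^ 'k \<Rightarrow> complex) set" where
  "L2_closure A = {f \<in> L2. \<forall>e>0. \<exists>g\<in>A. L2_norm (f - g) < e}"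


text \<open>Integer translations and shift invariant subspaces\<close>

definition of_int_vec :: "int ^ 'k \<Rightarrow> real ^ 'k" where
  "of_int_vec l = (\<chi> i. of_int (l $ i))"

definition translate :: "real ^ 'k \<Rightarrow> (real ^ 'k \<Rightarrow> complex) \<Rightarrow> (real ^ 'k \<Rightarrow> complex)" where
  "translate y f = (\<lambda>x. f (x - y))"

definition shift_invariant :: "(real ^ 'k \<Rightarrow> complex) set \<Rightarrow> bool" where
  "shift_invariant W \<longleftrightarrow>
     W \<subseteq> L2 \<and> cfun.subspace W \<and> L2_closure W \<subseteq> W \<and>
     (\<forall>f\<in>W. \<forall>l. translate (of_int_vec l) f \<in> W)"

definition SI_span :: "(real ^ 'k \<Rightarrow> complex) set \<Rightarrow> (real ^ 'k \<Rightarrow> complex) set" where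
  "SI_span A = L2_closure (cfun.span {translate (of_int_vec l) f | l f. f \<in> A})"

definition FSI :: "(real ^ 'k \<Rightarrow> complex) set \<Rightarrow> bool" where
  "FSI W \<longleftrightarrow> shift_invariant W \<and> (\<exists>A. finite A \<and> A \<subseteq> L2 \<and> W = SI_span A)"


text \<open>The sequence space l^2(Z^k); the norm and inner product are meant for arguments in it.\<close>

definition ell2 :: "(int ^ 'k \<Rightarrow> complex) set" where
  "ell2 = {\<xi>. (\<lambda>l. (cmod (\<xi> l))\<^sup>2) summable_on UNIV}"

definition ell2_inner :: "(int ^ 'k \<Rightarrow> complex) \<Rightarrow> (int ^ 'k \<Rightarrow> complex) \<Rightarrow> complex" where
  "ell2_inner \<xi> \<eta> = (\<Sum>\<^sub>\<infinity>l\<in>UNIV. \<xi> l * cnj (\<eta> l))"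

definition ell2_norm :: "(int ^ 'k \<Rightarrow> complex) \<Rightarrow> real" where
  "ell2_norm \<xi> = sqrt (\<Sum>\<^sub>\<infinity>l\<in>UNIV. (cmod (\<xi> l))\<^sup>2)"


text \<open>
  The torus and L^2(T^k, l^2(Z^k)). Since l^2(Z^k) is separable, measurability of an
  l^2-valued function is measurability of its coordinates.
\<close>

definition torus :: "(real ^ 'k) set" where
  "torus = {x. \<forall>i. - 1 / 2 \<le> x $ i \<and> x $ i < 1 / 2}"

abbreviation torus_measure :: "(real ^ 'k) measure" where
  "torus_measure \<equiv> lebesgue_on torus"

definition L2_torus :: "(real ^ 'k \<Rightarrow> int ^ 'k \<Rightarrow> complex) set" where
  "L2_torus = {\<phi>. (\<forall>l. (\<lambda>x. \<phi> x l) \<in> borel_measurable torus_measure) \<and>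
                   (AE x in torus_measure. \<phi> x \<in> ell2) \<and>
                   integrable torus_measure (\<lambda>x. (ell2_norm (\<phi> x))\<^sup>2)}"


definition fourier :: "(real ^ 'k \<Rightarrow> complex) \<Rightarrow> real ^ 'k \<Rightarrow> complex" where
  "fourier f x = (LINT y|lebesgue. f y * cis (- 2 * pi * (y \<bullet> x)))"

text \<open>
  The map Gamma is the isometric isomorphism from L^2(R^k) onto L^2(T^k, l^2(Z^k)) that is given
  by the integral formula on the intersection of L^1 and L^2. By density of this intersection
  it is unique up to null sets; \<open>fiberization\<close> is one choice of representatives.
\<close>

definition is_fiberization ::
    "((real ^ 'k \<Rightarrow> complex) \<Rightarrow> real ^ 'k \<Rightarrow> int ^ 'k \<Rightarrow> complex) \<Rightarrow> bool" where
  "is_fiberization G \<longleftrightarrow>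
     (\<forall>f\<in>L2. G f \<in> L2_torus) \<and>
     (\<forall>f\<in>L2. \<forall>g\<in>L2. \<forall>a b. AE x in torus_measure.
        G (cscale a f + cscale b g) x = cscale a (G f x) + cscale b (G g x)) \<and>
     (\<forall>f\<in>L2. (LINT x|torus_measure. (ell2_norm (G f x))\<^sup>2) = (L2_norm f)\<^sup>2) \<and>
     (\<forall>\<phi>\<in>L2_torus. \<exists>f\<in>L2. AE x in torus_measure. G f x = \<phi> x) \<and>
     (\<forall>f\<in>L2. integrable lebesgue f \<longrightarrow>
        (AE x in torus_measure. G f x = (\<lambda>l. fourier f (x + of_int_vec l))))"

definition fiberization ::
    "(real ^ 'k \<Rightarrow> complex) \<Rightarrow> real ^ 'k \<Rightarrow> int ^ 'k \<Rightarrow> complex" where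
  "fiberization = (SOME G. is_fiberization G)"

text \<open>
  A range function is determined by the subspace only up to null sets, so being a range
  function of W is a predicate.
\<close>

definition is_range_function ::
    "(real ^ 'k \<Rightarrow> complex) set \<Rightarrow> (real ^ 'k \<Rightarrow> (int ^ 'k \<Rightarrow> complex) set) \<Rightarrow> bool" where
  "is_range_function W J \<longleftrightarrow>
     (\<exists>H. finite H \<and> H \<subseteq> L2 \<and> W = SI_span H \<and>
        (AE x in torus_measure. J x = cfun.span ((\<lambda>h. fiberization h x) ` H)))"


definition bessel_translates :: "nat \<Rightarrow> (nat \<Rightarrow> real ^ 'k \<Rightarrow> complex) \<Rightarrow> bool" where
  "bessel_translates n F \<longleftrightarrow>
     (\<exists>b>0. \<forall>f\<in>L2.
        (\<lambda>(l :: int ^ 'k, i). (cmod (L2_inner f (translate (of_int_vec l) (F i))))\<^sup>2)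
          summable_on (UNIV \<times> {1..n}) \<and>
        (\<Sum>\<^sub>\<infinity>(l :: int ^ 'k, i)\<in>UNIV \<times> {1..n}.
           (cmod (L2_inner f (translate (of_int_vec l) (F i))))\<^sup>2) \<le> b * (L2_norm f)\<^sup>2)"

text \<open>
  The fiber at x of the frame operator of the integer translates of F 1, ..., F n, that is, the
  frame operator of the fibers of F 1, ..., F n at x.
\<close>

definition frame_operator_fiber ::
    "nat \<Rightarrow> (nat \<Rightarrow> real ^ 'k \<Rightarrow> complex) \<Rightarrow> real ^ 'k \<Rightarrow>
     (int ^ 'k \<Rightarrow> complex) \<Rightarrow> (int ^ 'k \<Rightarrow> complex)" where
  "frame_operator_fiber n F x \<xi> =
     (\<Sum>i\<in>{1..n}. cscale (ell2_inner \<xi> (fiberization (F i) x)) (fiberization (F i) x))"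

definition ell2_eigenspace ::
    "((int ^ 'k \<Rightarrow> complex) \<Rightarrow> (int ^ 'k \<Rightarrow> complex)) \<Rightarrow> real \<Rightarrow> (int ^ 'k \<Rightarrow> complex) set" where
  "ell2_eigenspace T \<mu> = {\<xi> \<in> ell2. T \<xi> = cscale (complex_of_real \<mu>) \<xi>}"

text \<open>
  For a positive finite rank operator: the nonzero eigenvalues in non-increasing order, each
  repeated according to its multiplicity. The eigenvalue sequence is this list completed with
  zeros; it is indexed from 1.
\<close>

definition nonzero_eigenvalues ::
    "((int ^ 'k \<Rightarrow> complex) \<Rightarrow> (int ^ 'k \<Rightarrow> complex)) \<Rightarrow> real list" where
  "nonzero_eigenvalues T =
     concat (map (\<lambda>\<mu>. replicate (cfun.dim (ell2_eigenspace T \<mu>)) \<mu>)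
       (rev (sorted_list_of_set {\<mu>. \<mu> > 0 \<and> ell2_eigenspace T \<mu> \<noteq> {0}})))"

definition eigenvalue_seq ::
    "((int ^ 'k \<Rightarrow> complex) \<Rightarrow> (int ^ 'k \<Rightarrow> complex)) \<Rightarrow> nat \<Rightarrow> real" where
  "eigenvalue_seq T j =
     (if 1 \<le> j \<and> j \<le> length (nonzero_eigenvalues T) then nonzero_eigenvalues T ! (j - 1) else 0)"


definition majorized_by :: "real list \<Rightarrow> real list \<Rightarrow> bool" where
  "majorized_by a b \<longleftrightarrow>
     (\<forall>k. 1 \<le> k \<and> k \<le> min (length a) (length b) \<longrightarrow>
        sum_list (take k (rev (sort a))) \<le> sum_list (take k (rev (sort b)))) \<and>
     sum_list a = sum_list b"


text \<open>
  The norms of the fibers of the generators are prescribed by \<open>\<alpha>\<close>, the fine spectral structure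
  by \<open>lam\<close>.
\<close>

definition has_bessel_realization ::
    "(real ^ 'k \<Rightarrow> complex) set \<Rightarrow> nat \<Rightarrow> (nat \<Rightarrow> real ^ 'k \<Rightarrow> real) \<Rightarrow>
     (nat \<Rightarrow> real ^ 'k \<Rightarrow> real) \<Rightarrow> bool" where
  "has_bessel_realization W n \<alpha> lam \<longleftrightarrow>
     (\<exists>F. (\<forall>j\<in>{1..n}. F j \<in> W) \<and> bessel_translates n F \<and>
        (\<forall>j\<in>{1..n}. AE x in torus_measure. (ell2_norm (fiberization (F j) x))\<^sup>2 = \<alpha> j x) \<and>
        (\<forall>j\<ge>1. AE x in torus_measure.
           eigenvalue_seq (frame_operator_fiber n F x) j = lam j x))"

definition admissible ::
    "(real ^ 'k \<Rightarrow> nat) \<Rightarrow> nat \<Rightarrow> (nat \<Rightarrow> real ^ 'k \<Rightarrow> real) \<Rightarrow>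
     (nat \<Rightarrow> real ^ 'k \<Rightarrow> real) \<Rightarrow> bool" where
  "admissible d n \<alpha> lam \<longleftrightarrow>
     (\<forall>j\<ge>1. AE x in torus_measure. j \<ge> min (d x) n + 1 \<longrightarrow> lam j x = 0) \<and>
     (AE x in torus_measure.
        majorized_by (map (\<lambda>j. \<alpha> j x) [1..<n + 1]) (map (\<lambda>j. lam j x) [1..<d x + 1]))"

end

theory Submission
  imports Defs
begin

text \<open>
  The fiberization exists by Plancherel's theorem, which reduces to Fourier series: the Fourier samples
  over \<open>x + \<int>\<^sup>k\<close> of a function supported on finitely many integer cells are Fourier coefficients on a
  single cell, so Parseval gives the isometry; the multiplication formula shows that the adjoint is
  isometric as well, hence the map is onto.

  A function belongs to the shift invariant space exactly if its fibers lie in the spans of the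
  fibers of the generators. Pointwise, the theorem is then about finitely many vectors \<open>v\<^sub>i\<close> in a
  space of dimension \<open>d(x)\<close>. Necessity is Schur's inequality, after a unitary mixing of
  the \<open>v\<^sub>i\<close> into orthogonal vectors, whose squared norms are the eigenvalues. Sufficiency reverses this: starting
  from orthogonal vectors with squared norms \<open>\<lambda>\<^sub>j(x)\<close>, rotations in coordinate planes that
  depend measurably on \<open>x\<close> split off vectors with the prescribed norms, one at a time.
\<close>

text \<open>Eigenvalues enter only through dimensions of eigenspaces. Mixing by a matrix with
  orthonormal columns leaves the frame operator unchanged, and for orthogonal vectors the positive
  eigenvalues and their multiplicities can be read off from the squared norms, so a compactness
  argument takes the place of the spectral theorem. The mixing is chosen at each point separately,
  without regard to measurability in x, because necessity is a pointwise statement. Sufficiency has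
  to return measurable fibers, and this dictates its form: Gram--Schmidt as one formula without
  cases for dependent vectors, rotations with explicit coefficients, and a pivot index chosen as a
  least number. Zero vectors are carried along wherever the dimension of the fiber or the number of
  positive eigenvalues varies with x. The fibers so obtained must also come from the given space;
  this uses that the Gram--Schmidt vectors of the generators are fibers of elements of the space,
  although their normalising factors need not be bounded.\<close>

section \<open>Square integrable functions\<close>

text \<open>The measure is a parameter because the same notions serve for Lebesgue measure, the
  torus, counting measure on the lattice or on {..<n}, and the product of torus and lattice. One set
  of lemmas then covers functions, fibers and columns of matrices.\<close>

definition sqi :: "'a measure \<Rightarrow> ('a \<Rightarrow> complex) set" where
  "sqi M = {f. f \<in> borel_measurable M \<and> integrable M (\<lambda>x. (cmod (f x))\<^sup>2)}"

definition nsq :: "'a measure \<Rightarrow> ('a \<Rightarrow> complex) \<Rightarrow> real" where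
  "nsq M f = (LINT x|M. (cmod (f x))\<^sup>2)"

definition ip :: "'a measure \<Rightarrow> ('a \<Rightarrow> complex) \<Rightarrow> ('a \<Rightarrow> complex) \<Rightarrow> complex" where
  "ip M f g = (LINT x|M. f x * cnj (g x))"

lemma cscale_apply [simp]: "cscale c f x = c * f x"
  by (simp add: cscale_def)

lemma borel_measurable_cnj [measurable]:
  "f \<in> borel_measurable M \<Longrightarrow> (\<lambda>x. cnj (f x)) \<in> borel_measurable M"
  by (rule borel_measurable_continuous_on) (intro continuous_intros)+

lemma sqi_measurable: "f \<in> sqi M \<Longrightarrow> f \<in> borel_measurable M"
  and sqi_integrable: "f \<in> sqi M \<Longrightarrow> integrable M (\<lambda>x. (cmod (f x))\<^sup>2)"
  by (auto simp: sqi_def)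

lemma nsq_nonneg [simp]: "0 \<le> nsq M f"
  by (simp add: nsq_def)

lemma sqi_dominated:
  assumes "f \<in> sqi M" "g \<in> borel_measurable M" "AE x in M. cmod (g x) \<le> B * cmod (f x)"
  shows "g \<in> sqi M"
proof -
  have "integrable M (\<lambda>x. B\<^sup>2 * (cmod (f x))\<^sup>2)"
    using sqi_integrable[OF assms(1)] by simp
  then have "integrable M (\<lambda>x. (cmod (g x))\<^sup>2)"
  proof (rule Bochner_Integration.integrable_bound)
    show "AE x in M. norm ((cmod (g x))\<^sup>2) \<le> norm (B\<^sup>2 * (cmod (f x))\<^sup>2)"
      using assms(3)
    proof (eventually_elim)
      case (elim x)
      then have "(cmod (g x))\<^sup>2 \<le> (B * cmod (f x))\<^sup>2" by (intro power_mono) auto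
      then show ?case by (simp add: power_mult_distrib)
    qed
  qed (use assms(2) in measurable)
  then show ?thesis using assms(2) by (simp add: sqi_def)
qed

lemma sqi_bounded:
  assumes "finite_measure M" "g \<in> borel_measurable M" "AE x in M. cmod (g x) \<le> B"
  shows "g \<in> sqi M"
proof -
  interpret finite_measure M by fact
  have "(\<lambda>_. 1) \<in> sqi M" by (simp add: sqi_def)
  from sqi_dominated[OF this assms(2), of B] assms(3) show ?thesis by simp
qed

lemma ip_integrable:
  assumes "f \<in> sqi M" "g \<in> sqi M"
  shows "integrable M (\<lambda>x. f x * cnj (g x))"
proof (rule Bochner_Integration.integrable_bound)
  show "integrable M (\<lambda>x. (cmod (f x))\<^sup>2 + (cmod (g x))\<^sup>2)"
    using assms by (simp add: sqi_def)
  show "(\<lambda>x. f x * cnj (g x)) \<in> borel_measurable M"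
    using assms[THEN sqi_measurable] by measurable
  have "cmod (f x) * cmod (g x) \<le> (cmod (f x))\<^sup>2 + (cmod (g x))\<^sup>2" for x
    using sum_squares_bound[of "cmod (f x)" "cmod (g x)"]
      mult_nonneg_nonneg[OF norm_ge_zero[of "f x"] norm_ge_zero[of "g x"]] by linarith
  then show "AE x in M. norm (f x * cnj (g x)) \<le> norm ((cmod (f x))\<^sup>2 + (cmod (g x))\<^sup>2)"
    by (simp add: norm_mult)
qed

lemma sqi_zero [simp]: "0 \<in> sqi M" "(\<lambda>x. 0) \<in> sqi M"
  by (auto simp: sqi_def zero_fun_def)

lemma sqi_cscale [simp]: "f \<in> sqi M \<Longrightarrow> cscale c f \<in> sqi M"
  by (auto simp: sqi_def norm_mult power_mult_distrib cscale_def)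

lemma sqi_cnj: "f \<in> sqi M \<Longrightarrow> (\<lambda>x. cnj (f x)) \<in> sqi M"
  by (auto simp: sqi_def)

lemma cmod_add_sq: "(cmod (a + b))\<^sup>2 = (cmod a)\<^sup>2 + 2 * Re (a * cnj b) + (cmod b)\<^sup>2"
  unfolding cmod_power2 by (simp add: power2_eq_square algebra_simps)

lemma cmod_diff_sq: "(cmod (a - b))\<^sup>2 = (cmod a)\<^sup>2 - 2 * Re (a * cnj b) + (cmod b)\<^sup>2"
  unfolding cmod_power2 by (simp add: power2_eq_square algebra_simps)

lemma sqi_add [simp]:
  assumes "f \<in> sqi M" "g \<in> sqi M" shows "f + g \<in> sqi M"
proof -
  have "integrable M (\<lambda>x. (cmod (f x))\<^sup>2 + 2 * Re (f x * cnj (g x)) + (cmod (g x))\<^sup>2)"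
    by (intro Bochner_Integration.integrable_add integrable_mult_right integrable_Re ip_integrable
        sqi_integrable assms)
  then show ?thesis
    using assms unfolding sqi_def by (auto simp: cmod_add_sq plus_fun_def)
qed

lemma diff_eq_cscale: "f - g = f + cscale (-1) g"
  by (auto simp: fun_eq_iff)

lemma sqi_diff [simp]:
  assumes "f \<in> sqi M" "g \<in> sqi M" shows "f - g \<in> sqi M"
  using assms unfolding diff_eq_cscale by (intro sqi_add sqi_cscale)

lemma sqi_sum: "(\<And>i. i \<in> I \<Longrightarrow> f i \<in> sqi M) \<Longrightarrow> (\<Sum>i\<in>I. f i) \<in> sqi M"
  by (induction I rule: infinite_finite_induct) auto

lemma subspace_sqi: "cfun.subspace (sqi M)"
  by (auto simp: cfun.subspace_def)

lemma ip_add_left: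
  assumes "f \<in> sqi M" "g \<in> sqi M" "h \<in> sqi M"
  shows "ip M (f + g) h = ip M f h + ip M g h"
  using ip_integrable[of f M h] ip_integrable[of g M h] assms
  by (simp add: ip_def algebra_simps)

lemma ip_cscale_left [simp]: "ip M (cscale c f) g = c * ip M f g"
  by (simp add: ip_def mult.assoc)

lemma ip_cscale_right [simp]: "ip M f (cscale c g) = cnj c * ip M f g"
  by (simp add: ip_def mult.left_commute)

lemma ip_zero [simp]: "ip M 0 f = 0" "ip M f 0 = 0" "ip M (\<lambda>x. 0) f = 0"
  by (auto simp: ip_def)

lemma ip_commute: "ip M g f = cnj (ip M f g)"
proof -
  have "cnj (ip M f g) = (LINT x|M. cnj (f x * cnj (g x)))"
    unfolding ip_def by (rule Bochner_Integration.integral_cnj[symmetric])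
  then show ?thesis by (simp add: ip_def mult.commute)
qed

lemma ip_add_right:
  assumes "f \<in> sqi M" "g \<in> sqi M" "h \<in> sqi M"
  shows "ip M h (f + g) = ip M h f + ip M h g"
  using ip_add_left[OF assms] unfolding ip_commute[of M h "f + g"] ip_commute[of M h f] ip_commute[of M h g]
  by simp

lemma ip_diff_left:
  assumes "f \<in> sqi M" "g \<in> sqi M" "h \<in> sqi M"
  shows "ip M (f - g) h = ip M f h - ip M g h"
  unfolding diff_eq_cscale using assms by (simp add: ip_add_left del: cfun.scale_minus_left)

lemma ip_diff_right:
  assumes "f \<in> sqi M" "g \<in> sqi M" "h \<in> sqi M"
  shows "ip M h (f - g) = ip M h f - ip M h g"
  unfolding diff_eq_cscale using assms by (simp add: ip_add_right del: cfun.scale_minus_left)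

lemma ip_sum_left:
  assumes "\<And>i. i \<in> I \<Longrightarrow> f i \<in> sqi M" "h \<in> sqi M"
  shows "ip M (\<Sum>i\<in>I. f i) h = (\<Sum>i\<in>I. ip M (f i) h)"
  using assms
  by (induction I rule: infinite_finite_induct) (auto simp: ip_add_left sqi_sum)

lemma ip_sum_right:
  assumes "\<And>i. i \<in> I \<Longrightarrow> f i \<in> sqi M" "h \<in> sqi M"
  shows "ip M h (\<Sum>i\<in>I. f i) = (\<Sum>i\<in>I. ip M h (f i))"
  using assms
  by (induction I rule: infinite_finite_induct) (auto simp: ip_add_right sqi_sum)

lemma ip_self: "ip M f f = complex_of_real (nsq M f)"
  unfolding ip_def nsq_def integral_complex_of_real[symmetric]
  by (simp add: complex_norm_square[symmetric])

lemma nsq_cscale [simp]: "nsq M (cscale c f) = (cmod c)\<^sup>2 * nsq M f"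
  by (simp add: nsq_def norm_mult power_mult_distrib)

lemma nsq_zero [simp]: "nsq M 0 = 0" "nsq M (\<lambda>x. 0) = 0"
  by (auto simp: nsq_def)

lemma nsq_minus_commute: "nsq M (f - g) = nsq M (g - f)"
  by (simp add: nsq_def norm_minus_commute)

lemma nsq_cong_AE:
  assumes "f \<in> borel_measurable M" "g \<in> borel_measurable M" "AE x in M. f x = g x"
  shows "nsq M f = nsq M g"
  unfolding nsq_def
  by (rule integral_cong_AE) (use assms in \<open>measurable, auto\<close>)

lemma ip_cong_AE:
  assumes "f \<in> borel_measurable M" "g \<in> borel_measurable M" "AE x in M. f x = g x"
    "f' \<in> borel_measurable M" "g' \<in> borel_measurable M" "AE x in M. f' x = g' x"
  shows "ip M f f' = ip M g g'"
  unfolding ip_def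
  by (rule integral_cong_AE) (use assms in \<open>measurable, auto\<close>)

lemma sqi_cong_AE:
  assumes "f \<in> sqi M" "g \<in> borel_measurable M" "AE x in M. f x = g x"
  shows "g \<in> sqi M"
  by (rule sqi_dominated[OF assms(1,2), of 1]) (use assms(3) in auto)

lemma nsq_add:
  assumes "f \<in> sqi M" "g \<in> sqi M"
  shows "nsq M (f + g) = nsq M f + 2 * Re (ip M f g) + nsq M g"
proof -
  have "complex_of_real (nsq M (f + g)) = ip M f f + (ip M f g + cnj (ip M f g)) + ip M g g"
    using assms by (simp add: ip_self[symmetric] ip_add_left ip_add_right ip_commute[of M g f])
  then have "complex_of_real (nsq M (f + g)) = complex_of_real (nsq M f + 2 * Re (ip M f g) + nsq M g)"
    by (simp add: ip_self complex_add_cnj)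
  then show ?thesis by (simp only: of_real_eq_iff)
qed

lemma nsq_diff:
  assumes "f \<in> sqi M" "g \<in> sqi M"
  shows "nsq M (f - g) = nsq M f - 2 * Re (ip M f g) + nsq M g"
  unfolding diff_eq_cscale using assms by (simp add: nsq_add del: cfun.scale_minus_left)

text \<open>The parallelogram law, as a squared norm is not subadditive. The constant 2 is the
  origin of the error bounds e / 4 below.\<close>

lemma nsq_add_le:
  assumes "f \<in> sqi M" "g \<in> sqi M"
  shows "nsq M (f + g) \<le> 2 * nsq M f + 2 * nsq M g"
  using nsq_add[OF assms] nsq_diff[OF assms] nsq_nonneg[of M "f - g"] by linarith

lemma nsq_diff_triangle:
  assumes "f \<in> sqi M" "g \<in> sqi M" "h \<in> sqi M"
  shows "nsq M (f - h) \<le> 2 * nsq M (f - g) + 2 * nsq M (g - h)"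
proof -
  have "f - h = (f - g) + (g - h)" by simp
  then show ?thesis using nsq_add_le[of "f - g" M "g - h"] assms by auto
qed

lemma nsq_eq_0_iff:
  assumes "f \<in> sqi M"
  shows "nsq M f = 0 \<longleftrightarrow> (AE x in M. f x = 0)"
  unfolding nsq_def using sqi_integrable[OF assms]
  by (subst integral_nonneg_eq_0_iff_AE) auto

lemma nsq_mono:
  assumes "f \<in> sqi M" "g \<in> sqi M" "AE x in M. cmod (f x) \<le> cmod (g x)"
  shows "nsq M f \<le> nsq M g"
  unfolding nsq_def using assms(3)
  by (intro integral_mono_AE sqi_integrable assms(1,2)) (auto elim!: eventually_mono intro: power_mono)

lemma ip_eq_0:
  assumes "f \<in> sqi M" "g \<in> sqi M" "nsq M g = 0"
  shows "ip M f g = 0"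
proof -
  have "AE x in M. g x = 0" using assms nsq_eq_0_iff by blast
  then have "ip M f g = ip M f 0"
    using assms sqi_measurable by (intro ip_cong_AE) (auto simp: zero_fun_def)
  then show ?thesis by simp
qed

lemma cauchy_schwarz:
  assumes "f \<in> sqi M" "g \<in> sqi M"
  shows "(cmod (ip M f g))\<^sup>2 \<le> nsq M f * nsq M g"
proof (cases "nsq M g = 0")
  case True
  then show ?thesis using ip_eq_0[OF assms] by simp
next
  case False
  then have pos: "nsq M g > 0" using nsq_nonneg[of M g] by linarith
  define c where "c = ip M f g / nsq M g"
  have "0 \<le> nsq M (f - cscale c g)" by simp
  also have "\<dots> = nsq M f - 2 * Re (cnj c * ip M f g) + (cmod c)\<^sup>2 * nsq M g"
    using assms by (simp add: nsq_diff)
  also have "cnj c * ip M f g = (cmod (ip M f g))\<^sup>2 / nsq M g"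
    using complex_norm_square[of "ip M f g"] by (simp add: c_def mult.commute)
  also have "(cmod c)\<^sup>2 * nsq M g = (cmod (ip M f g))\<^sup>2 / nsq M g"
    using pos by (simp add: c_def norm_divide power_divide power2_eq_square)
  finally have "(cmod (ip M f g))\<^sup>2 / nsq M g \<le> nsq M f"
    by (simp flip: of_real_power of_real_divide)
  then show ?thesis using pos by (simp add: pos_divide_le_eq)
qed

subsection \<open>Convergence in mean square\<close>

lemma nsq_tendsto_ip:
  assumes "\<And>n. f n \<in> sqi M" "g \<in> sqi M" "h \<in> sqi M" "(\<lambda>n. nsq M (f n - g)) \<longlonglongrightarrow> 0"
  shows "(\<lambda>n. ip M (f n) h) \<longlonglongrightarrow> ip M g h"
proof -
  have "(\<lambda>n. sqrt (nsq M (f n - g) * nsq M h)) \<longlonglongrightarrow> sqrt (0 * nsq M h)"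
    by (intro tendsto_intros assms)
  then have *: "(\<lambda>n. sqrt (nsq M (f n - g) * nsq M h)) \<longlonglongrightarrow> 0" by simp
  have "(\<lambda>n. ip M (f n) h - ip M g h) \<longlonglongrightarrow> 0"
  proof (rule Lim_null_comparison[OF _ *], intro always_eventually allI)
    fix n
    have "(cmod (ip M (f n - g) h))\<^sup>2 \<le> nsq M (f n - g) * nsq M h"
      by (rule cauchy_schwarz) (use assms in auto)
    then have "cmod (ip M (f n - g) h) \<le> sqrt (nsq M (f n - g) * nsq M h)"
      by (rule real_le_rsqrt)
    then show "norm (ip M (f n) h - ip M g h) \<le> sqrt (nsq M (f n - g) * nsq M h)"
      using assms by (simp add: ip_diff_left)
  qed
  then show ?thesis by (simp add: LIM_zero_cancel)
qed

lemma nsq_tendsto_ip_right: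
  assumes "\<And>n. f n \<in> sqi M" "g \<in> sqi M" "h \<in> sqi M" "(\<lambda>n. nsq M (f n - g)) \<longlonglongrightarrow> 0"
  shows "(\<lambda>n. ip M h (f n)) \<longlonglongrightarrow> ip M h g"
proof -
  have "(\<lambda>n. cnj (ip M (f n) h)) \<longlonglongrightarrow> cnj (ip M g h)"
    by (intro tendsto_cnj nsq_tendsto_ip assms)
  then show ?thesis by (simp add: ip_commute[symmetric])
qed

lemma nsq_tendsto_nsq:
  assumes "\<And>n. f n \<in> sqi M" "g \<in> sqi M" "(\<lambda>n. nsq M (f n - g)) \<longlonglongrightarrow> 0"
  shows "(\<lambda>n. nsq M (f n)) \<longlonglongrightarrow> nsq M g"
proof -
  have "(\<lambda>n. nsq M (f n - g) + 2 * Re (ip M (f n) g) - nsq M g) \<longlonglongrightarrow> 0 + 2 * Re (ip M g g) - nsq M g"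
    by (intro tendsto_intros nsq_tendsto_ip assms)
  moreover have "nsq M (f n - g) + 2 * Re (ip M (f n) g) - nsq M g = nsq M (f n)" for n
    using assms by (simp add: nsq_diff)
  ultimately show ?thesis by (simp add: ip_self)
qed

lemma nsq_limit_unique:
  assumes "\<And>n. f n \<in> sqi M" "g \<in> sqi M" "h \<in> sqi M"
    "(\<lambda>n. nsq M (f n - g)) \<longlonglongrightarrow> 0" "(\<lambda>n. nsq M (f n - h)) \<longlonglongrightarrow> 0"
  shows "AE x in M. g x = h x"
proof -
  have "(\<lambda>n. 2 * nsq M (f n - g) + 2 * nsq M (f n - h)) \<longlonglongrightarrow> 2 * 0 + 2 * 0"
    by (intro tendsto_intros assms)
  moreover have "nsq M (g - h) \<le> 2 * nsq M (f n - g) + 2 * nsq M (f n - h)" for n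
    using nsq_diff_triangle[of g M "f n" h] assms by (simp add: nsq_minus_commute[of M g])
  ultimately have "nsq M (g - h) \<le> 0"
    by (intro LIMSEQ_le_const) auto
  then have "nsq M (g - h) = 0" using nsq_nonneg[of M "g - h"] by linarith
  then have "AE x in M. (g - h) x = 0" using nsq_eq_0_iff[of "g - h" M] assms by auto
  then show ?thesis by simp
qed

lemma nn_integral_eq_nsq:
  "f \<in> sqi M \<Longrightarrow> (\<integral>\<^sup>+x. ennreal ((cmod (f x))\<^sup>2) \<partial>M) = ennreal (nsq M f)"
  unfolding nsq_def by (rule nn_integral_eq_integral) (auto dest: sqi_integrable)

text \<open>Fatou's lemma for the squared moduli. The bound is asked for only from \<open>n0\<close>
  on, since a limit inferior ignores initial segments.\<close>

lemma sqi_fatou: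
  assumes f: "\<And>n. f n \<in> sqi M" and g: "g \<in> borel_measurable M"
    and lim: "AE x in M. (\<lambda>n. f n x) \<longlonglongrightarrow> g x"
    and le: "\<And>n. n \<ge> n0 \<Longrightarrow> nsq M (f n) \<le> B"
  shows "g \<in> sqi M" "nsq M g \<le> B"
proof -
  have B: "0 \<le> B" using le[of n0] nsq_nonneg[of M "f n0"] by linarith
  have "(\<integral>\<^sup>+x. ennreal ((cmod (g x))\<^sup>2) \<partial>M) = (\<integral>\<^sup>+x. liminf (\<lambda>n. ennreal ((cmod (f n x))\<^sup>2)) \<partial>M)"
  proof (rule nn_integral_cong_AE, use lim in eventually_elim)
    case (elim x)
    then have "(\<lambda>n. ennreal ((cmod (f n x))\<^sup>2)) \<longlonglongrightarrow> ennreal ((cmod (g x))\<^sup>2)"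
      by (intro tendsto_intros tendsto_ennrealI)
    then show ?case by (metis lim_imp_Liminf sequentially_bot)
  qed
  also have "\<dots> \<le> liminf (\<lambda>n. \<integral>\<^sup>+x. ennreal ((cmod (f n x))\<^sup>2) \<partial>M)"
    by (rule nn_integral_liminf) (use f[THEN sqi_measurable] in measurable)
  also have "\<dots> = liminf (\<lambda>n. ennreal (nsq M (f n)))"
    using f by (simp add: nn_integral_eq_nsq)
  also have "\<dots> \<le> liminf (\<lambda>n. ennreal B)"
    by (rule Liminf_mono) (auto simp: eventually_sequentially intro!: exI[of _ n0] ennreal_leI le)
  also have "\<dots> = ennreal B" by (simp add: Liminf_const)
  finally have *: "(\<integral>\<^sup>+x. ennreal ((cmod (g x))\<^sup>2) \<partial>M) \<le> ennreal B" .
  then have "integrable M (\<lambda>x. (cmod (g x))\<^sup>2)"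
    using g by (intro integrableI_nonneg) (auto simp: less_top[symmetric] top_unique)
  then show 1: "g \<in> sqi M" using g by (simp add: sqi_def)
  show "nsq M g \<le> B" using * B unfolding nn_integral_eq_nsq[OF 1] by simp
qed

text \<open>Fatou's lemma for \<open>f n - g\<close> bounds the squared distance of \<open>h\<close>
  and \<open>g\<close> by every positive number.\<close>

lemma nsq_limit_eq_pointwise_limit:
  assumes f: "\<And>n. f n \<in> sqi M" and g: "g \<in> sqi M" and h: "h \<in> borel_measurable M"
    and lim: "(\<lambda>n. nsq M (f n - g)) \<longlonglongrightarrow> 0" and pw: "AE x in M. (\<lambda>n. f n x) \<longlonglongrightarrow> h x"
  shows "AE x in M. h x = g x"
proof -
  have hm: "h - g \<in> borel_measurable M"
    unfolding fun_diff_def using h g[THEN sqi_measurable] by measurable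
  have pw': "AE x in M. (\<lambda>n. (f n - g) x) \<longlonglongrightarrow> (h - g) x"
    using pw by eventually_elim (simp add: tendsto_diff)
  have *: "h - g \<in> sqi M \<and> nsq M (h - g) \<le> e" if e: "e > 0" for e
  proof -
    obtain n0 where "\<And>n. n \<ge> n0 \<Longrightarrow> nsq M (f n - g) \<le> e"
      using order_tendstoD(2)[OF lim e] unfolding eventually_sequentially by (meson less_imp_le)
    then show ?thesis using sqi_fatou[OF _ hm pw', of n0 e] f g by (meson sqi_diff)
  qed
  have "nsq M (h - g) \<le> 0" by (rule field_le_epsilon) (use * in auto)
  then have "nsq M (h - g) = 0" using nsq_nonneg[of M "h - g"] by linarith
  then show ?thesis using * nsq_eq_0_iff[of "h - g" M] by (auto intro: zero_less_one)
qed

text \<open>The squared increments of a fast subsequence are weighted by 2 ^ j. The integrals of the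
  weighted squares still form a convergent series, and the weights are large enough to make the
  increments themselves absolutely summable almost everywhere.\<close>

theorem riesz_fischer:
  assumes f: "\<And>n. f n \<in> sqi M"
    and cauchy: "\<And>e. e > 0 \<Longrightarrow> \<exists>N. \<forall>m\<ge>N. \<forall>n\<ge>N. nsq M (f m - f n) < e"
  obtains g where "g \<in> sqi M" "(\<lambda>n. nsq M (f n - g)) \<longlonglongrightarrow> 0"
proof -
  note [measurable] = f[THEN sqi_measurable]
  obtain N where N: "\<And>j m n. m \<ge> N j \<Longrightarrow> n \<ge> N j \<Longrightarrow> nsq M (f m - f n) < (1/4) ^ j"
    using cauchy[of "(1/4) ^ _"] by (metis zero_less_divide_1_iff zero_less_numeral zero_less_power)
  \<comment> \<open>The maximum makes the indices strictly increasing as well as large enough for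
    the j-th Cauchy bound.\<close>
  define r where "r = rec_nat (N 0) (\<lambda>j rj. max (Suc rj) (N (Suc j)))"
  have r_Suc: "r (Suc j) = max (Suc (r j)) (N (Suc j))" for j by (simp add: r_def)
  have rN: "r j \<ge> N j" for j by (cases j) (auto simp: r_def)
  have r_mono: "strict_mono r" by (auto simp: strict_mono_Suc_iff r_Suc less_max_iff_disj)
  define D where "D j x = f (r (Suc j)) x - f (r j) x" for j x
  have D_eq: "D j = f (r (Suc j)) - f (r j)" for j by (auto simp: D_def)
  have [measurable]: "D j \<in> borel_measurable M" for j unfolding D_def by measurable
  have Dsqi: "D j \<in> sqi M" for j unfolding D_eq using f by auto
  have Dle: "nsq M (D j) \<le> (1/4) ^ j" for j unfolding D_eq
    using N[of j "r (Suc j)" "r j"] rN[of j] rN[of "Suc j"] r_mono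
    by (metis less_imp_le order_trans strict_mono_less lessI)
  have "(\<integral>\<^sup>+x. (\<Sum>j. ennreal (2 ^ j * (cmod (D j x))\<^sup>2)) \<partial>M)
      = (\<Sum>j. \<integral>\<^sup>+x. ennreal (2 ^ j * (cmod (D j x))\<^sup>2) \<partial>M)"
    by (rule nn_integral_suminf) measurable
  also have "\<dots> \<le> (\<Sum>j. ennreal ((1/2) ^ j))"
  proof (rule suminf_le)
    fix j
    have "(\<integral>\<^sup>+x. ennreal (2 ^ j * (cmod (D j x))\<^sup>2) \<partial>M) = ennreal (2 ^ j) * ennreal (nsq M (D j))"
      using Dsqi by (simp add: ennreal_mult nn_integral_cmult nn_integral_eq_nsq)
    also have "\<dots> \<le> ennreal (2 ^ j * (1/4) ^ j)"
      unfolding ennreal_mult'[symmetric, OF nsq_nonneg] 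
      by (subst ennreal_mult[symmetric]) (auto intro!: ennreal_leI mult_left_mono Dle)
    also have "2 ^ j * (1/4) ^ j = (1/2 :: real) ^ j"
      by (simp add: power_mult_distrib[symmetric])
    finally show "(\<integral>\<^sup>+x. ennreal (2 ^ j * (cmod (D j x))\<^sup>2) \<partial>M) \<le> ennreal ((1/2) ^ j)" .
  qed auto
  also have "\<dots> = ennreal (\<Sum>j. (1/2) ^ j)"
    by (rule suminf_ennreal2) auto
  also have "\<dots> < \<infinity>" by simp
  finally have fin: "(\<integral>\<^sup>+x. (\<Sum>j. ennreal (2 ^ j * (cmod (D j x))\<^sup>2)) \<partial>M) \<noteq> \<infinity>" by simp
  have AEfin: "AE x in M. (\<Sum>j. ennreal (2 ^ j * (cmod (D j x))\<^sup>2)) \<noteq> \<infinity>"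
    by (rule nn_integral_PInf_AE[OF _ fin]) measurable
  have conv: "AE x in M. convergent (\<lambda>j. f (r j) x)"
    using AEfin
  proof eventually_elim
    case (elim x)
    have sm: "summable (\<lambda>j. 2 ^ j * (cmod (D j x))\<^sup>2)"
      by (rule summable_suminf_not_top) (use elim in auto)
    have "summable (\<lambda>j. 2 ^ j * (cmod (D j x))\<^sup>2 + (1/2) ^ j)"
      by (intro summable_add sm) auto
    then have "summable (\<lambda>j. D j x)"
    proof (rule summable_comparison_test'[where N = 0])
      fix j :: nat
      define a where "a = sqrt (2 ^ j)"
      have a: "a > 0" "a\<^sup>2 = 2 ^ j" by (auto simp: a_def)
      \<comment> \<open>With a squared equal to 2 ^ j, the arithmetic-geometric mean inequality
        splits an increment into its weighted square and a geometric term.\<close>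
      have "2 * ((a * cmod (D j x)) * (1 / a)) \<le> (a * cmod (D j x))\<^sup>2 + (1 / a)\<^sup>2"
        using sum_squares_bound[of "a * cmod (D j x)" "1 / a"] by (simp only: mult.assoc)
      then have "2 * cmod (D j x) \<le> 2 ^ j * (cmod (D j x))\<^sup>2 + (1/2) ^ j"
        using a by (simp add: power_mult_distrib power_divide power_one_over)
      then show "norm (D j x) \<le> 2 ^ j * (cmod (D j x))\<^sup>2 + (1/2) ^ j"
        using norm_ge_zero[of "D j x"] by linarith
    qed
    then have "convergent (\<lambda>n. \<Sum>j<n. D j x)"
      by (simp add: summable_iff_convergent)
    moreover have "(\<Sum>j<n. D j x) = f (r n) x - f (r 0) x" for n
      unfolding D_def by (rule sum_lessThan_telescope)
    ultimately have "convergent (\<lambda>n. f (r n) x - f (r 0) x)" by simp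
    then show ?case using convergent_add[OF _ convergent_const[of "f (r 0) x"]] by fastforce
  qed
  define g where "g x = lim (\<lambda>j. f (r j) x)" for x
  have [measurable]: "g \<in> borel_measurable M" unfolding g_def by measurable
  have pw: "AE x in M. (\<lambda>j. f (r j) x) \<longlonglongrightarrow> g x"
    using conv by eventually_elim (simp add: g_def convergent_LIMSEQ_iff)
  \<comment> \<open>The Cauchy bound between \<open>f n\<close> and \<open>f (r i)\<close> survives
    the limit in \<open>i\<close> by Fatou's lemma. Hence the whole sequence converges, not only the
    subsequence.\<close>
  have bd: "f n - g \<in> sqi M \<and> nsq M (f n - g) \<le> (1/4) ^ j" if "n \<ge> N j" for n j
  proof -
    have m: "f n - g \<in> borel_measurable M" unfolding fun_diff_def by measurable
    have "AE x in M. (\<lambda>i. (f n - f (r i)) x) \<longlonglongrightarrow> (f n - g) x"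
      using pw by eventually_elim (auto intro!: tendsto_intros)
    moreover have "nsq M (f n - f (r i)) \<le> (1/4) ^ j" if "i \<ge> j" for i
    proof -
      have "r i \<ge> r j" using r_mono that by (simp add: strict_mono_less_eq)
      then show ?thesis using N[OF \<open>n \<ge> N j\<close>, of "r i"] rN[of j] by auto
    qed
    ultimately show ?thesis using sqi_fatou[of "\<lambda>i. f n - f (r i)" M "f n - g" j "(1/4)^j"] m f by auto
  qed
  \<comment> \<open>So far only differences with \<open>g\<close> are known to be square integrable;
    \<open>g\<close> itself is recovered from one of them.\<close>
  have "f (N 0) - (f (N 0) - g) \<in> sqi M" by (rule sqi_diff[OF f]) (use bd[of 0 "N 0"] in auto)
  then have "g \<in> sqi M" by (simp add: fun_diff_def)
  moreover have "(\<lambda>n. nsq M (f n - g)) \<longlonglongrightarrow> 0"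
  proof (rule LIMSEQ_I)
    fix e :: real assume "e > 0"
    then obtain j where "(1/4) ^ j < e" using real_arch_pow_inv[of e "1/4"] by auto
    then show "\<exists>no. \<forall>n\<ge>no. norm (nsq M (f n - g) - 0) < e"
      using bd[of j] by (intro exI[of _ "N j"]) force
  qed
  ultimately show ?thesis using that by blast
qed

section \<open>The tiling of space by translates of the torus\<close>

lemma of_int_vec_nth [simp]: "of_int_vec l $ i = of_int (l $ i)"
  by (simp add: of_int_vec_def)

lemma of_int_vec_add: "of_int_vec (l + m) = of_int_vec l + of_int_vec m"
  and of_int_vec_minus: "of_int_vec (- l) = - of_int_vec l"
  and of_int_vec_0 [simp]: "of_int_vec 0 = 0"
  by (simp_all add: vec_eq_iff)

text \<open>Halves are rounded up to fit the half-open cell \<open>torus\<close>, so that each point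
  lies in exactly one lattice translate of it.\<close>

definition round_vec :: "real ^ 'k \<Rightarrow> int ^ 'k" where
  "round_vec x = (\<chi> i. \<lfloor>x $ i + 1 / 2\<rfloor>)"

lemma round_vec_eq_iff: "round_vec x = l \<longleftrightarrow> x - of_int_vec l \<in> torus"
proof -
  have "\<lfloor>x $ i + 1 / 2\<rfloor> = l $ i \<longleftrightarrow> - 1 / 2 \<le> x $ i - l $ i \<and> x $ i - l $ i < 1 / 2" for i
    by (simp add: floor_eq_iff) linarith
  then show ?thesis by (simp add: round_vec_def torus_def vec_eq_iff)
qed

lemma diff_round_vec_in_torus: "x - of_int_vec (round_vec x) \<in> torus"
  using round_vec_eq_iff by blast

lemma round_vec_torus_add: "x \<in> torus \<Longrightarrow> round_vec (x + of_int_vec l) = l"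
  by (simp add: round_vec_eq_iff)

lemma torus_subset_cbox: "(torus :: (real ^ 'k) set) \<subseteq> cbox (\<chi> i. - 1 / 2) (\<chi> i. 1 / 2)"
  by (auto simp: torus_def mem_box_cart less_imp_le)

lemma box_subset_torus: "box (\<chi> i. - 1 / 2) (\<chi> i. 1 / 2) \<subseteq> (torus :: (real ^ 'k) set)"
  by (auto simp: torus_def mem_box_cart less_imp_le)

lemma negligible_cbox_diff_torus:
  "negligible (cbox (\<chi> i. - 1 / 2) (\<chi> i. 1 / 2) - (torus :: (real ^ 'k) set))"
  by (rule negligible_subset[OF negligible_frontier_interval]) (use box_subset_torus in blast)

lemma torus_sets [measurable, simp]: "(torus :: (real ^ 'k) set) \<in> sets lebesgue"
proof -
  have "(torus :: (real ^ 'k) set) = cbox (\<chi> i. - 1 / 2) (\<chi> i. 1 / 2) - (cbox (\<chi> i. - 1 / 2) (\<chi> i. 1 / 2) - torus)"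
    using torus_subset_cbox by blast
  then show ?thesis
    using negligible_cbox_diff_torus negligible_imp_sets by (metis lmeasurable_cbox fmeasurableD sets.Diff)
qed

lemma space_torus [simp]: "space torus_measure = torus"
  by (simp add: space_restrict_space)

lemma emeasure_torus: "emeasure lebesgue (torus :: (real ^ 'k) set) = 1"
proof -
  let ?C = "cbox (\<chi> i. - 1 / 2) (\<chi> i. 1 / 2) :: (real ^ 'k) set"
  have "emeasure lebesgue (torus :: (real ^ 'k) set) = emeasure lebesgue ?C"
  proof (rule emeasure_eq_AE)
    have "AE x in lebesgue. x \<notin> ?C - torus"
      using negligible_cbox_diff_torus negligible_iff_null_sets AE_not_in by blast
    then show "AE x in lebesgue. x \<in> torus \<longleftrightarrow> x \<in> ?C"
      by eventually_elim (use torus_subset_cbox in auto)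
  qed auto
  also have "\<dots> = 1"
    by (simp add: emeasure_lborel_cbox_eq inner_axis Basis_vec_def prod.UNION_disjoint axis_eq_axis)
  finally show ?thesis .
qed

lemma emeasure_torus_measure: "emeasure torus_measure (torus :: (real ^ 'k) set) = 1"
  by (simp add: emeasure_restrict_space emeasure_torus)

interpretation torus: finite_measure "torus_measure :: (real ^ 'k) measure"
  by standard (simp add: emeasure_torus_measure)

lemma measure_torus [simp]: "measure torus_measure (torus :: (real ^ 'k) set) = 1"
  by (simp add: measure_def emeasure_torus_measure)

interpretation int_vec_count: sigma_finite_measure "count_space (UNIV :: (int ^ 'k) set)"
  by (rule sigma_finite_measure_count_space)

lemma measurable_translate [measurable]: "(\<lambda>x. x + a) \<in> lebesgue \<rightarrow>\<^sub>M (lebesgue :: (real ^ 'k) measure)"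
proof (rule measurableI)
  fix A :: "(real ^ 'k) set" assume "A \<in> sets lebesgue"
  then have "(+) (- a) ` A \<in> sets lebesgue" by (rule lebesgue_sets_translation)
  also have "(+) (- a) ` A = (\<lambda>x. x + a) -` A \<inter> space lebesgue"
    by (auto simp: image_iff intro!: bexI[of _ "_ + a"])
  finally show "(\<lambda>x. x + a) -` A \<inter> space lebesgue \<in> sets lebesgue" .
qed simp

lemma measurable_translate_diff [measurable]: "(\<lambda>x. x - a) \<in> lebesgue \<rightarrow>\<^sub>M (lebesgue :: (real ^ 'k) measure)"
  using measurable_translate[of "- a"] by simp

lemma emeasure_lebesgue_vimage_add:
  assumes "A \<in> sets lebesgue"
  shows "emeasure lebesgue ((\<lambda>x. x + a) -` A) = emeasure lebesgue (A :: (real ^ 'k) set)"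
proof -
  have "(\<lambda>x. x + a) -` A = (\<lambda>x. 1 *\<^sub>R x + (- a)) ` A"
    by (auto simp: image_iff intro!: bexI[of _ "_ + a"])
  then show ?thesis by (simp only: emeasure_lebesgue_affine) simp
qed

lemma distr_lebesgue_add: "distr lebesgue lebesgue (\<lambda>x. x + a) = (lebesgue :: (real ^ 'k) measure)"
  by (rule measure_eqI) (simp_all add: emeasure_distr emeasure_lebesgue_vimage_add)

lemma measurable_round_vec [measurable]: "round_vec \<in> lebesgue \<rightarrow>\<^sub>M count_space (UNIV :: (int ^ 'k) set)"
proof -
  have "round_vec -` {l} \<in> sets lebesgue" for l :: "int ^ 'k"
  proof -
    have "round_vec -` {l} = (\<lambda>x. x - of_int_vec l) -` torus \<inter> space lebesgue"
      using diff_round_vec_in_torus by (auto simp: round_vec_eq_iff)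
    then show ?thesis by (metis measurable_sets measurable_translate_diff torus_sets)
  qed
  then show ?thesis by (simp add: measurable_count_space_eq2_countable)
qed

text \<open>An l^2-valued function on the torus is treated as a scalar function on this product; its
  norm, inner product and completeness are then those of \<open>sqi\<close>.\<close>

definition fib_measure :: "((real ^ 'k) \<times> (int ^ 'k)) measure" where
  "fib_measure = torus_measure \<Otimes>\<^sub>M count_space UNIV"

interpretation fib: pair_sigma_finite "torus_measure :: (real ^ 'k) measure" "count_space (UNIV :: (int ^ 'k) set)"
  by standard

abbreviation tile :: "(real ^ 'k) \<times> (int ^ 'k) \<Rightarrow> real ^ 'k" where
  "tile z \<equiv> fst z + of_int_vec (snd z)"

lemma measurable_fib_measureI:
  assumes "\<And>l. (\<lambda>x. f (x, l)) \<in> torus_measure \<rightarrow>\<^sub>M N"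
  shows "f \<in> (fib_measure :: ((real ^ 'k) \<times> (int ^ 'k)) measure) \<rightarrow>\<^sub>M N"
proof -
  have "(\<lambda>z. f (fst z, snd z)) \<in> fib_measure \<rightarrow>\<^sub>M N"
    unfolding fib_measure_def
    by (rule measurable_compose_countable[where f = "\<lambda>l z. f (fst z, l)"])
      (auto intro: measurable_compose[OF measurable_fst assms])
  then show ?thesis by simp
qed

lemma measurable_fib_measureD:
  assumes "f \<in> (fib_measure :: ((real ^ 'k) \<times> (int ^ 'k)) measure) \<rightarrow>\<^sub>M N"
  shows "(\<lambda>x. f (x, l)) \<in> torus_measure \<rightarrow>\<^sub>M N"
  using assms unfolding fib_measure_def by measurable

lemma measurable_tile [measurable]:
  "(tile :: (real ^ 'k) \<times> (int ^ 'k) \<Rightarrow> _) \<in> fib_measure \<rightarrow>\<^sub>M lebesgue"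
  by (rule measurable_fib_measureI) (auto intro!: measurable_restrict_space1)

text \<open>The lattice translates of the torus partition space and Lebesgue measure is translation
  invariant. Rearranging a function into fibers is therefore an isometry.\<close>

lemma distr_tile:
  "distr fib_measure lebesgue tile = (lebesgue :: (real ^ 'k) measure)"
proof (rule measure_eqI)
  fix A :: "(real ^ 'k) set" assume "A \<in> sets (distr fib_measure lebesgue tile)"
  then have A [measurable]: "A \<in> sets lebesgue" by simp
  \<comment> \<open>The part of \<open>A\<close> in the cell around \<open>l\<close>; the sections
    of the preimage of \<open>A\<close> are these parts moved back to the torus.\<close>
  define X where "X l = (\<lambda>x. x - of_int_vec l) -` torus \<inter> A" for l :: "int ^ 'k"
  have X [measurable]: "X l \<in> sets lebesgue" for l
    unfolding X_def using measurable_sets[OF measurable_translate_diff torus_sets] by auto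
  have "emeasure (distr fib_measure lebesgue tile) A = emeasure fib_measure (tile -` A \<inter> space fib_measure)"
    by (rule emeasure_distr) auto
  also have "\<dots> = (\<integral>\<^sup>+l. emeasure torus_measure ((\<lambda>x. (x, l)) -` (tile -` A \<inter> space fib_measure)) \<partial>count_space UNIV)"
    using measurable_sets[OF measurable_tile A] unfolding fib_measure_def
    by (rule fib.emeasure_pair_measure_alt2)
  also have "\<dots> = (\<integral>\<^sup>+l. emeasure lebesgue (X l) \<partial>count_space UNIV)"
  proof (rule nn_integral_cong)
    fix l :: "int ^ 'k"
    have eq: "(\<lambda>x. (x, l)) -` (tile -` A \<inter> space fib_measure) = (\<lambda>x. x + of_int_vec l) -` X l"
      by (auto simp: fib_measure_def space_pair_measure X_def)
    have "(\<lambda>x. x + of_int_vec l) -` X l \<in> sets lebesgue"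
      using measurable_sets[OF measurable_translate X] by auto
    moreover have "(\<lambda>x. x + of_int_vec l) -` X l \<subseteq> torus" by (auto simp: X_def)
    ultimately show "emeasure torus_measure ((\<lambda>x. (x, l)) -` (tile -` A \<inter> space fib_measure)) = emeasure lebesgue (X l)"
      unfolding eq by (simp add: emeasure_restrict_space emeasure_lebesgue_vimage_add X del: emeasure_completion)
  qed
  also have "\<dots> = emeasure lebesgue (\<Union>(X ` UNIV))"
    by (rule emeasure_UN_countable[symmetric])
      (auto simp: disjoint_family_on_def X_def round_vec_eq_iff[symmetric])
  also have "\<Union>(X ` UNIV) = A"
    using diff_round_vec_in_torus by (auto simp: X_def)
  finally show "emeasure (distr fib_measure lebesgue tile) A = emeasure lebesgue A" .
qed simp

definition untile :: "real ^ 'k \<Rightarrow> (real ^ 'k) \<times> (int ^ 'k)" where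
  "untile y = (y - of_int_vec (round_vec y), round_vec y)"

lemma untile_tile: "x \<in> torus \<Longrightarrow> untile (x + of_int_vec l) = (x, l)"
  by (simp add: untile_def round_vec_torus_add)

lemma measurable_untile [measurable]: "untile \<in> lebesgue \<rightarrow>\<^sub>M (fib_measure :: ((real ^ 'k) \<times> (int ^ 'k)) measure)"
proof -
  have "(\<lambda>y. y - of_int_vec (round_vec y)) \<in> lebesgue \<rightarrow>\<^sub>M (lebesgue :: (real ^ 'k) measure)"
    by (rule measurable_compose_countable[where f = "\<lambda>l y. y - of_int_vec l"]) auto
  then have "(\<lambda>y. y - of_int_vec (round_vec y)) \<in> lebesgue \<rightarrow>\<^sub>M (torus_measure :: (real ^ 'k) measure)"
    by (intro measurable_restrict_space2) (auto simp: diff_round_vec_in_torus)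
  then show ?thesis unfolding untile_def fib_measure_def by measurable
qed

lemma AE_fib_iff:
  assumes "Measurable.pred fib_measure P"
  shows "(AE z in fib_measure. P z) \<longleftrightarrow> (AE x in torus_measure. \<forall>l::int ^ 'k. P (x, l))"
proof -
  have "{z \<in> space fib_measure. P z} \<in> sets fib_measure" using assms by simp
  then have "{z \<in> space (torus_measure \<Otimes>\<^sub>M count_space UNIV). P z} \<in> sets (torus_measure \<Otimes>\<^sub>M count_space (UNIV :: (int ^ 'k) set))"
    by (simp add: fib_measure_def)
  from fib.AE_pair_iff[of "\<lambda>x l. P (x, l)"] this show ?thesis
    unfolding fib_measure_def by (simp add: AE_count_space)
qed

lemma AE_fibD:
  assumes "AE z in fib_measure. P z"
  shows "AE x in torus_measure. \<forall>l::int ^ 'k. P (x, l)"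
  using fib.AE_pair[of P] assms unfolding fib_measure_def by (simp add: AE_count_space)

lemma sqi_fib_iff:
  assumes "g \<in> borel_measurable lebesgue"
  shows "(\<lambda>z. g (tile z)) \<in> sqi (fib_measure :: ((real ^ 'k) \<times> (int ^ 'k)) measure) \<longleftrightarrow> g \<in> sqi lebesgue"
proof -
  have "integrable (distr fib_measure lebesgue tile) (\<lambda>x. (cmod (g x))\<^sup>2) \<longleftrightarrow>
    integrable (fib_measure :: ((real ^ 'k) \<times> (int ^ 'k)) measure) (\<lambda>z. (cmod (g (tile z)))\<^sup>2)"
    by (rule integrable_distr_eq) (use assms in measurable)
  moreover have "(\<lambda>z. g (tile z)) \<in> borel_measurable fib_measure"
    using measurable_compose[OF measurable_tile assms] .
  ultimately show ?thesis using assms by (simp add: distr_tile sqi_def)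
qed

lemma nsq_fib:
  assumes "g \<in> borel_measurable lebesgue"
  shows "nsq (fib_measure :: ((real ^ 'k) \<times> (int ^ 'k)) measure) (\<lambda>z. g (tile z)) = nsq lebesgue g"
proof -
  have "nsq (distr fib_measure lebesgue (tile :: (real ^ 'k) \<times> (int ^ 'k) \<Rightarrow> _)) g = nsq fib_measure (\<lambda>z. g (tile z))"
    unfolding nsq_def by (rule integral_distr) (use assms in measurable)
  then show ?thesis by (simp add: distr_tile)
qed

section \<open>Characters of the torus\<close>

definition chr :: "int ^ 'k \<Rightarrow> real ^ 'k \<Rightarrow> complex" where
  "chr l x = cis (2 * pi * (of_int_vec l \<bullet> x))"

lemma norm_chr [simp]: "cmod (chr l x) = 1"
  by (simp add: chr_def)

lemma chr_add: "chr (l + m) x = chr l x * chr m x"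
  by (simp add: chr_def of_int_vec_add inner_add_left ring_distribs cis_mult)

lemma chr_add_right: "chr l (x + y) = chr l x * chr l y"
  by (simp add: chr_def inner_add_right ring_distribs cis_mult)

lemma chr_minus: "chr (- l) x = cnj (chr l x)"
  by (simp add: chr_def of_int_vec_minus cis_cnj)

lemma chr_diff: "chr (l - m) x = chr l x * cnj (chr m x)"
  using chr_add[of l "- m"] by (simp add: chr_minus)

lemma chr_0 [simp]: "chr 0 x = 1"
  by (simp add: chr_def)

lemma chr_of_int_vec [simp]: "chr l (of_int_vec m) = 1"
proof -
  have "of_int_vec l \<bullet> of_int_vec m = of_int (\<Sum>i\<in>UNIV. l $ i * m $ i)"
    by (simp add: inner_vec_def)
  then show ?thesis by (simp only: chr_def) (metis cis_multiple_2pi Ints_of_int)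
qed

lemma continuous_chr [continuous_intros]: "continuous_on S (chr l)"
  unfolding chr_def by (intro continuous_intros)

lemma measurable_chr_lebesgue [measurable]: "chr l \<in> borel_measurable lebesgue"
  by (rule measurable_completion) (simp add: borel_measurable_continuous_onI continuous_chr)

lemma measurable_chr [measurable]: "chr l \<in> borel_measurable torus_measure"
  by (intro measurable_restrict_space1 measurable_chr_lebesgue)

lemma sqi_chr [simp]: "chr l \<in> sqi (torus_measure :: (real ^ 'k) measure)"
  by (rule sqi_bounded[where B = 1]) (auto intro: torus.finite_measure_axioms)

text \<open>Both sides are the integral of the character over the translated cell \<open>torus + y\<close>.\<close>

lemma integral_chr_shift:
  "chr l y * (LINT x|torus_measure. chr l x) = (LINT x|torus_measure. chr l (x :: real ^ 'k))"
proof -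
  define G where "G z = indicat_real torus (z - y) *\<^sub>R chr l z" for z
  have ind: "(\<lambda>z. indicat_real torus (z - y)) \<in> borel_measurable lebesgue"
    by (rule measurable_compose[OF measurable_translate_diff]) measurable
  then have [measurable]: "G \<in> borel_measurable lebesgue"
    unfolding G_def by measurable
  have Gadd: "G (x + y) = indicat_real torus x *\<^sub>R (chr l y * chr l x)" for x
    by (simp add: G_def chr_add_right mult.commute)
  have "set_integrable lebesgue torus (\<lambda>x. chr l y * chr l x)"
    unfolding set_integrable_def
    using sqi_chr torus.integrable_const_bound[of "chr l" 1] integrable_restrict_space[of torus lebesgue "\<lambda>x. chr l y * chr l x"]
    by simp
  then have "integrable lebesgue (\<lambda>x. G (x + y))"
    by (simp add: set_integrable_def Gadd)
  then have "integrable (distr lebesgue lebesgue (\<lambda>x. x + y)) G"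
    by (subst integrable_distr_eq) auto
  then have intG: "integrable (distr fib_measure lebesgue tile) G"
    by (simp add: distr_lebesgue_add distr_tile)
  then have intP: "integrable fib_measure (\<lambda>z. G (tile z))"
    by (rule integrable_distr[OF measurable_tile])
  have "(LINT x|torus_measure. chr l y * chr l x) = (LINT x|lebesgue. G (x + y))"
    by (simp add: integral_restrict_space Gadd flip: mult_scaleR_right)
  also have "\<dots> = (LINT x|distr lebesgue lebesgue (\<lambda>x. x + y). G x)"
    by (rule integral_distr[symmetric]) auto
  also have "\<dots> = (LINT x|distr fib_measure lebesgue tile. G x)"
    by (simp add: distr_lebesgue_add distr_tile)
  also have "\<dots> = (LINT z|fib_measure. G (tile z))"
    by (rule integral_distr) auto
  also have "\<dots> = (LINT x|torus_measure. (LINT m|count_space UNIV. G (x + of_int_vec m)))"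
    using fib.integral_fst'[of "\<lambda>z. G (tile z)"] intP by (simp add: fib_measure_def)
  also have "\<dots> = (LINT x|torus_measure. chr l x)"
  proof (rule Bochner_Integration.integral_cong)
    fix x :: "real ^ 'k"
    have "G (x + of_int_vec m) = indicat_real {- round_vec (x - y)} m *\<^sub>R chr l x" for m
    proof -
      have "x + of_int_vec m - y \<in> torus \<longleftrightarrow> m = - round_vec (x - y)"
        using round_vec_eq_iff[of "x - y" "- m"] by (auto simp: of_int_vec_minus algebra_simps)
      then show ?thesis by (auto simp: G_def chr_add_right indicator_def)
    qed
    then show "(LINT m|count_space UNIV. G (x + of_int_vec m)) = chr l x" by simp
  qed simp
  finally show ?thesis by simp
qed

lemma integral_chr: "(LINT x|torus_measure. chr l (x :: real ^ 'k)) = (if l = 0 then 1 else 0)"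
proof (cases "l = 0")
  case False
  then obtain i where i: "l $ i \<noteq> 0" by (auto simp: vec_eq_iff)
  \<comment> \<open>Half a period in a coordinate where \<open>l\<close> is nonzero: the character
    equals - 1 there, so the integral equals its own negative.\<close>
  define y :: "real ^ 'k" where "y = axis i (1 / (2 * of_int (l $ i)))"
  have "of_int_vec l \<bullet> y = 1 / 2" using i by (simp add: y_def inner_axis)
  then have "2 * pi * (of_int_vec l \<bullet> y) = pi" by simp
  then have "chr l y = - 1" by (simp only: chr_def cis_pi)
  then show ?thesis using integral_chr_shift[of l y] False by simp
qed simp

lemma ip_chr: "ip torus_measure (chr l) (chr m) = (if l = (m :: int ^ 'k) then 1 else 0)"
  by (simp add: ip_def chr_diff[symmetric] integral_chr)

section \<open>Density of trigonometric polynomials\<close>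

lemma nsq_dominated_tendsto:
  assumes f: "\<And>n. f n \<in> borel_measurable M" and g: "g \<in> borel_measurable M" and w: "w \<in> sqi M"
    and lim: "AE x in M. (\<lambda>n. f n x) \<longlonglongrightarrow> g x"
    and le: "\<And>n. AE x in M. cmod (f n x) \<le> cmod (w x)"
  shows "(\<lambda>n. nsq M (f n - g)) \<longlonglongrightarrow> 0"
proof -
  note [measurable] = f g
  have le_all: "AE x in M. \<forall>n. cmod (f n x) \<le> cmod (w x)"
    using le by (simp add: AE_all_countable)
  have "(\<lambda>n. LINT x|M. (cmod (f n x - g x))\<^sup>2) \<longlonglongrightarrow> (LINT x|M. 0)"
  proof (rule integral_dominated_convergence[where w = "\<lambda>x. 4 * (cmod (w x))\<^sup>2"])
    show "integrable M (\<lambda>x. 4 * (cmod (w x))\<^sup>2)" using sqi_integrable[OF w] by simp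
    show "AE x in M. (\<lambda>n. (cmod (f n x - g x))\<^sup>2) \<longlonglongrightarrow> 0"
      using lim by eventually_elim (auto intro!: tendsto_eq_intros)
    show "AE x in M. norm ((cmod (f n x - g x))\<^sup>2) \<le> 4 * (cmod (w x))\<^sup>2" for n
      using lim le_all
    proof eventually_elim
      case (elim x)
      have "cmod (g x) \<le> cmod (w x)"
        by (rule Lim_norm_ubound[OF _ elim(1)]) (use elim(2) in auto)
      then have "cmod (f n x - g x) \<le> 2 * cmod (w x)"
        using elim(2) norm_triangle_ineq4[of "f n x" "g x"] by (smt (verit))
      then have "(cmod (f n x - g x))\<^sup>2 \<le> (2 * cmod (w x))\<^sup>2" by (intro power_mono) auto
      then show ?case by (simp add: power_mult_distrib)
    qed
  qed auto
  then show ?thesis by (simp add: nsq_def)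
qed

definition trig_poly :: "(real ^ 'k \<Rightarrow> complex) set" where
  "trig_poly = cfun.span (range chr)"

lemma trig_poly_chr: "chr l \<in> trig_poly"
  unfolding trig_poly_def by (rule cfun.span_base) simp

lemma trig_poly_add: "p \<in> trig_poly \<Longrightarrow> q \<in> trig_poly \<Longrightarrow> (\<lambda>x. p x + q x) \<in> trig_poly"
  using cfun.span_add[of p "range chr" q] by (simp add: trig_poly_def plus_fun_def)

lemma trig_poly_cmult: "p \<in> trig_poly \<Longrightarrow> (\<lambda>x. c * p x) \<in> trig_poly"
  using cfun.span_scale[of p "range chr" c] by (simp add: trig_poly_def cscale_def)

lemma trig_poly_const: "(\<lambda>x. c) \<in> trig_poly"
  using trig_poly_cmult[OF trig_poly_chr[of 0], of c] by simp

lemma trig_poly_sum: "(\<And>i. i \<in> I \<Longrightarrow> p i \<in> trig_poly) \<Longrightarrow> (\<lambda>x. \<Sum>i\<in>I. p i x) \<in> trig_poly"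
  by (induction I rule: infinite_finite_induct) (auto intro: trig_poly_const trig_poly_add)

lemma trig_poly_induct [consumes 1, case_names chr zero add scale]:
  assumes "p \<in> trig_poly" "\<And>l. P (chr l)" "P (\<lambda>x. 0)"
    "\<And>p q. P p \<Longrightarrow> P q \<Longrightarrow> P (\<lambda>x. p x + q x)" "\<And>c p. P p \<Longrightarrow> P (\<lambda>x. c * p x)"
  shows "P p"
  using assms(1) unfolding trig_poly_def
  by (rule cfun.span_induct)
    (use assms(2-) in \<open>auto simp: cfun.subspace_def zero_fun_def plus_fun_def cscale_def\<close>)

lemma trig_poly_mult:
  assumes "p \<in> trig_poly" "q \<in> trig_poly"
  shows "(\<lambda>x. p x * q x) \<in> trig_poly"
  using assms(1)
proof (induction p rule: trig_poly_induct)
  case (chr l)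
  show ?case using assms(2)
  proof (induction q rule: trig_poly_induct)
    case (chr m)
    then show ?case using trig_poly_chr[of "l + m"] by (simp add: chr_add[abs_def])
  next
    case (scale c p)
    then show ?case using trig_poly_cmult[of "\<lambda>x. chr l x * p x" c] by (simp add: mult.left_commute)
  qed (auto simp: distrib_left intro: trig_poly_const trig_poly_add)
next
  case (scale c p)
  then show ?case using trig_poly_cmult[of "\<lambda>x. p x * q x" c] by (simp add: mult.assoc)
qed (auto simp: distrib_right intro: trig_poly_const trig_poly_add)

text \<open>The span gives coefficients indexed by functions. Choosing one frequency for each
  function turns them into coefficients indexed by frequencies, without appeal to injectivity of
  \<open>chr\<close>.\<close>

lemma trig_poly_explicit:
  assumes "p \<in> trig_poly"
  obtains L a where "finite L" "p = (\<Sum>l\<in>L. cscale (a l) (chr l))"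
proof -
  obtain t r where t: "finite t" "t \<subseteq> range chr" "p = (\<Sum>f\<in>t. cscale (r f) f)"
    using assms unfolding trig_poly_def cfun.span_explicit by blast
  then obtain L where L: "inj_on chr L" "t = chr ` L" by (meson subset_image_inj)
  then have "finite L" using t(1) by (simp add: finite_image_iff)
  moreover have "p = (\<Sum>l\<in>L. cscale (r (chr l)) (chr l))"
    unfolding t(3) L(2) by (simp only: sum.reindex[OF L(1)] o_def)
  ultimately show ?thesis by (rule that)
qed

lemma trig_poly_continuous: "p \<in> trig_poly \<Longrightarrow> continuous_on S p"
  by (induction p rule: trig_poly_induct) (auto intro!: continuous_intros)

text \<open>Embeds the quotient of space by the lattice. Trigonometric polynomials are polynomials
  in the coordinates of this map and their conjugates, the form to which Stone--Weierstrass
  applies.\<close>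

definition circ :: "real ^ 'k \<Rightarrow> complex ^ 'k" where
  "circ x = (\<chi> i. cis (2 * pi * x $ i))"

lemma continuous_circ [continuous_intros]: "continuous_on S circ"
  unfolding circ_def by (intro continuous_intros)

lemma fixes i :: "'k::finite"
  shows trig_poly_cos: "(\<lambda>x. complex_of_real (cos (2 * pi * x $ i))) \<in> trig_poly"
    and trig_poly_sin: "(\<lambda>x. complex_of_real (sin (2 * pi * x $ i))) \<in> trig_poly"
proof -
  let ?l = "axis i 1 :: int ^ 'k"
  have "of_int_vec ?l = axis i 1" by (simp add: vec_eq_iff axis_def)
  then have chr: "chr ?l x = cis (2 * pi * x $ i)" for x by (simp add: chr_def inner_axis')
  have 1: "complex_of_real (cos (2 * pi * x $ i)) = (1/2) * (chr ?l x + chr (- ?l) x)"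
    and 2: "complex_of_real (sin (2 * pi * x $ i)) = (1/(2*\<i>)) * (chr ?l x + (-1) * chr (- ?l) x)" for x
    by (simp_all add: chr_minus chr complex_eq_iff)
  show "(\<lambda>x. complex_of_real (cos (2 * pi * x $ i))) \<in> trig_poly"
    unfolding 1 by (intro trig_poly_cmult trig_poly_add trig_poly_chr)
  show "(\<lambda>x. complex_of_real (sin (2 * pi * x $ i))) \<in> trig_poly"
    unfolding 2 by (intro trig_poly_cmult trig_poly_add trig_poly_chr)
qed

text \<open>For a linear function one expands \<open>circ x\<close> in coordinate vectors with
  cosines and sines as coefficients; sums and products stay within \<open>trig_poly\<close>.\<close>

lemma trig_poly_real_polynomial:
  fixes q :: "complex ^ 'k \<Rightarrow> real"
  assumes "real_polynomial_function q"
  shows "(\<lambda>x. complex_of_real (q (circ x))) \<in> trig_poly"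
  using assms
proof (induction q rule: real_polynomial_function.induct)
  case (linear f)
  then interpret f: bounded_linear f .
  have "circ x = (\<Sum>i\<in>UNIV. cos (2 * pi * x $ i) *\<^sub>R axis i 1 + sin (2 * pi * x $ i) *\<^sub>R axis i \<i>)" for x :: "real ^ 'k"
    by (simp add: vec_eq_iff circ_def axis_def sum.delta' if_distrib[of "(*\<^sub>R) _"] cong: if_cong)
      (simp add: complex_eq_iff sum.distrib)
  then have "f (circ x) = (\<Sum>i\<in>UNIV. cos (2 * pi * x $ i) * f (axis i 1) + sin (2 * pi * x $ i) * f (axis i \<i>))" for x
    by (simp add: f.sum f.add f.scaleR)
  then have "(\<lambda>x. complex_of_real (f (circ x))) =
    (\<lambda>x. \<Sum>i\<in>UNIV. complex_of_real (f (axis i 1)) * complex_of_real (cos (2 * pi * x $ i))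
        + complex_of_real (f (axis i \<i>)) * complex_of_real (sin (2 * pi * x $ i)))"
    by (simp add: mult.commute)
  then show ?case
    by (simp only:) (intro trig_poly_sum trig_poly_add trig_poly_cmult trig_poly_cos trig_poly_sin)
next
  case (mult f g)
  then show ?case using trig_poly_mult by fastforce
qed (auto intro: trig_poly_const trig_poly_add)

abbreviation cube :: "(real ^ 'k) set" where
  "cube \<equiv> cbox (\<chi> i. - 1 / 2) (\<chi> i. 1 / 2)"

abbreviation ocube :: "(real ^ 'k) set" where
  "ocube \<equiv> box (\<chi> i. - 1 / 2) (\<chi> i. 1 / 2)"

text \<open>Coordinates with the same image differ by an integer, and a nonzero integer difference
  inside the closed cube is possible only between opposite faces.\<close>

lemma circ_eqD:
  assumes "x \<in> cube" "y \<in> cube" "circ x = circ y" "x \<noteq> y"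
  shows "x \<notin> ocube" "y \<notin> ocube"
proof -
  obtain i where i: "x $ i \<noteq> y $ i" using assms(4) by (auto simp: vec_eq_iff)
  have "cis (2 * pi * x $ i) = cis (2 * pi * y $ i)"
    using assms(3) by (simp add: circ_def vec_eq_iff)
  then have "cis (2 * pi * (x $ i - y $ i)) = 1"
    by (simp add: right_diff_distrib flip: cis_divide)
  then have "cos (2 * pi * (x $ i - y $ i)) = 1" by (metis cis.simps(1) one_complex.simps(1))
  then obtain n :: int where n: "2 * pi * (x $ i - y $ i) = n * 2 * pi"
    using cos_one_2pi_int by auto
  then have n': "x $ i - y $ i = n" by simp
  have b: "- 1 / 2 \<le> x $ i" "x $ i \<le> 1 / 2" "- 1 / 2 \<le> y $ i" "y $ i \<le> 1 / 2"
    using assms(1,2) by (auto simp: mem_box_cart)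
  then have "n \<le> 1" "n \<ge> -1" "n \<noteq> 0" using n' i by linarith+
  then have "n = 1 \<or> n = -1" by auto
  then have "(x $ i = 1 / 2 \<or> x $ i = - 1 / 2) \<and> (y $ i = 1 / 2 \<or> y $ i = - 1 / 2)"
    using b n' by auto
  then show "x \<notin> ocube" "y \<notin> ocube" by (auto simp: mem_box_cart intro!: exI[of _ i])
qed

text \<open>A function that vanishes on the boundary of the cube factors through the torus, where the
  Stone--Weierstrass theorem applies.\<close>

lemma trig_poly_uniform_approx:
  fixes g :: "real ^ 'k \<Rightarrow> complex"
  assumes cont: "continuous_on cube g" and zero: "\<And>x. x \<notin> ocube \<Longrightarrow> g x = 0" and e: "e > 0"
  obtains p where "p \<in> trig_poly" "\<And>x. x \<in> cube \<Longrightarrow> cmod (g x - p x) < e"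
proof -
  \<comment> \<open>The value does not depend on the chosen preimage: distinct preimages of a point
    lie on the boundary, where \<open>g\<close> vanishes.\<close>
  define h where "h w = g (SOME x. x \<in> cube \<and> circ x = w)" for w
  have h: "h (circ x) = g x" if "x \<in> cube" for x
  proof -
    define y where "y = (SOME y. y \<in> cube \<and> circ y = circ x)"
    have "y \<in> cube \<and> circ y = circ x" unfolding y_def by (rule someI[of _ x]) (use that in simp)
    then have "g y = g x" using circ_eqD[of x y] that zero by metis
    then show ?thesis by (simp add: h_def y_def)
  qed
  have comp: "compact (circ ` cube)"
    by (rule compact_continuous_image) (auto intro: continuous_intros)
  \<comment> \<open>By compactness \<open>circ\<close> is a closed map onto its image, so continuity
    of \<open>g\<close> descends to \<open>h\<close>.\<close>
  have "closed (h -` B \<inter> circ ` cube)" if "closed B" for B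
  proof -
    have "h -` B \<inter> circ ` cube = circ ` (cube \<inter> g -` B)" using h by auto
    moreover have "compact (cube \<inter> g -` B)"
      using continuous_closed_preimage[OF cont closed_cbox that] compact_cbox
      by (metis Int_left_absorb closed_Int_compact compact_Int_closed inf.commute)
    ultimately show ?thesis
      by (metis compact_continuous_image compact_imp_closed continuous_circ)
  qed
  then have "continuous_on (circ ` cube) h"
    using continuous_on_closed_vimage[OF compact_imp_closed[OF comp]] by blast
  from Stone_Weierstrass_polynomial_function[OF comp this e]
  obtain q where q: "polynomial_function q" "\<And>w. w \<in> circ ` cube \<Longrightarrow> cmod (h w - q w) < e"
    by blast
  have "real_polynomial_function (Re \<circ> q)" "real_polynomial_function (Im \<circ> q)"
    using q(1) bounded_linear_Re bounded_linear_Im unfolding polynomial_function_def by blast+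
  then have "(\<lambda>x. complex_of_real (Re (q (circ x))) + \<i> * complex_of_real (Im (q (circ x)))) \<in> trig_poly"
    using trig_poly_real_polynomial by (intro trig_poly_add trig_poly_cmult) fastforce+
  then have "(\<lambda>x. q (circ x)) \<in> trig_poly" by (simp flip: complex_eq)
  moreover have "cmod (g x - q (circ x)) < e" if "x \<in> cube" for x using q(2)[of "circ x"] h that by auto
  ultimately show ?thesis using that by blast
qed

text \<open>The uniform bound is what lets dominated convergence turn the pointwise limit into a
  mean square limit. It exceeds \<open>B\<close> by the largest of the approximation errors 1 / Suc
  n.\<close>

lemma trig_poly_bounded_approx:
  fixes c :: "real ^ 'k \<Rightarrow> complex"
  assumes c: "c \<in> borel_measurable torus_measure" and B: "\<And>x. x \<in> torus \<Longrightarrow> cmod (c x) \<le> B"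
  obtains p :: "nat \<Rightarrow> real ^ 'k \<Rightarrow> complex" where "\<And>n. p n \<in> trig_poly" "\<And>n x. x \<in> torus \<Longrightarrow> cmod (p n x) \<le> B + 1"
    "AE x in torus_measure. (\<lambda>n. p n x) \<longlonglongrightarrow> c x"
proof -
  have "(0 :: real ^ 'k) \<in> torus" by (simp add: torus_def)
  then have B0: "B \<ge> 0" using B norm_ge_zero order_trans by blast
  have "c measurable_on torus" using c by (simp add: measurable_on_iff_borel_measurable)
  then obtain N g where N: "negligible N" and g: "\<And>n::nat. continuous_on UNIV (g n)"
    and lim: "\<And>x. x \<notin> N \<Longrightarrow> (\<lambda>n. g n x) \<longlonglongrightarrow> (if x \<in> torus then c x else 0)"
    unfolding measurable_on_def by blast
  \<comment> \<open>Nearest point retraction onto the disc: continuous, bounded by \<open>B\<close>,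
    and the identity on the values of \<open>c\<close>.\<close>
  define clamp where "clamp = (closest_point (cball 0 B) :: complex \<Rightarrow> complex)"
  have clamp: "continuous_on UNIV clamp"
    unfolding clamp_def by (rule continuous_on_closest_point) (use B0 in auto)
  have clamp_le: "cmod (clamp z) \<le> B" for z
    using closest_point_in_set[of "cball 0 B" z] B0 by (auto simp: clamp_def)
  have clamp_id: "clamp z = z" if "cmod z \<le> B" for z
    unfolding clamp_def by (rule closest_point_self) (use that in simp)
  \<comment> \<open>A continuous cutoff that vanishes off the open cube, as the uniform
    approximation requires, and tends to 1 inside. The boundary lost in this way is a null
    set.\<close>
  define \<kappa> where "\<kappa> n x = min 1 (real n * infdist x (- ocube))" for n and x :: "real ^ 'k"
  have k01: "0 \<le> \<kappa> n x" "\<kappa> n x \<le> 1" for n x by (auto simp: \<kappa>_def infdist_nonneg)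
  have ne: "- ocube \<noteq> ({} :: (real ^ 'k) set)"
    using bounded_box[of "(\<chi> i. - 1 / 2) :: real ^ 'k" "\<chi> i. 1 / 2"] not_bounded_UNIV
    by (metis Compl_eq_Diff_UNIV Diff_eq_empty_iff UNIV_I bounded_subset subsetI)
  have k0: "\<kappa> n x = 0" if "x \<notin> ocube" for n x
    using that by (simp add: \<kappa>_def)
  have klim: "(\<lambda>n. \<kappa> n x) \<longlonglongrightarrow> 1" if x: "x \<in> ocube" for x
  proof -
    have "closed (- ocube :: (real ^ 'k) set)" using open_box closed_Compl by blast
    then have pos: "infdist x (- ocube) > 0"
      using in_closed_iff_infdist_zero[OF _ ne] x infdist_nonneg[of x "- ocube"] by (metis ComplD order_le_less)
    then obtain m :: nat where m: "1 < real m * infdist x (- ocube)" using reals_Archimedean3 by blast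
    have "\<kappa> n x = 1" if "n \<ge> m" for n
    proof -
      have "real m * infdist x (- ocube) \<le> real n * infdist x (- ocube)"
        using that pos by (intro mult_right_mono) auto
      then show ?thesis using m by (simp add: \<kappa>_def)
    qed
    then show ?thesis by (intro tendsto_eventually) (auto simp: eventually_sequentially)
  qed
  define f where "f n x = \<kappa> n x *\<^sub>R clamp (g n x)" for n x
  have contf: "continuous_on cube (f n)" for n
    unfolding f_def \<kappa>_def
    by (intro continuous_intros continuous_on_infdist continuous_on_compose2[OF clamp] continuous_on_subset[OF g]) auto
  have f0: "f n x = 0" if "x \<notin> ocube" for n x using that k0 by (simp add: f_def)
  have f_le: "cmod (f n x) \<le> B" for n x
    using mult_mono[OF k01(2) clamp_le[of "g n x"], of n x] B0 k01(1)[of n x] by (simp add: f_def)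
  have "\<exists>p. p \<in> trig_poly \<and> (\<forall>x\<in>cube. cmod (f n x - p x) < 1 / Suc n)" for n
    by (rule trig_poly_uniform_approx[OF contf f0, of "1 / Suc n"]) auto
  then obtain p where p: "\<And>n. p n \<in> trig_poly" "\<And>n x. x \<in> cube \<Longrightarrow> cmod (f n x - p n x) < 1 / Suc n"
    by metis
  show ?thesis
  proof
    show "p n \<in> trig_poly" for n by (rule p)
  next
    fix n and x :: "real ^ 'k" assume "x \<in> torus"
    then have "cmod (f n x - p n x) < 1 / Suc n" using torus_subset_cbox by (intro p) auto
    moreover have "1 / Suc n \<le> (1 :: real)" by simp
    ultimately have "cmod (f n x - p n x) \<le> 1" by linarith
    then show "cmod (p n x) \<le> B + 1"
      using f_le[of n x] norm_triangle_sub[of "p n x" "f n x"] by (simp add: norm_minus_commute)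
  next
    have "negligible (N \<union> (cube - ocube))"
      by (intro negligible_Un N negligible_frontier_interval)
    then have "AE x in lebesgue. x \<notin> N \<union> (cube - ocube)"
      using negligible_iff_null_sets AE_not_in by blast
    then have "AE x in lebesgue. x \<in> torus \<longrightarrow> (\<lambda>n. p n x) \<longlonglongrightarrow> c x"
    proof eventually_elim
      case (elim x)
      show ?case
      proof
        assume x: "x \<in> torus"
        then have xc: "x \<in> cube" using torus_subset_cbox by blast
        have "(\<lambda>n. clamp (g n x)) \<longlonglongrightarrow> clamp (c x)"
          using lim[of x] elim x by (intro continuous_on_tendsto_compose[OF clamp]) auto
        then have "(\<lambda>n. f n x) \<longlonglongrightarrow> 1 *\<^sub>R clamp (c x)"
          unfolding f_def using elim xc by (intro tendsto_scaleR klim) auto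
        then have 1: "(\<lambda>n. f n x) \<longlonglongrightarrow> c x" using clamp_id B x by simp
        have "(\<lambda>n. p n x - f n x) \<longlonglongrightarrow> 0"
          by (rule Lim_null_comparison[OF _ LIMSEQ_Suc[OF lim_1_over_n]])
            (use p(2)[OF xc] in \<open>auto simp: norm_minus_commute less_imp_le\<close>)
        from tendsto_add[OF this 1] show "(\<lambda>n. p n x) \<longlonglongrightarrow> c x" by simp
      qed
    qed
    then show "AE x in torus_measure. (\<lambda>n. p n x) \<longlonglongrightarrow> c x"
      by (simp add: AE_restrict_space_iff)
  qed
qed

lemma trig_poly_measurable [measurable_dest]: "p \<in> trig_poly \<Longrightarrow> p \<in> borel_measurable torus_measure"
  by (intro continuous_imp_measurable_on_sets_lebesgue trig_poly_continuous) auto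

lemma trig_poly_sqi: "p \<in> trig_poly \<Longrightarrow> p \<in> sqi (torus_measure :: (real ^ 'k) measure)"
  by (erule trig_poly_explicit) (auto intro: sqi_sum)

text \<open>Truncating the values of \<open>g\<close> at a height \<open>m\<close> brings it into
  the range of the bounded approximation.\<close>

lemma trig_poly_dense:
  assumes g: "g \<in> sqi (torus_measure :: (real ^ 'k) measure)" and e: "e > 0"
  obtains p where "p \<in> trig_poly" "nsq torus_measure (g - p) < e"
proof -
  note [measurable] = sqi_measurable[OF g]
  define c where "c m x = (if cmod (g x) \<le> real m then g x else 0)" for m x
  have [measurable]: "c m \<in> borel_measurable torus_measure" for m unfolding c_def by measurable
  have cs: "c m \<in> sqi torus_measure" for m
    by (rule sqi_dominated[OF g, of _ 1]) (auto simp: c_def)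
  have "(\<lambda>m. nsq torus_measure (c m - g)) \<longlonglongrightarrow> 0"
  proof (rule nsq_dominated_tendsto[OF _ _ g])
    have "(\<lambda>m. c m x) \<longlonglongrightarrow> g x" for x
    proof (rule tendsto_eventually)
      obtain n :: nat where "cmod (g x) \<le> real n" using real_arch_simple by blast
      then show "\<forall>\<^sub>F m in sequentially. c m x = g x"
        by (auto simp: eventually_sequentially c_def intro!: exI[of _ n])
    qed
    then show "AE x in torus_measure. (\<lambda>m. c m x) \<longlonglongrightarrow> g x" by simp
  qed (auto simp: c_def)
  then have "\<forall>\<^sub>F m in sequentially. nsq torus_measure (c m - g) < e / 4"
    by (rule order_tendstoD(2)) (use e in simp)
  then obtain m where m: "nsq torus_measure (c m - g) < e / 4"
    by (meson eventually_sequentially order_refl)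
  have "\<exists>p. (\<forall>n. p n \<in> trig_poly) \<and> (\<forall>n. \<forall>x\<in>torus. cmod (p n x) \<le> real m + 1) \<and>
      (AE x in torus_measure. (\<lambda>n. p n x) \<longlonglongrightarrow> c m x)"
  proof (rule trig_poly_bounded_approx[of "c m" "real m"])
    show "cmod (c m x) \<le> real m" for x by (simp add: c_def)
  qed (fact, blast)
  then obtain p where p: "\<And>n. p n \<in> trig_poly" "\<And>n x. x \<in> torus \<Longrightarrow> cmod (p n x) \<le> real m + 1"
    "AE x in torus_measure. (\<lambda>n. p n x) \<longlonglongrightarrow> c m x"
    by blast
  have "(\<lambda>n. nsq torus_measure (p n - c m)) \<longlonglongrightarrow> 0"
  proof (rule nsq_dominated_tendsto[OF trig_poly_measurable[OF p(1)] _ _ p(3)])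
    show "(\<lambda>x. complex_of_real (real m + 1)) \<in> sqi torus_measure"
      by (rule sqi_bounded[OF torus.finite_measure_axioms, of _ "real m + 1"])
        (simp, unfold norm_of_real, simp)
    show "AE x in torus_measure. cmod (p n x) \<le> cmod (complex_of_real (real m + 1))" for n
      unfolding norm_of_real using p(2)[of _ n] by (intro AE_I2) fastforce
  qed auto
  then have "\<forall>\<^sub>F n in sequentially. nsq torus_measure (p n - c m) < e / 4"
    by (rule order_tendstoD(2)) (use e in simp)
  then obtain n where n: "nsq torus_measure (p n - c m) < e / 4"
    by (meson eventually_sequentially order_refl)
  have "nsq torus_measure (g - p n) \<le> 2 * nsq torus_measure (g - c m) + 2 * nsq torus_measure (c m - p n)"
    by (intro nsq_diff_triangle g cs trig_poly_sqi p)
  also have "\<dots> < e" using m n nsq_minus_commute[of torus_measure "c m" "p n"] nsq_minus_commute[of torus_measure g "c m"] by linarith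
  finally show ?thesis by (rule that[OF p(1)])
qed

section \<open>Parseval's identity\<close>

text \<open>One identity with two uses: taking \<open>a l\<close> to be the inner products gives
  Bessel's inequality, and arbitrary \<open>a l\<close> show that no other combination of the same
  vectors comes closer to \<open>g\<close>.\<close>

lemma orthonormal_expansion:
  assumes g: "g \<in> sqi M" and e: "\<And>l. l \<in> L \<Longrightarrow> e l \<in> sqi M" and "finite L"
    and on: "\<And>l m. l \<in> L \<Longrightarrow> m \<in> L \<Longrightarrow> ip M (e l) (e m) = (if l = m then 1 else 0)"
  shows "nsq M (g - (\<Sum>l\<in>L. cscale (a l) (e l)))
    = nsq M g - (\<Sum>l\<in>L. (cmod (ip M g (e l)))\<^sup>2) + (\<Sum>l\<in>L. (cmod (ip M g (e l) - a l))\<^sup>2)"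
proof -
  let ?p = "\<Sum>l\<in>L. cscale (a l) (e l)"
  have p: "?p \<in> sqi M" using e by (intro sqi_sum sqi_cscale)
  have 1: "ip M g ?p = (\<Sum>l\<in>L. cnj (a l) * ip M g (e l))"
    using e g by (simp add: ip_sum_right)
  have ep: "ip M (e l) ?p = cnj (a l)" if "l \<in> L" for l
  proof -
    have "ip M (e l) ?p = (\<Sum>m\<in>L. cnj (a m) * ip M (e l) (e m))"
      using e that by (simp add: ip_sum_right)
    also have "\<dots> = (\<Sum>m\<in>L. if m = l then cnj (a l) else 0)"
      by (intro sum.cong) (use on that in auto)
    finally show ?thesis using that \<open>finite L\<close> by simp
  qed
  have "ip M ?p ?p = (\<Sum>l\<in>L. a l * cnj (a l))"
    using e p by (simp add: ip_sum_left ep)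
  then have 2: "nsq M ?p = (\<Sum>l\<in>L. (cmod (a l))\<^sup>2)"
    by (simp add: ip_self complex_norm_square[symmetric] flip: of_real_power of_real_sum)
  show ?thesis using g p
    by (simp add: nsq_diff 1 2 cmod_diff_sq sum.distrib sum_subtractf sum_distrib_left mult.commute)
qed

lemma has_sum_nonneg_realI:
  fixes f :: "'a \<Rightarrow> real"
  assumes "\<And>x. f x \<ge> 0" "\<And>L. finite L \<Longrightarrow> sum f L \<le> S" "\<And>e. e > 0 \<Longrightarrow> \<exists>L. finite L \<and> S - e < sum f L"
  shows "(f has_sum S) UNIV"
  unfolding has_sum_def
proof (rule tendstoI)
  fix e :: real assume "e > 0"
  then obtain X where X: "finite X" "S - e < sum f X" using assms(3) by blast
  have "dist (sum f Y) S < e" if "finite Y" "X \<subseteq> Y" for Y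
    using X(2) sum_mono2[OF that, of f] assms(1) assms(2)[OF that(1)] by (auto simp: dist_real_def)
  then show "\<forall>\<^sub>F Y in finite_subsets_at_top UNIV. dist (sum f Y) S < e"
    using X unfolding eventually_finite_subsets_at_top by blast
qed

text \<open>Bessel's inequality bounds the finite sums from above. From below, the coefficients of
  \<open>g\<close> do at least as well as those of an approximating trigonometric polynomial with
  the same frequencies.\<close>

theorem parseval:
  assumes g: "g \<in> sqi (torus_measure :: (real ^ 'k) measure)"
  shows "((\<lambda>l. (cmod (ip torus_measure g (chr l)))\<^sup>2) has_sum nsq torus_measure g) UNIV"
proof (rule has_sum_nonneg_realI)
  fix L :: "(int ^ 'k) set" assume "finite L"
  then show "(\<Sum>l\<in>L. (cmod (ip torus_measure g (chr l)))\<^sup>2) \<le> nsq torus_measure g"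
    using orthonormal_expansion[OF g, of L chr "\<lambda>l. ip torus_measure g (chr l)"]
      nsq_nonneg[of torus_measure "g - (\<Sum>l\<in>L. cscale (ip torus_measure g (chr l)) (chr l))"]
    by (simp add: ip_chr)
next
  fix e :: real assume "e > 0"
  then obtain p where p: "p \<in> trig_poly" "nsq torus_measure (g - p) < e"
    using trig_poly_dense[OF g] by blast
  obtain L a where L: "finite L" "p = (\<Sum>l\<in>L. cscale (a l) (chr l))"
    using trig_poly_explicit[OF p(1)] by blast
  have "0 \<le> (\<Sum>l\<in>L. (cmod (ip torus_measure g (chr l) - a l))\<^sup>2)" by (simp add: sum_nonneg)
  then have "nsq torus_measure g - e < (\<Sum>l\<in>L. (cmod (ip torus_measure g (chr l)))\<^sup>2)"
    using p(2) L orthonormal_expansion[OF g, of L chr a] by (simp add: ip_chr)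
  then show "\<exists>L. finite L \<and> nsq torus_measure g - e < (\<Sum>l\<in>L. (cmod (ip torus_measure g (chr l)))\<^sup>2)"
    using L by blast
qed simp

section \<open>Plancherel's theorem\<close>

lemma sum_fun_apply: "(\<Sum>i\<in>I. f i) x = (\<Sum>i\<in>I. f i x)"
  by (induction I rule: infinite_finite_induct) auto

lemma integrable_lebesgue_shift:
  fixes h :: "real ^ 'k \<Rightarrow> 'b::{banach, second_countable_topology}"
  assumes "h \<in> borel_measurable lebesgue"
  shows "integrable lebesgue (\<lambda>x. h (x + a)) \<longleftrightarrow> integrable lebesgue h"
  using integrable_distr_eq[OF measurable_translate[of a] assms] by (simp add: distr_lebesgue_add)

lemma integral_lebesgue_shift:
  fixes h :: "real ^ 'k \<Rightarrow> 'b::{banach, second_countable_topology}"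
  assumes "h \<in> borel_measurable lebesgue"
  shows "(LINT x|lebesgue. h (x + a)) = (LINT x|lebesgue. h x)"
  using integral_distr[OF measurable_translate[of a] assms] by (simp add: distr_lebesgue_add)

text \<open>Support in finitely many cells makes the decomposition a finite sum, so that
  integrability can be checked cell by cell.\<close>

lemma
  fixes h :: "real ^ 'k \<Rightarrow> 'b::{banach, second_countable_topology}"
  assumes L: "finite L" and h: "h \<in> borel_measurable lebesgue"
    and supp: "\<And>x. round_vec x \<notin> L \<Longrightarrow> h x = 0"
    and int: "\<And>m. m \<in> L \<Longrightarrow> integrable torus_measure (\<lambda>y. h (y + of_int_vec m))"
  shows integrable_cells: "integrable lebesgue h"
    and integral_cells: "(LINT x|lebesgue. h x) = (\<Sum>m\<in>L. LINT y|torus_measure. h (y + of_int_vec m))"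
proof -
  define G where "G m z = indicat_real torus (z - of_int_vec m) *\<^sub>R h z" for m z
  have ind: "(\<lambda>z. indicat_real torus (z - of_int_vec m)) \<in> borel_measurable lebesgue" for m :: "int ^ 'k"
    by (rule measurable_compose[OF measurable_translate_diff]) measurable
  have Gm: "G m \<in> borel_measurable lebesgue" for m
    unfolding G_def using ind h by measurable
  have Gi: "integrable lebesgue (\<lambda>y. G m (y + of_int_vec m))" if "m \<in> L" for m
    using int[OF that] by (simp add: G_def integrable_restrict_space set_integrable_def)
  have Gint: "integrable lebesgue (G m)" if "m \<in> L" for m
    using Gi[OF that] integrable_lebesgue_shift[OF Gm] by blast
  have "h z = (\<Sum>m\<in>L. G m z)" for z
  proof -
    have "G m z = (if m = round_vec z then h z else 0)" for m
      by (auto simp: G_def indicator_def round_vec_eq_iff[symmetric])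
    then show ?thesis using L supp[of z] by (simp add: sum.delta)
  qed
  then have h_eq: "h = (\<lambda>z. \<Sum>m\<in>L. G m z)" by blast
  show "integrable lebesgue h" unfolding h_eq using Gint by (rule Bochner_Integration.integrable_sum)
  have "(LINT x|lebesgue. h x) = (\<Sum>m\<in>L. LINT x|lebesgue. G m x)"
    unfolding h_eq using Gint by (rule Bochner_Integration.integral_sum)
  also have "\<dots> = (\<Sum>m\<in>L. LINT y|lebesgue. G m (y + of_int_vec m))"
    by (simp add: integral_lebesgue_shift[OF Gm])
  finally show "(LINT x|lebesgue. h x) = (\<Sum>m\<in>L. LINT y|torus_measure. h (y + of_int_vec m))"
    by (simp add: G_def integral_restrict_space)
qed

lemma sqi_torus_integrable:
  assumes "f \<in> sqi (torus_measure :: (real ^ 'k) measure)" shows "integrable torus_measure f"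
  using ip_integrable[OF assms sqi_chr[of 0]] by simp

lemma sqi_cell:
  assumes "f \<in> sqi (lebesgue :: (real ^ 'k) measure)"
  shows "(\<lambda>y. f (y + of_int_vec m)) \<in> sqi torus_measure"
proof -
  note [measurable] = sqi_measurable[OF assms]
  have m: "(\<lambda>y. f (y + of_int_vec m)) \<in> borel_measurable lebesgue"
    by (rule measurable_compose[OF measurable_translate]) measurable
  have "integrable lebesgue (\<lambda>y. (cmod (f (y + of_int_vec m)))\<^sup>2)"
    using integrable_lebesgue_shift[of "\<lambda>x. (cmod (f x))\<^sup>2" "of_int_vec m"] sqi_integrable[OF assms] by simp
  from integrable_mult_indicator[OF torus_sets this]
  have "integrable torus_measure (\<lambda>y. (cmod (f (y + of_int_vec m)))\<^sup>2)"
    by (simp add: integrable_restrict_space set_integrable_def)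
  then show ?thesis using measurable_restrict_space1[OF m] by (simp add: sqi_def)
qed

lemma integrable_cis:
  assumes "integrable M f" "(\<lambda>y. cis (g y)) \<in> borel_measurable M"
  shows "integrable M (\<lambda>y. f y * cis (g y))"
  by (rule Bochner_Integration.integrable_bound[OF assms(1)]) (use assms in \<open>auto simp: norm_mult\<close>)

lemma measurable_cis_lebesgue [measurable]:
  "(\<lambda>y. cis (c * (y \<bullet> x))) \<in> borel_measurable (lebesgue :: (real ^ 'k) measure)"
proof -
  have "(\<lambda>y. cis (c * (y \<bullet> x))) \<in> borel_measurable (borel :: (real ^ 'k) measure)"
    by (intro borel_measurable_continuous_onI continuous_intros)
  then show ?thesis by (intro measurable_completion) simp
qed

lemma fourier_integrable:
  fixes f :: "real ^ 'k \<Rightarrow> complex"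
  shows "integrable lebesgue f \<Longrightarrow> integrable lebesgue (\<lambda>y. f y * cis (- 2 * pi * (y \<bullet> x)))"
  by (rule integrable_cis[OF _ measurable_cis_lebesgue])

lemma continuous_fourier:
  fixes f :: "real ^ 'k \<Rightarrow> complex"
  assumes "integrable lebesgue f" shows "continuous_on UNIV (fourier f)"
proof -
  have "(\<lambda>n. fourier f (s n)) \<longlonglongrightarrow> fourier f x" if s: "s \<longlonglongrightarrow> x" for s and x :: "real ^ 'k"
    unfolding fourier_def
  proof (rule integral_dominated_convergence[where w = "\<lambda>y. norm (f y)"])
    show "AE y in lebesgue. (\<lambda>n. f y * cis (- 2 * pi * (y \<bullet> s n))) \<longlonglongrightarrow> f y * cis (- 2 * pi * (y \<bullet> x))"
    proof (rule AE_I2)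
      fix y :: "real ^ 'k"
      have "continuous_on UNIV (\<lambda>z. f y * cis (- 2 * pi * (y \<bullet> z)))" by (intro continuous_intros)
      from continuous_on_tendsto_compose[OF this s]
      show "(\<lambda>n. f y * cis (- 2 * pi * (y \<bullet> s n))) \<longlonglongrightarrow> f y * cis (- 2 * pi * (y \<bullet> x))" by simp
    qed
  qed (use assms fourier_integrable[OF assms] in \<open>auto simp: norm_mult\<close>)
  then show ?thesis by (simp add: continuous_on_sequentially o_def)
qed

lemma measurable_fourier: "integrable lebesgue f \<Longrightarrow> fourier f \<in> borel_measurable lebesgue"
  by (rule measurable_completion) (simp add: borel_measurable_continuous_onI continuous_fourier)

lemma fourier_add:
  "integrable lebesgue f \<Longrightarrow> integrable lebesgue g \<Longrightarrow> fourier (f + g) = fourier f + fourier g"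
  using fourier_integrable[of f] fourier_integrable[of g]
  by (auto simp: fourier_def fun_eq_iff distrib_right)

lemma fourier_cscale: "fourier (cscale c f) = cscale c (fourier f)"
  by (auto simp: fourier_def fun_eq_iff mult.assoc)

lemma fourier_diff:
  assumes "integrable lebesgue f" "integrable lebesgue g"
  shows "fourier (f - g) = fourier f - fourier g"
  using fourier_integrable[OF assms(1)] fourier_integrable[OF assms(2)]
  by (auto simp: fourier_def fun_eq_iff left_diff_distrib)

text \<open>The samples \<open>fourier f (x + l)\<close> are the Fourier coefficients, on a single cell, of the sum of the
  pieces of \<open>f\<close> modulated by characters of \<open>x\<close>; so the right-hand side below is a trigonometric
  polynomial in \<open>x\<close>.\<close>

lemma fourier_samples_has_sum:
  fixes f :: "real ^ 'k \<Rightarrow> complex"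
  assumes f: "f \<in> sqi lebesgue" and L: "finite L" and supp: "\<And>x. round_vec x \<notin> L \<Longrightarrow> f x = 0"
  shows "((\<lambda>l. (cmod (fourier f (x + of_int_vec l)))\<^sup>2) has_sum
    nsq torus_measure (\<Sum>m\<in>L. cscale (cnj (chr m x)) (\<lambda>y. f (y + of_int_vec m)))) UNIV"
proof -
  \<comment> \<open>The factor of the exponential that depends on \<open>x\<close> and on the
    position inside the cell. Having modulus 1, it drops out of the norm.\<close>
  define e :: "real ^ 'k \<Rightarrow> complex" where "e y = cis (- 2 * pi * (y \<bullet> x))" for y
  have [measurable]: "e \<in> borel_measurable lebesgue" unfolding e_def by measurable
  have em [measurable]: "e \<in> borel_measurable torus_measure" by (rule measurable_restrict_space1) measurable
  have ne [simp]: "cmod (e y) = 1" for y by (simp add: e_def)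
  note [measurable] = sqi_measurable[OF f]
  define P where "P = (\<Sum>m\<in>L. cscale (cnj (chr m x)) (\<lambda>y. f (y + of_int_vec m)))"
  have P: "P \<in> sqi torus_measure"
    unfolding P_def by (intro sqi_sum sqi_cscale sqi_cell f)
  have Pe: "(\<lambda>y. P y * e y) \<in> sqi torus_measure"
    using sqi_measurable[OF P] by (intro sqi_dominated[OF P, of _ 1]) (auto simp: norm_mult)
  have "fourier f (x + of_int_vec l) = ip torus_measure (\<lambda>y. P y * e y) (chr l)" for l
  proof -
    let ?h = "\<lambda>z. f z * cis (- 2 * pi * (z \<bullet> (x + of_int_vec l)))"
    \<comment> \<open>The inner product of two lattice vectors contributes a factor 1. Hence
      \<open>l\<close> enters through the same character in every cell, and the cell enters only
      through \<open>chr m x\<close>.\<close>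
    have ph: "?h (y + of_int_vec m) = (cnj (chr m x) * f (y + of_int_vec m)) * e y * cnj (chr l y)" for y m
    proof -
      have "(y + of_int_vec m) \<bullet> (x + of_int_vec l) = y \<bullet> x + of_int_vec l \<bullet> y + of_int_vec m \<bullet> x + of_int_vec m \<bullet> of_int_vec l"
        by (simp add: inner_add_left inner_add_right inner_commute)
      then have "cis (- 2 * pi * ((y + of_int_vec m) \<bullet> (x + of_int_vec l)))
        = e y * cnj (chr l y) * cnj (chr m x) * cnj (chr m (of_int_vec l))"
        unfolding e_def chr_def cis_cnj cis_mult by (simp add: algebra_simps)
      then show ?thesis by (simp add: mult_ac)
    qed
    have int: "integrable torus_measure (\<lambda>y. cnj (chr m x) * f (y + of_int_vec m) * e y * cnj (chr l y))" for m
    proof -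
      have "(\<lambda>y. cnj (chr m x) * f (y + of_int_vec m) * e y) \<in> sqi torus_measure"
        using sqi_measurable[OF sqi_cell[OF f, of m]]
        by (intro sqi_dominated[OF sqi_cell[OF f, of m], of _ 1]) (auto simp: norm_mult)
      from ip_integrable[OF this sqi_chr[of l]] show ?thesis by simp
    qed
    have "fourier f (x + of_int_vec l) = (\<Sum>m\<in>L. LINT y|torus_measure. ?h (y + of_int_vec m))"
      unfolding fourier_def
    proof (rule integral_cells[OF L])
      show "?h \<in> borel_measurable lebesgue" by measurable
      show "integrable torus_measure (\<lambda>y. ?h (y + of_int_vec m))" for m
        unfolding ph by (rule int)
    qed (simp add: supp)
    also have "\<dots> = (LINT y|torus_measure. (\<Sum>m\<in>L. cnj (chr m x) * f (y + of_int_vec m) * e y * cnj (chr l y)))"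
      unfolding ph using int by (intro Bochner_Integration.integral_sum[symmetric])
    also have "\<dots> = ip torus_measure (\<lambda>y. P y * e y) (chr l)"
      by (simp add: ip_def P_def sum_fun_apply sum_distrib_right)
    finally show ?thesis .
  qed
  then have "((\<lambda>l. (cmod (fourier f (x + of_int_vec l)))\<^sup>2) has_sum nsq torus_measure (\<lambda>y. P y * e y)) UNIV"
    using parseval[OF Pe] by simp
  moreover have "nsq torus_measure (\<lambda>y. P y * e y) = nsq torus_measure P"
    by (simp add: nsq_def norm_mult)
  ultimately show ?thesis by (simp add: P_def)
qed

lemma has_sum_nn_integral:
  fixes f :: "'a \<Rightarrow> real"
  assumes "(f has_sum S) UNIV" "\<And>x. f x \<ge> 0"
  shows "(\<integral>\<^sup>+x. ennreal (f x) \<partial>count_space UNIV) = ennreal S"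
proof -
  have "Infinite_Set_Sum.abs_summable_on f UNIV"
    using assms abs_summable_equivalent[of f UNIV] by (auto simp: summable_on_def)
  then have "integrable (count_space UNIV) f" "infsetsum f UNIV = S"
    using infsetsum_infsum[of f UNIV] infsumI[OF assms(1)] by (auto simp: abs_summable_on_def)
  then show ?thesis
    using nn_integral_eq_integral[of "count_space UNIV" f] assms(2) by (simp add: infsetsum_def)
qed

text \<open>Parseval's identity for trigonometric polynomials with vector coefficients: expanding
  the square leaves products of characters, of which only the diagonal survives integration.\<close>

lemma mean_trig_square:
  fixes F :: "int ^ 'k \<Rightarrow> 'a \<Rightarrow> complex"
  assumes F: "\<And>m. m \<in> L \<Longrightarrow> F m \<in> sqi M" and L: "finite L"
  shows "integrable (torus_measure :: (real ^ 'k) measure) (\<lambda>x. nsq M (\<Sum>m\<in>L. cscale (cnj (chr m x)) (F m)))"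
    and "(LINT x|torus_measure. nsq M (\<Sum>m\<in>L. cscale (cnj (chr m x)) (F m))) = (\<Sum>m\<in>L. nsq M (F m))"
proof -
  have q: "complex_of_real (nsq M (\<Sum>m\<in>L. cscale (cnj (chr m x)) (F m)))
     = (\<Sum>m\<in>L. \<Sum>m'\<in>L. chr (m' - m) x * ip M (F m) (F m'))" for x :: "real ^ 'k"
    unfolding ip_self[symmetric]
    by (subst ip_sum_left)
      (use F in \<open>auto simp: ip_sum_right sqi_sum sum_distrib_left chr_diff mult_ac\<close>)
  have ci: "integrable torus_measure (\<lambda>x. chr l (x :: real ^ 'k))" for l
    by (rule sqi_torus_integrable) simp
  have "integrable torus_measure (\<lambda>x::real ^ 'k. \<Sum>m\<in>L. \<Sum>m'\<in>L. chr (m' - m) x * ip M (F m) (F m'))"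
    using ci by (intro Bochner_Integration.integrable_sum integrable_mult_left)
  then have "integrable torus_measure (\<lambda>x::real ^ 'k. complex_of_real (nsq M (\<Sum>m\<in>L. cscale (cnj (chr m x)) (F m))))"
    unfolding q .
  then show "integrable (torus_measure :: (real ^ 'k) measure) (\<lambda>x. nsq M (\<Sum>m\<in>L. cscale (cnj (chr m x)) (F m)))"
    by (simp add: complex_of_real_integrable_eq)
  have "complex_of_real (LINT x|torus_measure. nsq M (\<Sum>m\<in>L. cscale (cnj (chr m x)) (F m)))
    = (LINT x|torus_measure. (\<Sum>m\<in>L. \<Sum>m'\<in>L. chr (m' - m) (x :: real ^ 'k) * ip M (F m) (F m')))"
    unfolding q[symmetric] by (rule integral_complex_of_real[symmetric])
  also have "\<dots> = (\<Sum>m\<in>L. \<Sum>m'\<in>L. (if m = m' then 1 else 0) * ip M (F m) (F m'))"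
    using ci by (simp add: Bochner_Integration.integral_sum Bochner_Integration.integrable_sum integral_chr)
      (intro sum.cong refl, auto)
  also have "\<dots> = (\<Sum>m\<in>L. ip M (F m) (F m))"
  proof (rule sum.cong[OF refl])
    fix m assume "m \<in> L"
    have "(\<Sum>m'\<in>L. (if m = m' then 1 else 0) * ip M (F m) (F m')) = (\<Sum>m'\<in>L. if m = m' then ip M (F m) (F m') else 0)"
      by (rule sum.cong) auto
    then show "(\<Sum>m'\<in>L. (if m = m' then 1 else 0) * ip M (F m) (F m')) = ip M (F m) (F m)"
      using L \<open>m \<in> L\<close> by simp
  qed
  also have "\<dots> = complex_of_real (\<Sum>m\<in>L. nsq M (F m))" by (simp add: ip_self)
  finally show "(LINT x|torus_measure. nsq M (\<Sum>m\<in>L. cscale (cnj (chr m x)) (F m))) = (\<Sum>m\<in>L. nsq M (F m))"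
    by (simp only: of_real_eq_iff)
qed

text \<open>By the tiling, the squared norm of the transform is the integral over the torus of the
  sums of its squared samples. These are squared norms of trigonometric polynomials whose
  coefficients are the pieces of \<open>f\<close>, and their mean is the sum over the
  pieces.\<close>

lemma plancherel_finite_cells:
  fixes f :: "real ^ 'k \<Rightarrow> complex"
  assumes f: "f \<in> sqi lebesgue" and L: "finite L" and supp: "\<And>x. round_vec x \<notin> L \<Longrightarrow> f x = 0"
  shows "integrable lebesgue f" "fourier f \<in> sqi lebesgue" "nsq lebesgue (fourier f) = nsq lebesgue f"
proof -
  note [measurable] = sqi_measurable[OF f]
  show int: "integrable lebesgue f"
    by (rule integrable_cells[OF L]) (use supp sqi_cell[OF f] sqi_torus_integrable in auto)
  note [measurable] = measurable_fourier[OF int]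
  let ?q = "\<lambda>x. nsq torus_measure (\<Sum>m\<in>L. cscale (cnj (chr m x)) (\<lambda>y. f (y + of_int_vec m)))"
  have "nsq lebesgue f = (\<Sum>m\<in>L. nsq torus_measure (\<lambda>y. f (y + of_int_vec m)))"
    unfolding nsq_def
    by (rule integral_cells[OF L]) (use supp sqi_integrable[OF sqi_cell[OF f]] in auto)
  then have q: "integrable torus_measure ?q" "(LINT x|torus_measure. ?q x) = nsq lebesgue f"
    using mean_trig_square[of L "\<lambda>m y. f (y + of_int_vec m)" torus_measure] sqi_cell[OF f] L by auto
  have fm: "(\<lambda>z. ennreal ((cmod (fourier f (tile z)))\<^sup>2)) \<in> borel_measurable (fib_measure :: ((real ^ 'k) \<times> (int ^ 'k)) measure)"
    using measurable_compose[OF measurable_tile, of "\<lambda>y. ennreal ((cmod (fourier f y))\<^sup>2)"] by measurable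
  have "(\<integral>\<^sup>+y. ennreal ((cmod (fourier f y))\<^sup>2) \<partial>lebesgue)
    = (\<integral>\<^sup>+y. ennreal ((cmod (fourier f y))\<^sup>2) \<partial>distr fib_measure lebesgue tile)"
    by (simp add: distr_tile)
  also have "\<dots> = (\<integral>\<^sup>+z. ennreal ((cmod (fourier f (tile z)))\<^sup>2) \<partial>fib_measure)"
    by (rule nn_integral_distr) (simp_all add: distr_tile)
  also have "\<dots> = (\<integral>\<^sup>+x. \<integral>\<^sup>+l. ennreal ((cmod (fourier f (x + of_int_vec l)))\<^sup>2) \<partial>count_space UNIV \<partial>torus_measure)"
    using int_vec_count.nn_integral_fst[OF fm[unfolded fib_measure_def]] by (simp add: fib_measure_def)
  also have "\<dots> = (\<integral>\<^sup>+x. ennreal (?q x) \<partial>torus_measure)"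
    by (intro nn_integral_cong has_sum_nn_integral fourier_samples_has_sum f L supp) auto
  also have "\<dots> = ennreal (nsq lebesgue f)"
    using nn_integral_eq_integral[OF q(1)] q(2) by simp
  finally have nn: "(\<integral>\<^sup>+y. ennreal ((cmod (fourier f y))\<^sup>2) \<partial>lebesgue) = ennreal (nsq lebesgue f)" .
  then have "integrable lebesgue (\<lambda>y. (cmod (fourier f y))\<^sup>2)"
    by (intro integrableI_nonneg) auto
  then show s: "fourier f \<in> sqi lebesgue" by (simp add: sqi_def)
  show "nsq lebesgue (fourier f) = nsq lebesgue f"
    using nn nn_integral_eq_nsq[OF s] by simp
qed

section \<open>Extension of the Fourier transform to square integrable functions\<close>

lemma L2_eq: "L2 = sqi lebesgue"
  by (simp add: L2_def sqi_def)

lemma L2_norm_eq: "L2_norm f = sqrt (nsq lebesgue f)"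
  by (simp add: L2_norm_def nsq_def)

lemma L2_inner_eq: "L2_inner f g = ip lebesgue f g"
  by (simp add: L2_inner_def ip_def)

text \<open>An exhaustion of the lattice by finite sets; an enumeration provides one without
  reference to geometry.\<close>

definition cells :: "nat \<Rightarrow> (int ^ 'k) set" where
  "cells N = {l. to_nat l < N}"

lemma finite_cells: "finite (cells N :: (int ^ 'k) set)"
proof -
  have "cells N = (to_nat :: int ^ 'k \<Rightarrow> nat) -` {..<N}" by (auto simp: cells_def)
  then show ?thesis by (simp add: finite_vimageI)
qed

definition cut_cells :: "nat \<Rightarrow> (real ^ 'k \<Rightarrow> complex) \<Rightarrow> real ^ 'k \<Rightarrow> complex" where
  "cut_cells N f x = (if round_vec x \<in> cells N then f x else 0)"

lemma cut_eq_0: "round_vec x \<notin> cells N \<Longrightarrow> cut_cells N f x = 0"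
  by (simp add: cut_cells_def)

lemma cut_le: "cmod (cut_cells N f x) \<le> cmod (f x)"
  by (simp add: cut_cells_def)

lemma measurable_cut [measurable]:
  assumes [measurable]: "f \<in> borel_measurable lebesgue" shows "cut_cells N f \<in> borel_measurable lebesgue"
  unfolding cut_cells_def by measurable

lemma cut_sqi: "f \<in> sqi lebesgue \<Longrightarrow> cut_cells N f \<in> sqi lebesgue"
  by (rule sqi_dominated[of f _ _ 1]) (auto simp: cut_le dest: sqi_measurable)

lemma cut_pointwise: "(\<lambda>N. cut_cells N f x) \<longlonglongrightarrow> f x"
  by (rule tendsto_eventually)
    (auto simp: eventually_sequentially cut_cells_def cells_def intro!: exI[of _ "Suc (to_nat (round_vec x))"])

lemma cut_tendsto: "f \<in> sqi lebesgue \<Longrightarrow> (\<lambda>N. nsq lebesgue (cut_cells N f - f)) \<longlonglongrightarrow> 0"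
  by (rule nsq_dominated_tendsto[of _ _ _ f]) (auto simp: cut_le cut_pointwise dest: sqi_measurable)

lemma cut_integrable: "f \<in> sqi lebesgue \<Longrightarrow> integrable lebesgue (cut_cells N f)"
  and fourier_cut_sqi: "f \<in> sqi lebesgue \<Longrightarrow> fourier (cut_cells N f) \<in> sqi lebesgue"
  and nsq_fourier_cut: "f \<in> sqi lebesgue \<Longrightarrow> nsq lebesgue (fourier (cut_cells N f)) = nsq lebesgue (cut_cells N f)"
  using plancherel_finite_cells[OF cut_sqi finite_cells] cut_eq_0 by blast+

lemma nsq_fourier_cut_diff:
  assumes "f \<in> sqi lebesgue"
  shows "nsq lebesgue (fourier (cut_cells m f) - fourier (cut_cells n f)) = nsq lebesgue (cut_cells m f - cut_cells n f)"
proof -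
  have "nsq lebesgue (fourier (cut_cells m f - cut_cells n f)) = nsq lebesgue (cut_cells m f - cut_cells n f)"
  proof (rule plancherel_finite_cells(3))
    show "cut_cells m f - cut_cells n f \<in> sqi lebesgue" using assms by (intro sqi_diff cut_sqi)
    show "finite (cells m \<union> cells n :: (int ^ 'a) set)" using finite_cells by blast
  qed (auto simp: cut_cells_def)
  then show ?thesis using cut_integrable[OF assms] by (simp add: fourier_diff)
qed

text \<open>The mean square limit is determined only up to null sets, so a representative is
  chosen.\<close>

definition FT :: "(real ^ 'k \<Rightarrow> complex) \<Rightarrow> real ^ 'k \<Rightarrow> complex" where
  "FT f = (SOME g. g \<in> sqi lebesgue \<and> (\<lambda>n. nsq lebesgue (fourier (cut_cells n f) - g)) \<longlonglongrightarrow> 0)"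

lemma
  fixes f :: "real ^ 'k \<Rightarrow> complex"
  assumes f: "f \<in> sqi lebesgue"
  shows FT_sqi: "FT f \<in> sqi lebesgue"
    and FT_lim: "(\<lambda>n. nsq lebesgue (fourier (cut_cells n f) - FT f)) \<longlonglongrightarrow> 0"
proof -
  obtain g where g: "g \<in> sqi lebesgue" "(\<lambda>n. nsq lebesgue (fourier (cut_cells n f) - g)) \<longlonglongrightarrow> 0"
  proof (rule riesz_fischer[of "\<lambda>n. fourier (cut_cells n f)" lebesgue])
    fix e :: real assume "e > 0"
    then obtain N where N: "\<And>n. n \<ge> N \<Longrightarrow> nsq lebesgue (cut_cells n f - f) < e / 4"
      using order_tendstoD(2)[OF cut_tendsto[OF f], of "e / 4"] unfolding eventually_sequentially by auto
    have "nsq lebesgue (fourier (cut_cells m f) - fourier (cut_cells n f)) < e" if "m \<ge> N" "n \<ge> N" for m n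
    proof -
      have "nsq lebesgue (cut_cells m f - cut_cells n f) \<le> 2 * nsq lebesgue (cut_cells m f - f) + 2 * nsq lebesgue (f - cut_cells n f)"
        by (intro nsq_diff_triangle cut_sqi f)
      then show ?thesis
        using N[OF that(1)] N[OF that(2)] nsq_minus_commute[of lebesgue f "cut_cells n f"]
        by (simp add: nsq_fourier_cut_diff[OF f])
    qed
    then show "\<exists>N. \<forall>m\<ge>N. \<forall>n\<ge>N. nsq lebesgue (fourier (cut_cells m f) - fourier (cut_cells n f)) < e" by blast
  qed (use fourier_cut_sqi[OF f] in auto)
  then have "\<exists>g. g \<in> sqi lebesgue \<and> (\<lambda>n. nsq lebesgue (fourier (cut_cells n f) - g)) \<longlonglongrightarrow> 0"
    by blast
  then have "FT f \<in> sqi lebesgue \<and> (\<lambda>n. nsq lebesgue (fourier (cut_cells n f) - FT f)) \<longlonglongrightarrow> 0"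
    unfolding FT_def by (rule someI_ex)
  then show "FT f \<in> sqi lebesgue" "(\<lambda>n. nsq lebesgue (fourier (cut_cells n f) - FT f)) \<longlonglongrightarrow> 0" by auto
qed

lemma FT_isometry:
  assumes f: "f \<in> sqi lebesgue" shows "nsq lebesgue (FT f) = nsq lebesgue f"
proof -
  have "(\<lambda>n. nsq lebesgue (fourier (cut_cells n f))) \<longlonglongrightarrow> nsq lebesgue (FT f)"
    by (intro nsq_tendsto_nsq fourier_cut_sqi FT_sqi FT_lim f)
  moreover have "(\<lambda>n. nsq lebesgue (cut_cells n f)) \<longlonglongrightarrow> nsq lebesgue f"
    by (intro nsq_tendsto_nsq cut_sqi cut_tendsto f)
  ultimately show ?thesis unfolding nsq_fourier_cut[OF f] by (rule LIMSEQ_unique)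
qed

lemma nsq_tendsto_lincomb:
  assumes "\<And>n. f n \<in> sqi M" "f' \<in> sqi M" "\<And>n. g n \<in> sqi M" "g' \<in> sqi M"
    "(\<lambda>n. nsq M (f n - f')) \<longlonglongrightarrow> 0" "(\<lambda>n. nsq M (g n - g')) \<longlonglongrightarrow> 0"
  shows "(\<lambda>n. nsq M ((cscale a (f n) + cscale b (g n)) - (cscale a f' + cscale b g'))) \<longlonglongrightarrow> 0"
proof (rule tendsto_sandwich[OF _ _ tendsto_const])
  show "(\<lambda>n. 2 * ((cmod a)\<^sup>2 * nsq M (f n - f')) + 2 * ((cmod b)\<^sup>2 * nsq M (g n - g'))) \<longlonglongrightarrow> 0"
    by (rule tendsto_eq_intros assms refl | simp)+
  show "\<forall>\<^sub>F n in sequentially. nsq M ((cscale a (f n) + cscale b (g n)) - (cscale a f' + cscale b g'))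
    \<le> 2 * ((cmod a)\<^sup>2 * nsq M (f n - f')) + 2 * ((cmod b)\<^sup>2 * nsq M (g n - g'))"
  proof (intro always_eventually allI)
    fix n
    have "(cscale a (f n) + cscale b (g n)) - (cscale a f' + cscale b g')
      = cscale a (f n - f') + cscale b (g n - g')" by (auto simp: fun_eq_iff algebra_simps)
    then show "nsq M ((cscale a (f n) + cscale b (g n)) - (cscale a f' + cscale b g'))
      \<le> 2 * ((cmod a)\<^sup>2 * nsq M (f n - f')) + 2 * ((cmod b)\<^sup>2 * nsq M (g n - g'))"
      using nsq_add_le[of "cscale a (f n - f')" M "cscale b (g n - g')"] assms by (simp del: cfun.scale_right_diff_distrib)
  qed
qed simp

text \<open>Cutting off is exactly linear, and so is the integral transform on cut functions. Both
  sides are therefore limits of one sequence.\<close>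

lemma FT_linear:
  fixes f g :: "real ^ 'k \<Rightarrow> complex"
  assumes f: "f \<in> sqi lebesgue" and g: "g \<in> sqi lebesgue"
  shows "AE x in lebesgue. FT (cscale a f + cscale b g) x = (cscale a (FT f) + cscale b (FT g)) x"
proof -
  let ?h = "cscale a f + cscale b g"
  have h: "?h \<in> sqi lebesgue" using f g by simp
  have "cut_cells n ?h = cscale a (cut_cells n f) + cscale b (cut_cells n g)" for n
    by (auto simp: fun_eq_iff cut_cells_def)
  moreover have "integrable lebesgue (cscale a (cut_cells n f))" "integrable lebesgue (cscale b (cut_cells n g))" for n
    unfolding cscale_def using cut_integrable f g by auto
  ultimately have "fourier (cut_cells n ?h) = cscale a (fourier (cut_cells n f)) + cscale b (fourier (cut_cells n g))" for n
    by (simp add: fourier_add fourier_cscale)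
  then have "(\<lambda>n. nsq lebesgue (fourier (cut_cells n ?h) - (cscale a (FT f) + cscale b (FT g)))) \<longlonglongrightarrow> 0"
    using nsq_tendsto_lincomb[OF fourier_cut_sqi[OF f] FT_sqi[OF f] fourier_cut_sqi[OF g] FT_sqi[OF g]
        FT_lim[OF f] FT_lim[OF g], of a b] by simp
  then show ?thesis
    by (intro nsq_limit_unique[of "\<lambda>n. fourier (cut_cells n ?h)"] fourier_cut_sqi FT_lim FT_sqi h sqi_add sqi_cscale f g)
qed

text \<open>Along the cutoffs the integrals converge at every point by dominated convergence, and in
  mean square to \<open>FT f\<close>.\<close>

lemma FT_eq_fourier:
  fixes f :: "real ^ 'k \<Rightarrow> complex"
  assumes f: "f \<in> sqi lebesgue" and int: "integrable lebesgue f"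
  shows "AE x in lebesgue. fourier f x = FT f x"
proof (rule nsq_limit_eq_pointwise_limit[OF _ _ _ FT_lim[OF f]])
  have "(\<lambda>n. fourier (cut_cells n f) x) \<longlonglongrightarrow> fourier f x" for x
    unfolding fourier_def
  proof (rule integral_dominated_convergence[where w = "\<lambda>y. norm (f y)"])
    show "AE y in lebesgue. (\<lambda>n. cut_cells n f y * cis (- 2 * pi * (y \<bullet> x))) \<longlonglongrightarrow> f y * cis (- 2 * pi * (y \<bullet> x))"
      by (intro AE_I2 tendsto_mult cut_pointwise tendsto_const)
    show "(\<lambda>y. cut_cells n f y * cis (- 2 * pi * (y \<bullet> x))) \<in> borel_measurable lebesgue" for n
      by (rule borel_measurable_integrable[OF fourier_integrable[OF cut_integrable[OF f]]])
    show "(\<lambda>y. f y * cis (- 2 * pi * (y \<bullet> x))) \<in> borel_measurable lebesgue"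
      by (rule borel_measurable_integrable[OF fourier_integrable[OF int]])
  qed (use int in \<open>auto simp: norm_mult cut_le\<close>)
  then show "AE x in lebesgue. (\<lambda>n. fourier (cut_cells n f) x) \<longlonglongrightarrow> fourier f x" by simp
qed (use fourier_cut_sqi f FT_sqi measurable_fourier int in auto)

section \<open>The adjoint of the Fourier transform and surjectivity\<close>

lemma borel_version:
  fixes f :: "real ^ 'k \<Rightarrow> complex"
  assumes "f \<in> borel_measurable lebesgue"
  obtains f' where "f' \<in> borel_measurable borel" "AE x in lebesgue. f x = f' x"
proof -
  have m: "(\<lambda>x. Re (f x)) \<in> borel_measurable lebesgue" "(\<lambda>x. Im (f x)) \<in> borel_measurable lebesgue"
    using assms by auto
  obtain u where u: "u \<in> borel_measurable lborel" "AE x in lborel. Re (f x) = u x"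
    using completion_ex_borel_measurable_real[OF m(1)] by blast
  obtain v where v: "v \<in> borel_measurable lborel" "AE x in lborel. Im (f x) = v x"
    using completion_ex_borel_measurable_real[OF m(2)] by blast
  have "AE x in lborel. f x = Complex (u x) (v x)"
    using u(2) v(2) by eventually_elim (simp add: complex_eq_iff)
  then have "AE x in lebesgue. f x = Complex (u x) (v x)" by (rule AE_completion)
  moreover have "(\<lambda>x. Complex (u x) (v x)) \<in> borel_measurable borel"
    using u(1) v(1) unfolding Complex_eq by simp
  ultimately show ?thesis by (intro that)
qed

text \<open>Fubini's theorem for a kernel symmetric in its two variables. It is applied to Borel
  representatives over \<open>lborel\<close>, where joint measurability on the product is
  available.\<close>

lemma fourier_multiplication:
  fixes f h :: "real ^ 'k \<Rightarrow> complex"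
  assumes f: "integrable lebesgue f" and h: "integrable lebesgue h"
  shows "(LINT x|lebesgue. fourier f x * h x) = (LINT y|lebesgue. f y * fourier h y)"
proof -
  obtain f' where f': "f' \<in> borel_measurable borel" "AE x in lebesgue. f x = f' x"
    by (rule borel_version[OF borel_measurable_integrable[OF f]])
  obtain h' where h': "h' \<in> borel_measurable borel" "AE x in lebesgue. h x = h' x"
    by (rule borel_version[OF borel_measurable_integrable[OF h]])
  note [measurable] = f'(1) h'(1)
  have fm: "f' \<in> borel_measurable lebesgue" "h' \<in> borel_measurable lebesgue"
    using f' h' by (auto intro: measurable_completion)
  have cism [measurable]: "(\<lambda>y. cis (- 2 * pi * (y \<bullet> x))) \<in> borel_measurable borel" for x :: "real ^ 'k"
    by (intro borel_measurable_continuous_onI continuous_intros)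
  have cis2 [measurable]: "(\<lambda>z. cis (- 2 * pi * (fst z \<bullet> snd z))) \<in> borel_measurable (borel \<Otimes>\<^sub>M (borel :: (real ^ 'k) measure))"
    unfolding borel_prod by (intro borel_measurable_continuous_onI continuous_intros)
  have f'i: "integrable lborel f'"
    using integrable_cong_AE[OF borel_measurable_integrable[OF f] fm(1) f'(2)] f f'(1)
      integrable_completion[of f' lborel] by simp
  have h'i: "integrable lborel h'"
    using integrable_cong_AE[OF borel_measurable_integrable[OF h] fm(2) h'(2)] h h'(1)
      integrable_completion[of h' lborel] by simp
  have ff: "fourier g x = (LINT y|lborel. g' y * cis (- 2 * pi * (y \<bullet> x)))"
    if g: "integrable lebesgue g" "g' \<in> borel_measurable borel" "AE x in lebesgue. g x = g' x"
    for g g' :: "real ^ 'k \<Rightarrow> complex" and x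
  proof -
    have m [measurable]: "(\<lambda>y. g' y * cis (- 2 * pi * (y \<bullet> x))) \<in> borel_measurable borel"
      by (intro borel_measurable_times g(2) cism)
    have "fourier g x = (LINT y|lebesgue. g' y * cis (- 2 * pi * (y \<bullet> x)))"
      unfolding fourier_def
    proof (rule integral_cong_AE)
      show "AE y in lebesgue. g y * cis (- 2 * pi * (y \<bullet> x)) = g' y * cis (- 2 * pi * (y \<bullet> x))"
        using g(3) by eventually_elim simp
      show "(\<lambda>y. g y * cis (- 2 * pi * (y \<bullet> x))) \<in> borel_measurable lebesgue"
        by (rule borel_measurable_integrable[OF fourier_integrable[OF g(1)]])
      show "(\<lambda>y. g' y * cis (- 2 * pi * (y \<bullet> x))) \<in> borel_measurable lebesgue"
        by (rule measurable_completion) (use m in simp)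
    qed
    also have "\<dots> = (LINT y|lborel. g' y * cis (- 2 * pi * (y \<bullet> x)))"
      by (rule integral_completion) (use m in simp)
    finally show ?thesis .
  qed
  have m2 [measurable]: "(\<lambda>z. f' (fst z) * h' (snd z) * cis (- 2 * pi * (fst z \<bullet> snd z))) \<in> borel_measurable (lborel \<Otimes>\<^sub>M lborel)"
    using cis2 by measurable
  have int2: "integrable (lborel \<Otimes>\<^sub>M lborel) (\<lambda>(y, x). f' y * h' x * cis (- 2 * pi * (y \<bullet> x)))"
  proof (rule lborel_pair.Fubini_integrable)
    show "(\<lambda>(y, x). f' y * h' x * cis (- 2 * pi * (y \<bullet> x))) \<in> borel_measurable (lborel \<Otimes>\<^sub>M lborel)"
      using m2 by (simp add: split_beta')
    show "integrable lborel (\<lambda>y. LINT x|lborel. norm (case (y, x) of (y, x) \<Rightarrow> f' y * h' x * cis (- 2 * pi * (y \<bullet> x))))"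
      using f'i by (simp add: norm_mult)
    show "AE y in lborel. integrable lborel (\<lambda>x. case (y, x) of (y, x) \<Rightarrow> f' y * h' x * cis (- 2 * pi * (y \<bullet> x)))"
    proof (rule AE_I2)
      fix y :: "real ^ 'k"
      have "integrable lborel (\<lambda>x. h' x * cis (- 2 * pi * (x \<bullet> y)))"
        by (rule integrable_cis[OF h'i]) (use cism in simp)
      then have "integrable lborel (\<lambda>x. f' y * (h' x * cis (- 2 * pi * (x \<bullet> y))))" by (rule integrable_mult_right)
      then show "integrable lborel (\<lambda>x. case (y, x) of (y, x) \<Rightarrow> f' y * h' x * cis (- 2 * pi * (y \<bullet> x)))"
        by (simp add: mult.assoc inner_commute)
    qed
  qed
  have "(LINT x|lebesgue. fourier f x * h x) = (LINT x|lebesgue. fourier f x * h' x)"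
  proof (rule integral_cong_AE)
    show "AE x in lebesgue. fourier f x * h x = fourier f x * h' x"
      using h'(2) by eventually_elim simp
  qed (use measurable_fourier[OF f] h fm in \<open>auto intro!: borel_measurable_times\<close>)
  also have "\<dots> = (LINT x|lborel. fourier f x * h' x)"
    using borel_measurable_continuous_onI[OF continuous_fourier[OF f]] by (intro integral_completion) simp
  also have "\<dots> = (LINT x|lborel. (LINT y|lborel. f' y * h' x * cis (- 2 * pi * (y \<bullet> x))))"
    unfolding ff[OF f f'] by (subst integral_mult_left_zero[symmetric]) (simp only: mult_ac)
  also have "\<dots> = (LINT y|lborel. (LINT x|lborel. f' y * h' x * cis (- 2 * pi * (y \<bullet> x))))"
    by (rule lborel_pair.Fubini_integral[OF int2])
  also have "\<dots> = (LINT y|lborel. f' y * fourier h y)"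
    unfolding ff[OF h h'] by (subst integral_mult_right_zero[symmetric]) (simp only: mult_ac inner_commute)
  also have "\<dots> = (LINT y|lebesgue. f' y * fourier h y)"
    using borel_measurable_continuous_onI[OF continuous_fourier[OF h]] by (intro integral_completion[symmetric]) simp
  also have "\<dots> = (LINT y|lebesgue. f y * fourier h y)"
  proof (rule integral_cong_AE)
    show "AE y in lebesgue. f' y * fourier h y = f y * fourier h y"
      using f'(2) by eventually_elim simp
  qed (use measurable_fourier[OF h] f fm in \<open>auto intro!: borel_measurable_times\<close>)
  finally show ?thesis .
qed

lemma nsq_cnj_diff: "nsq M ((\<lambda>x. cnj (f x)) - (\<lambda>x. cnj (g x))) = nsq M (f - g)"
  by (simp add: nsq_def flip: complex_cnj_diff)

text \<open>The multiplication formula gives the identity for cut functions. The limits are taken in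
  one argument at a time, with the other cutoff held fixed.\<close>

lemma FT_adjoint:
  fixes f g :: "real ^ 'k \<Rightarrow> complex"
  assumes f: "f \<in> sqi lebesgue" and g: "g \<in> sqi lebesgue"
  shows "ip lebesgue (FT f) g = ip lebesgue f (\<lambda>x. cnj (FT (\<lambda>x. cnj (g x)) x))"
proof -
  let ?g = "\<lambda>x. cnj (g x)"
  let ?u = "\<lambda>m x. cnj (fourier (cut_cells m ?g) x)"
  have g': "?g \<in> sqi lebesgue" by (rule sqi_cnj[OF g])
  have u: "?u m \<in> sqi lebesgue" for m by (intro sqi_cnj fourier_cut_sqi g')
  have base: "ip lebesgue (fourier (cut_cells n f)) (cut_cells m g) = ip lebesgue (cut_cells n f) (?u m)" for n m
  proof -
    have "(\<lambda>x. cnj (cut_cells m g x)) = cut_cells m ?g" by (auto simp: cut_cells_def)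
    then show ?thesis
      using fourier_multiplication[OF cut_integrable[OF f] cut_integrable[OF g'], of n m]
      by (simp add: ip_def fun_eq_iff)
  qed
  have step: "ip lebesgue (FT f) (cut_cells m g) = ip lebesgue f (?u m)" for m
  proof (rule LIMSEQ_unique)
    show "(\<lambda>n. ip lebesgue (fourier (cut_cells n f)) (cut_cells m g)) \<longlonglongrightarrow> ip lebesgue (FT f) (cut_cells m g)"
      by (intro nsq_tendsto_ip fourier_cut_sqi f FT_sqi cut_sqi g FT_lim)
    show "(\<lambda>n. ip lebesgue (fourier (cut_cells n f)) (cut_cells m g)) \<longlonglongrightarrow> ip lebesgue f (?u m)"
      unfolding base by (intro nsq_tendsto_ip f cut_sqi u cut_tendsto)
  qed
  show ?thesis
  proof (rule LIMSEQ_unique)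
    show "(\<lambda>m. ip lebesgue (FT f) (cut_cells m g)) \<longlonglongrightarrow> ip lebesgue (FT f) g"
      by (intro nsq_tendsto_ip_right f FT_sqi cut_sqi g cut_tendsto)
    have "(\<lambda>m. nsq lebesgue (?u m - (\<lambda>x. cnj (FT ?g x)))) \<longlonglongrightarrow> 0"
      unfolding nsq_cnj_diff by (rule FT_lim[OF g'])
    then show "(\<lambda>m. ip lebesgue (FT f) (cut_cells m g)) \<longlonglongrightarrow> ip lebesgue f (\<lambda>x. cnj (FT ?g x))"
      unfolding step by (intro nsq_tendsto_ip_right u sqi_cnj FT_sqi g' f)
  qed
qed

text \<open>The adjoint \<open>g \<mapsto> cnj (FT (cnj g))\<close> is isometric along with \<open>FT\<close>, and an isometry with isometric
  adjoint is onto.\<close>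

lemma FT_surj:
  fixes g :: "real ^ 'k \<Rightarrow> complex"
  assumes g: "g \<in> sqi lebesgue"
  obtains f where "f \<in> sqi lebesgue" "AE x in lebesgue. FT f x = g x"
proof -
  let ?g = "\<lambda>x. cnj (g x)"
  define h where "h x = cnj (FT ?g x)" for x
  have h: "h \<in> sqi lebesgue" unfolding h_def by (intro sqi_cnj FT_sqi g)
  have nh: "nsq lebesgue h = nsq lebesgue g"
    using FT_isometry[OF sqi_cnj[OF g]] by (simp add: nsq_def h_def)
  have "ip lebesgue (FT h) g = ip lebesgue h h"
    using FT_adjoint[OF h g] by (simp add: h_def[abs_def])
  \<comment> \<open>In the expanded square the inner product equals the squared norm of
    \<open>h\<close>, and \<open>FT h\<close>, \<open>h\<close> and \<open>g\<close> all have the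
    same norm.\<close>
  then have "nsq lebesgue (FT h - g) = 0"
    using FT_isometry[OF h] nh by (simp add: nsq_diff FT_sqi g h ip_self)
  then have "AE x in lebesgue. (FT h - g) x = 0"
    using nsq_eq_0_iff[of "FT h - g" lebesgue] FT_sqi[OF h] g by auto
  then show ?thesis using that[OF h] by simp
qed

section \<open>Fibers\<close>

lemma abs_summable_iff_integrable:
  fixes f :: "'a \<Rightarrow> 'b::{banach, second_countable_topology}"
  shows "Infinite_Sum.abs_summable_on f A \<longleftrightarrow> integrable (count_space A) f"
  by (simp add: abs_summable_equivalent abs_summable_on_def)

text \<open>Without summability both sides take the default value 0, which is why the identity is
  unconditional.\<close>

lemma infsum_eq_integral_real:
  fixes f :: "'a \<Rightarrow> real"
  shows "(\<Sum>\<^sub>\<infinity>x\<in>A. f x) = (LINT x|count_space A. f x)"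
proof (cases "f summable_on A")
  case True
  then have "Infinite_Set_Sum.abs_summable_on f A"
    using summable_on_iff_abs_summable_on_real[of f A] abs_summable_equivalent[of f A] by blast
  from infsetsum_infsum[OF this] show ?thesis by (simp add: infsetsum_def)
next
  case False
  then have "\<not> integrable (count_space A) f"
    using summable_on_iff_abs_summable_on_real[of f A] abs_summable_iff_integrable[of f A] by blast
  then show ?thesis using False by (simp add: infsum_not_exists not_integrable_integral_eq)
qed

lemma infsum_eq_integral_complex:
  fixes f :: "'a \<Rightarrow> complex"
  shows "(\<Sum>\<^sub>\<infinity>x\<in>A. f x) = (LINT x|count_space A. f x)"
proof (cases "f summable_on A")
  case True
  then have "Infinite_Set_Sum.abs_summable_on f A"
    using summable_on_iff_abs_summable_on_complex[of f A] abs_summable_equivalent[of f A] by blast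
  from infsetsum_infsum[OF this] show ?thesis by (simp add: infsetsum_def)
next
  case False
  then have "\<not> integrable (count_space A) f"
    using summable_on_iff_abs_summable_on_complex[of f A] abs_summable_iff_integrable[of f A] by blast
  then show ?thesis using False by (simp add: infsum_not_exists not_integrable_integral_eq)
qed

abbreviation cs :: "(int ^ 'k) measure" where
  "cs \<equiv> count_space UNIV"

lemma ell2_eq: "ell2 = sqi cs"
proof -
  have "(\<lambda>l. (cmod (\<xi> l))\<^sup>2) summable_on UNIV \<longleftrightarrow> integrable cs (\<lambda>l. (cmod (\<xi> l))\<^sup>2)" for \<xi> :: "int ^ 'a \<Rightarrow> complex"
    by (rule trans[OF summable_on_iff_abs_summable_on_real abs_summable_iff_integrable])
  then show ?thesis by (simp add: ell2_def sqi_def)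
qed

lemma ell2_norm_eq: "ell2_norm \<xi> = sqrt (nsq cs \<xi>)"
  by (simp add: ell2_norm_def nsq_def infsum_eq_integral_real)

lemma ell2_norm_sq: "(ell2_norm \<xi>)\<^sup>2 = nsq cs \<xi>"
  by (simp add: ell2_norm_eq)

lemma ell2_inner_eq: "ell2_inner \<xi> \<eta> = ip cs \<xi> \<eta>"
  by (simp add: ell2_inner_def ip_def infsum_eq_integral_complex)

lemma nsq_cs_eq_0_iff: "\<xi> \<in> sqi cs \<Longrightarrow> nsq cs \<xi> = 0 \<longleftrightarrow> \<xi> = 0"
  using nsq_eq_0_iff[of \<xi> cs] by (auto simp: AE_count_space)

lemma measurable_fib_iff:
  "case_prod \<phi> \<in> borel_measurable fib_measure \<longleftrightarrow> (\<forall>l. (\<lambda>x. \<phi> x l) \<in> borel_measurable torus_measure)"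
proof
  assume "case_prod \<phi> \<in> borel_measurable fib_measure"
  from measurable_fib_measureD[OF this]
  show "\<forall>l. (\<lambda>x. \<phi> x l) \<in> borel_measurable torus_measure" by simp
next
  assume "\<forall>l. (\<lambda>x. \<phi> x l) \<in> borel_measurable torus_measure"
  then show "case_prod \<phi> \<in> borel_measurable fib_measure"
    by (intro measurable_fib_measureI) simp
qed

lemma
  assumes "case_prod \<phi> \<in> borel_measurable fib_measure" "case_prod \<psi> \<in> borel_measurable fib_measure"
  shows measurable_ip_fibers: "(\<lambda>x. ip cs (\<phi> x) (\<psi> x)) \<in> borel_measurable torus_measure"
    and measurable_nsq_fibers: "(\<lambda>x. nsq cs (\<phi> x)) \<in> borel_measurable torus_measure"
proof -
  note [measurable] = assms[unfolded fib_measure_def]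
  show "(\<lambda>x. ip cs (\<phi> x) (\<psi> x)) \<in> borel_measurable torus_measure"
    unfolding ip_def by measurable
  show "(\<lambda>x. nsq cs (\<phi> x)) \<in> borel_measurable torus_measure"
    unfolding nsq_def by measurable
qed

lemma ip_fibers:
  assumes "case_prod \<phi> \<in> sqi fib_measure" "case_prod \<psi> \<in> sqi fib_measure"
  shows "ip fib_measure (case_prod \<phi>) (case_prod \<psi>) = (LINT x|torus_measure. ip cs (\<phi> x) (\<psi> x))"
proof -
  have *: "integrable (torus_measure \<Otimes>\<^sub>M count_space UNIV) (\<lambda>(x, l). \<phi> x l * cnj (\<psi> x l))"
    using ip_integrable[OF assms] by (simp add: fib_measure_def split_beta')
  show ?thesis
    using fib.integral_fst[OF *] by (simp add: ip_def fib_measure_def split_beta')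
qed

lemma
  assumes "case_prod \<phi> \<in> sqi fib_measure"
  shows nsq_fibers_integrable: "integrable torus_measure (\<lambda>x. nsq cs (\<phi> x))"
    and nsq_fibers: "nsq fib_measure (case_prod \<phi>) = (LINT x|torus_measure. nsq cs (\<phi> x))"
    and AE_fiber_sqi: "AE x in torus_measure. \<phi> x \<in> sqi cs"
proof -
  have *: "integrable (torus_measure \<Otimes>\<^sub>M count_space UNIV) (\<lambda>(x, l). (cmod (\<phi> x l))\<^sup>2)"
    using sqi_integrable[OF assms] by (simp add: fib_measure_def split_beta')
  show "integrable torus_measure (\<lambda>x. nsq cs (\<phi> x))"
    using fib.integrable_fst[OF *] by (simp add: nsq_def)
  show "nsq fib_measure (case_prod \<phi>) = (LINT x|torus_measure. nsq cs (\<phi> x))"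
    using fib.integral_fst[OF *] by (simp add: nsq_def fib_measure_def split_beta')
  show "AE x in torus_measure. \<phi> x \<in> sqi cs"
    using fib.AE_integrable_fst[OF *] by (simp add: sqi_def)
qed

lemma sqi_fibI:
  assumes "case_prod \<phi> \<in> borel_measurable fib_measure" "AE x in torus_measure. \<phi> x \<in> sqi cs"
    "integrable torus_measure (\<lambda>x. nsq cs (\<phi> x))"
  shows "case_prod \<phi> \<in> sqi fib_measure"
proof -
  note [measurable] = assms(1)[unfolded fib_measure_def]
  have "(\<integral>\<^sup>+z. ennreal ((cmod (case_prod \<phi> z))\<^sup>2) \<partial>fib_measure)
    = (\<integral>\<^sup>+x. \<integral>\<^sup>+l. ennreal ((cmod (\<phi> x l))\<^sup>2) \<partial>cs \<partial>torus_measure)"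
    unfolding fib_measure_def
    by (subst int_vec_count.nn_integral_fst[symmetric]) simp_all
  also have "\<dots> = (\<integral>\<^sup>+x. ennreal (nsq cs (\<phi> x)) \<partial>torus_measure)"
    by (rule nn_integral_cong_AE) (use assms(2) in \<open>eventually_elim, simp add: nn_integral_eq_nsq\<close>)
  also have "\<dots> < \<infinity>"
    using nn_integral_eq_integral[OF assms(3)] by simp
  finally have "integrable fib_measure (\<lambda>z. (cmod (case_prod \<phi> z))\<^sup>2)"
    using assms(1) by (intro integrableI_nonneg) auto
  then show ?thesis using assms(1) by (simp add: sqi_def)
qed

lemma L2_torus_iff: "\<phi> \<in> L2_torus \<longleftrightarrow> case_prod \<phi> \<in> sqi fib_measure"
proof
  assume "\<phi> \<in> L2_torus"
  then show "case_prod \<phi> \<in> sqi fib_measure"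
    by (intro sqi_fibI) (simp_all add: L2_torus_def measurable_fib_iff ell2_eq ell2_norm_sq)
next
  assume *: "case_prod \<phi> \<in> sqi fib_measure"
  then show "\<phi> \<in> L2_torus"
    using AE_fiber_sqi[OF *] nsq_fibers_integrable[OF *] sqi_measurable[OF *]
    by (simp add: L2_torus_def measurable_fib_iff ell2_eq ell2_norm_sq)
qed

lemma AE_lebesgue_fibers:
  assumes "AE y in lebesgue. P y"
  shows "AE x in torus_measure. \<forall>l::int ^ 'k. P (x + of_int_vec l)"
proof -
  have "AE y in distr fib_measure lebesgue (tile :: (real ^ 'k) \<times> (int ^ 'k) \<Rightarrow> _). P y"
    unfolding distr_tile by (rule assms)
  from AE_fibD[OF AE_distrD[OF measurable_tile this]] show ?thesis by simp
qed

lemma FT_fiber_sqi: "f \<in> sqi lebesgue \<Longrightarrow> (\<lambda>(x, l). FT f (x + of_int_vec l)) \<in> sqi fib_measure"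
  using sqi_fib_iff[of "FT f"] FT_sqi[of f] by (auto simp: split_beta' dest: sqi_measurable)

lemma is_fiberization_FT:
  "is_fiberization (\<lambda>(f :: real ^ 'k \<Rightarrow> complex) x l. FT f (x + of_int_vec l))"
  unfolding is_fiberization_def L2_eq L2_torus_iff
proof (intro conjI ballI allI impI)
  fix f :: "real ^ 'k \<Rightarrow> complex" assume f: "f \<in> sqi lebesgue"
  show "(\<lambda>(x, l). FT f (x + of_int_vec l)) \<in> sqi fib_measure"
    by (rule FT_fiber_sqi[OF f])
  show "(LINT x|torus_measure. (ell2_norm (\<lambda>l. FT f (x + of_int_vec l)))\<^sup>2) = (L2_norm f)\<^sup>2"
    using nsq_fibers[OF FT_fiber_sqi[OF f]] nsq_fib[OF sqi_measurable[OF FT_sqi[OF f]]] FT_isometry[OF f]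
    by (simp add: ell2_norm_sq L2_norm_eq split_beta')
next
  fix f g :: "real ^ 'k \<Rightarrow> complex" and a b assume "f \<in> sqi lebesgue" "g \<in> sqi lebesgue"
  from AE_lebesgue_fibers[OF FT_linear[OF this, of a b]]
  show "AE x in torus_measure. (\<lambda>l. FT (cscale a f + cscale b g) (x + of_int_vec l)) =
      cscale a (\<lambda>l. FT f (x + of_int_vec l)) + cscale b (\<lambda>l. FT g (x + of_int_vec l))"
    by (auto simp: fun_eq_iff)
next
  fix f :: "real ^ 'k \<Rightarrow> complex" assume "f \<in> sqi lebesgue" "integrable lebesgue f"
  from AE_lebesgue_fibers[OF FT_eq_fourier[OF this]]
  show "AE x in torus_measure. (\<lambda>l. FT f (x + of_int_vec l)) = (\<lambda>l. fourier f (x + of_int_vec l))"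
    by (auto simp: fun_eq_iff)
next
  fix \<phi> :: "real ^ 'k \<Rightarrow> int ^ 'k \<Rightarrow> complex" assume "\<phi> \<in> L2_torus"
  then have \<phi>: "case_prod \<phi> \<in> sqi fib_measure" by (simp only: L2_torus_iff)
  \<comment> \<open>The function on space with fibers \<phi>; the preimage sought is the one whose
    Fourier transform it is.\<close>
  define g where "g y = case_prod \<phi> (untile y)" for y
  have g: "g \<in> borel_measurable lebesgue"
    unfolding g_def by (rule measurable_compose[OF measurable_untile sqi_measurable[OF \<phi>]])
  have g_tile: "g (x + of_int_vec l) = \<phi> x l" if "x \<in> torus" for x l
    using untile_tile[OF that, of l] by (simp add: g_def)
  have "(\<lambda>z. g (tile z)) \<in> sqi fib_measure"
  proof (rule sqi_cong_AE[OF \<phi>])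
    show "(\<lambda>z. g (tile z)) \<in> borel_measurable fib_measure"
      by (rule measurable_compose[OF measurable_tile g])
    show "AE z in fib_measure. case_prod \<phi> z = g (tile z)"
      by (rule AE_I2) (auto simp: fib_measure_def space_pair_measure g_tile)
  qed
  then have "g \<in> sqi lebesgue" by (simp add: sqi_fib_iff[OF g])
  then obtain f where f: "f \<in> sqi lebesgue" "AE y in lebesgue. FT f y = g y"
    by (rule FT_surj)
  have "AE x in torus_measure. (\<lambda>l. FT f (x + of_int_vec l)) = \<phi> x"
    using AE_lebesgue_fibers[OF f(2)] AE_space
    by eventually_elim (auto simp: fun_eq_iff g_tile)
  then show "\<exists>f\<in>sqi lebesgue. AE x in torus_measure. (\<lambda>l. FT f (x + of_int_vec l)) = \<phi> x"
    using f(1) by blast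
qed

text \<open>\<open>fiberization\<close> is an unspecified choice. The transform \<open>FT\<close>
  shows only that a choice exists; everything below has to follow from the clauses of
  \<open>is_fiberization\<close>.\<close>

lemma is_fiberization: "is_fiberization (fiberization :: (real ^ 'k \<Rightarrow> complex) \<Rightarrow> _)"
  unfolding fiberization_def by (rule someI[where P = is_fiberization, OF is_fiberization_FT])

section \<open>Consequences of the defining clauses of the fiberization\<close>

abbreviation \<Gamma> :: "(real ^ 'k \<Rightarrow> complex) \<Rightarrow> real ^ 'k \<Rightarrow> int ^ 'k \<Rightarrow> complex" where
  "\<Gamma> \<equiv> fiberization"

lemma \<Gamma>_sqi: "f \<in> sqi lebesgue \<Longrightarrow> case_prod (\<Gamma> f) \<in> sqi fib_measure"
  using is_fiberization unfolding is_fiberization_def L2_eq L2_torus_iff by blast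

lemma \<Gamma>_linear:
  assumes "f \<in> sqi lebesgue" "g \<in> sqi lebesgue"
  shows "AE x in torus_measure. \<Gamma> (cscale a f + cscale b g) x = cscale a (\<Gamma> f x) + cscale b (\<Gamma> g x)"
  using is_fiberization assms unfolding is_fiberization_def L2_eq by blast

lemma \<Gamma>_isometry:
  assumes "f \<in> sqi lebesgue"
  shows "nsq fib_measure (case_prod (\<Gamma> f)) = nsq lebesgue f"
proof -
  have "(LINT x|torus_measure. (ell2_norm (\<Gamma> f x))\<^sup>2) = (L2_norm f)\<^sup>2"
    using is_fiberization assms unfolding is_fiberization_def L2_eq by blast
  then show ?thesis using nsq_fibers[OF \<Gamma>_sqi[OF assms]] by (simp add: ell2_norm_sq L2_norm_eq)
qed

lemma \<Gamma>_surj: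
  assumes "case_prod \<phi> \<in> sqi fib_measure"
  obtains f where "f \<in> sqi lebesgue" "AE x in torus_measure. \<Gamma> f x = \<phi> x"
proof -
  have "\<phi> \<in> L2_torus" using assms by (simp only: L2_torus_iff)
  then have "\<exists>f\<in>sqi lebesgue. AE x in torus_measure. \<Gamma> f x = \<phi> x"
    using is_fiberization unfolding is_fiberization_def L2_eq by blast
  then show ?thesis using that by blast
qed

lemma \<Gamma>_fourier:
  assumes "f \<in> sqi lebesgue" "integrable lebesgue f"
  shows "AE x in torus_measure. \<Gamma> f x = (\<lambda>l. fourier f (x + of_int_vec l))"
  using is_fiberization assms unfolding is_fiberization_def L2_eq by blast

lemma AE_fibI:
  fixes \<phi> \<psi> :: "real ^ 'k \<Rightarrow> int ^ 'k \<Rightarrow> complex"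
  assumes "case_prod \<phi> \<in> borel_measurable fib_measure" "case_prod \<psi> \<in> borel_measurable fib_measure"
    "AE x in torus_measure. \<phi> x = \<psi> x"
  shows "AE z in fib_measure. case_prod \<phi> z = case_prod \<psi> z"
proof -
  have "(\<lambda>z. case_prod \<phi> z - case_prod \<psi> z) -` {0} \<inter> space fib_measure \<in> sets fib_measure"
    by (intro measurable_sets[of _ _ borel] borel_measurable_diff assms(1,2)) simp
  also have "(\<lambda>z. case_prod \<phi> z - case_prod \<psi> z) -` {0} \<inter> space fib_measure
    = {z \<in> space fib_measure. case_prod \<phi> z = case_prod \<psi> z}" by auto
  finally have "Measurable.pred fib_measure (\<lambda>z. case_prod \<phi> z = case_prod \<psi> z)"
    by (simp only: pred_def)
  from AE_fib_iff[OF this] show ?thesis using assms(3) by (auto simp: fun_eq_iff)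
qed

lemma \<Gamma>_lincomb_fib:
  assumes "f \<in> sqi lebesgue" "g \<in> sqi lebesgue"
  shows "AE z in fib_measure. case_prod (\<Gamma> (cscale a f + cscale b g)) z
    = (cscale a (case_prod (\<Gamma> f)) + cscale b (case_prod (\<Gamma> g))) z"
proof -
  let ?\<psi> = "\<lambda>x. cscale a (\<Gamma> f x) + cscale b (\<Gamma> g x)"
  have eq: "cscale a (case_prod (\<Gamma> f)) + cscale b (case_prod (\<Gamma> g)) = case_prod ?\<psi>"
    by (auto simp: fun_eq_iff)
  have "cscale a (case_prod (\<Gamma> f)) + cscale b (case_prod (\<Gamma> g)) \<in> sqi fib_measure"
    by (intro sqi_add sqi_cscale \<Gamma>_sqi assms)
  then have "case_prod ?\<psi> \<in> sqi fib_measure" unfolding eq .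
  then show ?thesis
    unfolding eq using assms by (intro AE_fibI \<Gamma>_linear sqi_measurable \<Gamma>_sqi) auto
qed

lemma nsq_\<Gamma>_lincomb:
  assumes f: "f \<in> sqi lebesgue" and g: "g \<in> sqi lebesgue"
  shows "nsq fib_measure (cscale a (case_prod (\<Gamma> f)) + cscale b (case_prod (\<Gamma> g)))
    = nsq lebesgue (cscale a f + cscale b g)"
proof -
  have "nsq fib_measure (case_prod (\<Gamma> (cscale a f + cscale b g)))
    = nsq fib_measure (cscale a (case_prod (\<Gamma> f)) + cscale b (case_prod (\<Gamma> g)))"
    by (rule nsq_cong_AE[OF _ _ \<Gamma>_lincomb_fib[OF assms]])
      (intro sqi_measurable \<Gamma>_sqi sqi_add sqi_cscale f g)+
  then show ?thesis using \<Gamma>_isometry[of "cscale a f + cscale b g"] f g by simp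
qed

lemma nsq_\<Gamma>_diff:
  assumes "f \<in> sqi lebesgue" "g \<in> sqi lebesgue"
  shows "nsq fib_measure (case_prod (\<Gamma> f) - case_prod (\<Gamma> g)) = nsq lebesgue (f - g)"
  using nsq_\<Gamma>_lincomb[OF assms, of 1 "-1"] by simp

text \<open>Polarisation: the isometry for f + c g gives the real part for c = 1 and the imaginary
  part for c = i.\<close>

lemma ip_\<Gamma>:
  assumes f: "f \<in> sqi lebesgue" and g: "g \<in> sqi lebesgue"
  shows "ip fib_measure (case_prod (\<Gamma> f)) (case_prod (\<Gamma> g)) = ip lebesgue f g"
proof -
  have *: "Re (cnj c * ip fib_measure (case_prod (\<Gamma> f)) (case_prod (\<Gamma> g))) = Re (cnj c * ip lebesgue f g)" for c
    using nsq_\<Gamma>_lincomb[OF f g, of 1 c] f g \<Gamma>_sqi[OF f] \<Gamma>_sqi[OF g]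
    by (simp add: nsq_add \<Gamma>_isometry)
  show ?thesis using *[of 1] *[of \<i>] by (simp add: complex_eq_iff)
qed

section \<open>Translations as multiplication of fibers by characters\<close>

lemma nsq_lebesgue_shift:
  assumes "f \<in> borel_measurable lebesgue"
  shows "nsq lebesgue (translate y f) = nsq lebesgue f"
  using integral_lebesgue_shift[of "\<lambda>x. (cmod (f x))\<^sup>2" "- y"] assms
  by (simp add: nsq_def translate_def)

lemma translate_sqi:
  assumes "f \<in> sqi lebesgue" shows "translate y f \<in> sqi lebesgue"
proof -
  have "(\<lambda>x. f (x - y)) \<in> borel_measurable lebesgue"
    by (rule measurable_compose[OF measurable_translate_diff sqi_measurable[OF assms]])
  moreover have "(\<lambda>x. (cmod (f x))\<^sup>2) \<in> borel_measurable lebesgue"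
    using sqi_measurable[OF assms] by measurable
  ultimately show ?thesis
    using integrable_lebesgue_shift[of "\<lambda>x. (cmod (f x))\<^sup>2" "- y"] assms
    by (simp add: sqi_def translate_def)
qed

lemma fourier_translate:
  fixes f :: "real ^ 'k \<Rightarrow> complex"
  assumes int: "integrable lebesgue f"
  shows "fourier (translate y f) x = cis (- 2 * pi * (y \<bullet> x)) * fourier f x"
proof -
  let ?h = "\<lambda>z. f (z - y) * cis (- 2 * pi * (z \<bullet> x))"
  have sh: "?h (z + y) = cis (- 2 * pi * (y \<bullet> x)) * (f z * cis (- 2 * pi * (z \<bullet> x)))" for z
  proof -
    have "cis (- 2 * pi * ((z + y) \<bullet> x)) = cis (- 2 * pi * (y \<bullet> x)) * cis (- 2 * pi * (z \<bullet> x))"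
      by (simp add: cis_mult inner_add_left algebra_simps)
    then show ?thesis by simp
  qed
  have "(\<lambda>z. f (z - y)) \<in> borel_measurable lebesgue"
    by (rule measurable_compose[OF measurable_translate_diff]) (use int in auto)
  then have "?h \<in> borel_measurable lebesgue"
    by (intro borel_measurable_times measurable_cis_lebesgue)
  from integral_lebesgue_shift[OF this, of y]
  show ?thesis unfolding sh by (simp add: fourier_def translate_def)
qed

lemma measurable_fst_fib:
  assumes "c \<in> borel_measurable torus_measure"
  shows "(\<lambda>z. c (fst z)) \<in> borel_measurable (fib_measure :: ((real ^ 'k) \<times> (int ^ 'k)) measure)"
  unfolding fib_measure_def by (rule measurable_compose[OF measurable_fst assms])

lemma AE_fib_torus: "AE z in (fib_measure :: ((real ^ 'k) \<times> (int ^ 'k)) measure). fst z \<in> torus"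
  by (rule AE_I2) (auto simp: fib_measure_def space_pair_measure)

lemma sqi_fib_bounded_mult:
  assumes \<Phi>: "\<Phi> \<in> sqi fib_measure" and c: "c \<in> borel_measurable torus_measure" and B: "\<And>x. x \<in> torus \<Longrightarrow> cmod (c x) \<le> B"
  shows "(\<lambda>z. c (fst z) * \<Phi> z) \<in> sqi (fib_measure :: ((real ^ 'k) \<times> (int ^ 'k)) measure)"
proof (rule sqi_dominated[OF \<Phi>])
  show "(\<lambda>z. c (fst z) * \<Phi> z) \<in> borel_measurable fib_measure"
    by (intro borel_measurable_times measurable_fst_fib c sqi_measurable[OF \<Phi>])
  show "AE z in fib_measure. cmod (c (fst z) * \<Phi> z) \<le> B * cmod (\<Phi> z)"
    using AE_fib_torus by eventually_elim (auto simp: norm_mult intro!: mult_right_mono B)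
qed

lemma sqi_fib_mult:
  assumes "case_prod \<phi> \<in> sqi fib_measure" "c \<in> borel_measurable torus_measure" "\<And>x. x \<in> torus \<Longrightarrow> cmod (c x) \<le> B"
  shows "case_prod (\<lambda>x. cscale (c x) (\<phi> x)) \<in> sqi fib_measure"
proof -
  have "case_prod (\<lambda>x. cscale (c x) (\<phi> x)) = (\<lambda>z. c (fst z) * case_prod \<phi> z)" by (auto simp: fun_eq_iff)
  then show ?thesis using sqi_fib_bounded_mult[OF assms] by (simp only:)
qed

text \<open>Only for integrable functions are the fibers given by a formula, so the identity is
  checked on cutoffs and both sides pass to the limit. The character is constant along a fiber
  because it is 1 at lattice points.\<close>

lemma \<Gamma>_translate:
  fixes f :: "real ^ 'k \<Rightarrow> complex"
  assumes f: "f \<in> sqi lebesgue"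
  shows "AE x in torus_measure. \<Gamma> (translate (of_int_vec l) f) x = cscale (cnj (chr l x)) (\<Gamma> f x)"
proof -
  let ?T = "translate (of_int_vec l) :: _ \<Rightarrow> real ^ 'k \<Rightarrow> complex"
  let ?M = "\<lambda>\<phi>. case_prod (\<lambda>x. cscale (cnj (chr l x)) (\<phi> x)) :: _ \<times> (int ^ 'k) \<Rightarrow> complex"
  have M: "?M \<phi> \<in> sqi fib_measure" if "case_prod \<phi> \<in> sqi fib_measure" for \<phi>
    by (rule sqi_fib_mult[OF that, of _ 1]) auto
  have cut: "AE z in fib_measure. case_prod (\<Gamma> (?T (cut_cells n f))) z = ?M (\<Gamma> (cut_cells n f)) z" for n
  proof (rule AE_fibI)
    have c: "cut_cells n f \<in> sqi lebesgue" "integrable lebesgue (cut_cells n f)"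
      using cut_sqi[OF f] cut_integrable[OF f] by auto
    have "integrable lebesgue (?T (cut_cells n f))"
      using c(2) integrable_lebesgue_shift[of "cut_cells n f" "- of_int_vec l"] by (simp add: translate_def)
    from \<Gamma>_fourier[OF translate_sqi[OF c(1)] this] \<Gamma>_fourier[OF c]
    show "AE x in torus_measure. \<Gamma> (?T (cut_cells n f)) x = cscale (cnj (chr l x)) (\<Gamma> (cut_cells n f) x)"
    proof eventually_elim
      case (elim x)
      have "cis (- 2 * pi * (of_int_vec l \<bullet> (x + of_int_vec m))) = cnj (chr l x)" for m
      proof -
        have "cis (- 2 * pi * (of_int_vec l \<bullet> (x + of_int_vec m))) = cnj (chr l (x + of_int_vec m))"
          by (simp add: chr_def cis_cnj)
        then show ?thesis by (simp add: chr_add_right)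
      qed
      then show ?case unfolding elim fourier_translate[OF c(2)] by (auto simp: fun_eq_iff)
    qed
    show "case_prod (\<Gamma> (?T (cut_cells n f))) \<in> borel_measurable fib_measure"
      by (intro sqi_measurable \<Gamma>_sqi translate_sqi c)
    show "?M (\<Gamma> (cut_cells n f)) \<in> borel_measurable fib_measure"
      by (intro sqi_measurable M \<Gamma>_sqi c)
  qed
  have lim: "(\<lambda>n. nsq lebesgue (cut_cells n f - f)) \<longlonglongrightarrow> 0" by (rule cut_tendsto[OF f])
  have "AE z in fib_measure. case_prod (\<Gamma> (?T f)) z = ?M (\<Gamma> f) z"
  proof (rule nsq_limit_unique[of "\<lambda>n. case_prod (\<Gamma> (?T (cut_cells n f)))"])
    have "nsq fib_measure (case_prod (\<Gamma> (?T (cut_cells n f))) - case_prod (\<Gamma> (?T f))) = nsq lebesgue (cut_cells n f - f)" for n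
    proof -
      have "?T (cut_cells n f) - ?T f = ?T (cut_cells n f - f)" by (auto simp: translate_def)
      then show ?thesis
        using cut_sqi[OF f, of n] f nsq_lebesgue_shift[of "cut_cells n f - f" "of_int_vec l"]
        by (simp add: nsq_\<Gamma>_diff translate_sqi sqi_measurable)
    qed
    then show "(\<lambda>n. nsq fib_measure (case_prod (\<Gamma> (?T (cut_cells n f))) - case_prod (\<Gamma> (?T f)))) \<longlonglongrightarrow> 0"
      using lim by simp
    have "nsq fib_measure (case_prod (\<Gamma> (?T (cut_cells n f))) - ?M (\<Gamma> f)) = nsq lebesgue (cut_cells n f - f)" for n
    proof -
      have "nsq fib_measure (case_prod (\<Gamma> (?T (cut_cells n f))) - ?M (\<Gamma> f)) = nsq fib_measure (?M (\<Gamma> (cut_cells n f)) - ?M (\<Gamma> f))"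
      proof (rule nsq_cong_AE)
        show "AE z in fib_measure. (case_prod (\<Gamma> (?T (cut_cells n f))) - ?M (\<Gamma> f)) z = (?M (\<Gamma> (cut_cells n f)) - ?M (\<Gamma> f)) z"
          using cut[of n] by eventually_elim simp
      qed (intro sqi_measurable sqi_diff \<Gamma>_sqi translate_sqi cut_sqi M f)+
      also have "\<dots> = nsq fib_measure (case_prod (\<Gamma> (cut_cells n f)) - case_prod (\<Gamma> f))"
        by (simp add: nsq_def split_beta' norm_mult flip: right_diff_distrib)
      finally show ?thesis by (simp add: nsq_\<Gamma>_diff cut_sqi f)
    qed
    then show "(\<lambda>n. nsq fib_measure (case_prod (\<Gamma> (?T (cut_cells n f))) - ?M (\<Gamma> f))) \<longlonglongrightarrow> 0"
      using lim by simp
  qed (intro \<Gamma>_sqi translate_sqi cut_sqi M f)+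
  from AE_fibD[OF this] show ?thesis by (auto simp: fun_eq_iff)
qed

section \<open>Gram--Schmidt in the fibers\<close>

definition unit_vec :: "(int ^ 'k \<Rightarrow> complex) \<Rightarrow> int ^ 'k \<Rightarrow> complex" where
  "unit_vec \<xi> = cscale (1 / sqrt (nsq cs \<xi>)) \<xi>"

text \<open>Since \<open>1 / 0 = 0\<close>, a vector that depends on its predecessors is sent to 0.\<close>

function gram_schmidt :: "(nat \<Rightarrow> int ^ 'k \<Rightarrow> complex) \<Rightarrow> nat \<Rightarrow> int ^ 'k \<Rightarrow> complex" where
  "gram_schmidt v i = unit_vec (v i - (\<Sum>j\<in>{..<i}. cscale (ip cs (v i) (gram_schmidt v j)) (gram_schmidt v j)))"
  by pat_completeness auto
termination by (relation "Wellfounded.measure snd") auto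

declare gram_schmidt.simps [simp del]

definition gs_proj :: "(nat \<Rightarrow> int ^ 'k \<Rightarrow> complex) \<Rightarrow> nat \<Rightarrow> (int ^ 'k \<Rightarrow> complex) \<Rightarrow> int ^ 'k \<Rightarrow> complex" where
  "gs_proj v m \<xi> = (\<Sum>j\<in>{..<m}. cscale (ip cs \<xi> (gram_schmidt v j)) (gram_schmidt v j))"

lemma gram_schmidt_eq: "gram_schmidt v i = unit_vec (v i - gs_proj v i (v i))"
  unfolding gs_proj_def by (rule gram_schmidt.simps)

lemma unit_vec_sqi: "\<xi> \<in> sqi cs \<Longrightarrow> unit_vec \<xi> \<in> sqi cs"
  by (simp add: unit_vec_def)

lemma nsq_unit_vec: "nsq cs (unit_vec \<xi>) = (if nsq cs \<xi> = 0 then 0 else 1)"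
  by (simp add: unit_vec_def norm_divide power_divide)

lemma unit_vec_scale:
  assumes "\<xi> \<in> sqi cs" shows "cscale (sqrt (nsq cs \<xi>)) (unit_vec \<xi>) = \<xi>"
proof (cases "nsq cs \<xi> = 0")
  case True
  then show ?thesis using nsq_cs_eq_0_iff[OF assms] by (simp add: unit_vec_def)
qed (simp add: unit_vec_def)

lemma nsq_gram_schmidt: "nsq cs (gram_schmidt v i) = 0 \<or> nsq cs (gram_schmidt v i) = 1"
  by (simp add: gram_schmidt_eq nsq_unit_vec)

context
  fixes v :: "nat \<Rightarrow> int ^ 'k \<Rightarrow> complex"
  assumes v: "\<And>i. v i \<in> sqi cs"
begin

lemma gram_schmidt_sqi: "gram_schmidt v i \<in> sqi cs"
proof (induction i rule: less_induct)
  case (less i)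
  have "gs_proj v i (v i) \<in> sqi cs"
    unfolding gs_proj_def by (intro sqi_sum sqi_cscale) (use less in auto)
  then show ?case
    unfolding gram_schmidt_eq[of v i] by (intro unit_vec_sqi sqi_diff v)
qed

lemma gs_proj_sqi: "gs_proj v m \<xi> \<in> sqi cs"
  unfolding gs_proj_def by (intro sqi_sum sqi_cscale gram_schmidt_sqi)

lemma gram_schmidt_orth_less: "j < i \<Longrightarrow> ip cs (gram_schmidt v i) (gram_schmidt v j) = 0"
proof (induction i arbitrary: j rule: less_induct)
  case (less i)
  have orth: "ip cs (gram_schmidt v m) (gram_schmidt v j) = 0" if "m < i" "m \<noteq> j" for m
  proof (cases "m < j")
    case True
    then have "ip cs (gram_schmidt v j) (gram_schmidt v m) = 0" using less by blast
    then show ?thesis using ip_commute[of cs "gram_schmidt v m" "gram_schmidt v j"] by simp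
  next
    case False
    then show ?thesis using less.IH that by auto
  qed
  have "ip cs (gs_proj v i (v i)) (gram_schmidt v j)
    = (\<Sum>m\<in>{..<i}. ip cs (v i) (gram_schmidt v m) * ip cs (gram_schmidt v m) (gram_schmidt v j))"
    unfolding gs_proj_def using gram_schmidt_sqi by (simp add: ip_sum_left)
  also have "\<dots> = (\<Sum>m\<in>{..<i}. if m = j then ip cs (v i) (gram_schmidt v j) * nsq cs (gram_schmidt v j) else 0)"
    by (rule sum.cong) (auto simp: orth ip_self)
  also have "\<dots> = ip cs (v i) (gram_schmidt v j) * nsq cs (gram_schmidt v j)"
    using less.prems by simp
  \<comment> \<open>If normalisation produced 0, the inner product with \<open>v i\<close> vanishes
    too; otherwise the squared norm is 1.\<close>
  also have "\<dots> = ip cs (v i) (gram_schmidt v j)"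
    using nsq_gram_schmidt[of v j] ip_eq_0[OF v[of i] gram_schmidt_sqi[of j]] by auto
  finally have "ip cs (v i - gs_proj v i (v i)) (gram_schmidt v j) = 0"
    by (simp add: ip_diff_left v gs_proj_sqi gram_schmidt_sqi)
  then have "ip cs (gram_schmidt v i) (gram_schmidt v j) = 0"
    by (simp add: gram_schmidt_eq[of v i] unit_vec_def)
  then show ?case .
qed

lemma gram_schmidt_orth: "i \<noteq> j \<Longrightarrow> ip cs (gram_schmidt v i) (gram_schmidt v j) = 0"
  using gram_schmidt_orth_less[of i j] gram_schmidt_orth_less[of j i]
    ip_commute[of cs "gram_schmidt v i" "gram_schmidt v j"] by (metis complex_cnj_zero linorder_neqE_nat)

lemma gram_schmidt_in_span: "gram_schmidt v i \<in> cfun.span (v ` {..i})"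
proof (induction i rule: less_induct)
  case (less i)
  have "gram_schmidt v j \<in> cfun.span (v ` {..i})" if "j < i" for j
    using less[OF that] cfun.span_mono[of "v ` {..j}" "v ` {..i}"] that by fastforce
  then show ?case
    unfolding gram_schmidt_eq[of v i] gs_proj_def unit_vec_def
    by (intro cfun.span_scale cfun.span_diff cfun.span_sum) (auto intro: cfun.span_base)
qed

text \<open>Each \<open>v i\<close> is its projection plus a multiple of its normalised residual.
  This remains true when the residual is 0, so dependent vectors cause no loss.\<close>

lemma span_gram_schmidt: "cfun.span (gram_schmidt v ` {..<m}) = cfun.span (v ` {..<m})"
proof (rule antisym; rule cfun.span_minimal)
  have "gram_schmidt v i \<in> cfun.span (v ` {..<m})" if "i < m" for i
    using gram_schmidt_in_span[of i] cfun.span_mono[of "v ` {..i}" "v ` {..<m}"] that by fastforce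
  then show "gram_schmidt v ` {..<m} \<subseteq> cfun.span (v ` {..<m})" by blast
  have "v i \<in> cfun.span (gram_schmidt v ` {..<m})" if "i < m" for i
  proof -
    have "v i - gs_proj v i (v i) = cscale (sqrt (nsq cs (v i - gs_proj v i (v i)))) (gram_schmidt v i)"
      unfolding gram_schmidt_eq[of v i] by (rule unit_vec_scale[symmetric]) (intro sqi_diff v gs_proj_sqi)
    then have "v i = cscale (sqrt (nsq cs (v i - gs_proj v i (v i)))) (gram_schmidt v i) + gs_proj v i (v i)"
      by (metis diff_add_cancel)
    also have "\<dots> \<in> cfun.span (gram_schmidt v ` {..<m})"
      unfolding gs_proj_def using that
      by (intro cfun.span_add cfun.span_scale cfun.span_sum) (auto intro!: cfun.span_base)
    finally show ?thesis .
  qed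
  then show "v ` {..<m} \<subseteq> cfun.span (gram_schmidt v ` {..<m})" by blast
qed auto

lemma residual_orth:
  assumes \<xi>: "\<xi> \<in> sqi cs" and \<eta>: "\<eta> \<in> cfun.span (v ` {..<m})"
  shows "\<eta> \<in> sqi cs \<and> ip cs (\<xi> - gs_proj v m \<xi>) \<eta> = 0"
  using \<eta> unfolding span_gram_schmidt[symmetric]
proof (induction \<eta> rule: cfun.span_induct)
  case base
  define r where "r = \<xi> - gs_proj v m \<xi>"
  have r: "r \<in> sqi cs" unfolding r_def by (intro sqi_diff \<xi> gs_proj_sqi)
  have "cfun.subspace {\<eta>. \<eta> \<in> sqi cs \<and> ip cs r \<eta> = 0}"
    by (auto simp: cfun.subspace_def ip_add_right r)
  then show ?case unfolding r_def .
next
  case (step \<eta>)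
  then obtain j where j: "j < m" "\<eta> = gram_schmidt v j" by blast
  have "ip cs (gs_proj v m \<xi>) (gram_schmidt v j)
    = (\<Sum>i\<in>{..<m}. ip cs \<xi> (gram_schmidt v i) * ip cs (gram_schmidt v i) (gram_schmidt v j))"
    unfolding gs_proj_def using gram_schmidt_sqi by (simp add: ip_sum_left)
  also have "\<dots> = (\<Sum>i\<in>{..<m}. if i = j then ip cs \<xi> (gram_schmidt v j) * nsq cs (gram_schmidt v j) else 0)"
    by (rule sum.cong) (auto simp: gram_schmidt_orth ip_self)
  also have "\<dots> = ip cs \<xi> (gram_schmidt v j) * nsq cs (gram_schmidt v j)"
    using j by simp
  also have "\<dots> = ip cs \<xi> (gram_schmidt v j)"
    using nsq_gram_schmidt[of v j] ip_eq_0[OF \<xi> gram_schmidt_sqi[of j]] by auto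
  finally have "ip cs (\<xi> - gs_proj v m \<xi>) (gram_schmidt v j) = 0"
    using \<xi> by (simp add: ip_diff_left gs_proj_sqi gram_schmidt_sqi)
  then show ?case unfolding j(2) by (intro conjI gram_schmidt_sqi)
qed

lemma gs_proj_in_span: "gs_proj v m \<xi> \<in> cfun.span (v ` {..<m})"
  unfolding gs_proj_def span_gram_schmidt[symmetric]
  by (intro cfun.span_sum cfun.span_scale) (auto intro: cfun.span_base)

text \<open>Pythagoras: the residual is orthogonal to the span, which contains the difference of the
  two approximations.\<close>

lemma nsq_residual_le:
  assumes \<xi>: "\<xi> \<in> sqi cs" and \<eta>: "\<eta> \<in> cfun.span (v ` {..<m})"
  shows "nsq cs (\<xi> - gs_proj v m \<xi>) \<le> nsq cs (\<xi> - \<eta>)"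
proof -
  have d: "gs_proj v m \<xi> - \<eta> \<in> cfun.span (v ` {..<m})" by (intro cfun.span_diff gs_proj_in_span \<eta>)
  have "\<xi> - \<eta> = (\<xi> - gs_proj v m \<xi>) + (gs_proj v m \<xi> - \<eta>)" by simp
  then have "nsq cs (\<xi> - \<eta>) = nsq cs ((\<xi> - gs_proj v m \<xi>) + (gs_proj v m \<xi> - \<eta>))" by simp
  also have "\<dots> = nsq cs (\<xi> - gs_proj v m \<xi>) + nsq cs (gs_proj v m \<xi> - \<eta>)"
    using residual_orth[OF \<xi> d] \<xi> gs_proj_sqi by (subst nsq_add) auto
  finally show ?thesis by simp
qed

text \<open>Replaces membership in a span by an equation whose two sides depend measurably on the
  point of the torus.\<close>

lemma gs_proj_eq_iff:
  assumes \<xi>: "\<xi> \<in> sqi cs"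
  shows "gs_proj v m \<xi> = \<xi> \<longleftrightarrow> \<xi> \<in> cfun.span (v ` {..<m})"
proof
  assume "\<xi> \<in> cfun.span (v ` {..<m})"
  from nsq_residual_le[OF \<xi> this] have "nsq cs (\<xi> - gs_proj v m \<xi>) = 0"
    using nsq_nonneg[of cs "\<xi> - gs_proj v m \<xi>"] by simp
  then show "gs_proj v m \<xi> = \<xi>" using nsq_cs_eq_0_iff[of "\<xi> - gs_proj v m \<xi>"] \<xi> gs_proj_sqi by auto
qed (metis gs_proj_in_span)

end

lemma measurable_fib_sum:
  fixes \<phi> :: "'i \<Rightarrow> real ^ 'k \<Rightarrow> int ^ 'k \<Rightarrow> complex"
  assumes "\<And>i. i \<in> I \<Longrightarrow> case_prod (\<phi> i) \<in> borel_measurable fib_measure"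
  shows "case_prod (\<lambda>x. \<Sum>i\<in>I. \<phi> i x) \<in> borel_measurable (fib_measure :: ((real ^ 'k) \<times> (int ^ 'k)) measure)"
  unfolding measurable_fib_iff sum_fun_apply
  by (intro allI borel_measurable_sum assms[unfolded measurable_fib_iff, rule_format])

lemma measurable_fib_cscale:
  assumes "case_prod \<phi> \<in> borel_measurable fib_measure" "c \<in> borel_measurable torus_measure"
  shows "case_prod (\<lambda>x. cscale (c x) (\<phi> x)) \<in> borel_measurable (fib_measure :: ((real ^ 'k) \<times> (int ^ 'k)) measure)"
  using assms unfolding measurable_fib_iff by (auto intro!: borel_measurable_times)

lemma measurable_fib_diff:
  fixes \<phi> \<psi> :: "real ^ 'k \<Rightarrow> int ^ 'k \<Rightarrow> complex"
  assumes "case_prod \<phi> \<in> borel_measurable fib_measure" "case_prod \<psi> \<in> borel_measurable fib_measure"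
  shows "case_prod (\<lambda>x. \<phi> x - \<psi> x) \<in> borel_measurable (fib_measure :: ((real ^ 'k) \<times> (int ^ 'k)) measure)"
  using assms unfolding measurable_fib_iff minus_apply by (intro allI borel_measurable_diff) blast+

text \<open>The recursion consists of inner products, finite sums and a division with 1 / 0 = 0,
  each of which preserves measurability.\<close>

lemma measurable_gram_schmidt:
  fixes \<phi> :: "nat \<Rightarrow> real ^ 'k \<Rightarrow> int ^ 'k \<Rightarrow> complex"
  assumes "\<And>i. case_prod (\<phi> i) \<in> borel_measurable fib_measure"
  shows "case_prod (\<lambda>x. gram_schmidt (\<lambda>i. \<phi> i x) i) \<in> borel_measurable fib_measure"
proof (induction i rule: less_induct)
  case (less i)
  let ?r = "\<lambda>x. \<phi> i x - (\<Sum>j\<in>{..<i}. cscale (ip cs (\<phi> i x) (gram_schmidt (\<lambda>i. \<phi> i x) j)) (gram_schmidt (\<lambda>i. \<phi> i x) j))"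
  have r: "case_prod ?r \<in> borel_measurable fib_measure"
    by (intro measurable_fib_diff measurable_fib_sum measurable_fib_cscale measurable_ip_fibers assms less) auto
  have "(\<lambda>x. complex_of_real (1 / sqrt (nsq cs (?r x)))) \<in> borel_measurable torus_measure"
    using measurable_nsq_fibers[OF r r] by measurable
  from measurable_fib_cscale[OF r this]
  show ?case unfolding gram_schmidt.simps[of _ i] unit_vec_def .
qed

lemma measurable_proj:
  fixes \<phi> :: "nat \<Rightarrow> real ^ 'k \<Rightarrow> int ^ 'k \<Rightarrow> complex"
  assumes "\<And>i. case_prod (\<phi> i) \<in> borel_measurable fib_measure" "case_prod \<psi> \<in> borel_measurable fib_measure"
  shows "case_prod (\<lambda>x. gs_proj (\<lambda>i. \<phi> i x) m (\<psi> x)) \<in> borel_measurable fib_measure"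
  unfolding gs_proj_def
  by (intro measurable_fib_sum measurable_fib_cscale measurable_ip_fibers measurable_gram_schmidt assms)

section \<open>Fibers of shift invariant spaces\<close>

abbreviation translates :: "(real ^ 'k \<Rightarrow> complex) set \<Rightarrow> (real ^ 'k \<Rightarrow> complex) set" where
  "translates H \<equiv> {translate (of_int_vec l) f | l f. f \<in> H}"

lemma span_translates_sqi:
  assumes "H \<subseteq> L2" "g \<in> cfun.span (translates H)"
  shows "g \<in> sqi lebesgue"
proof -
  have "translates H \<subseteq> sqi lebesgue" using assms(1) translate_sqi by (auto simp: L2_eq)
  then show ?thesis using cfun.span_minimal[OF _ subspace_sqi] assms(2) by blast
qed

text \<open>The exceptional null set depends on \<open>g\<close>. It stays null because an element
  of the span arises in finitely many steps, each of which contributes one null set.\<close>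

lemma fibers_span_translates:
  fixes H :: "(real ^ 'k \<Rightarrow> complex) set"
  assumes H: "H \<subseteq> L2" and g: "g \<in> cfun.span (translates H)"
  shows "AE x in torus_measure. \<Gamma> g x \<in> cfun.span ((\<lambda>h. \<Gamma> h x) ` H)"
proof -
  let ?S = "\<lambda>x. cfun.span ((\<lambda>h. \<Gamma> h x) ` H)"
  have "g \<in> sqi lebesgue \<and> (AE x in torus_measure. \<Gamma> g x \<in> ?S x)"
    using g
  proof (induction g rule: cfun.span_induct)
    case base
    have lin: "AE x in torus_measure. \<Gamma> (cscale a f + cscale b g) x \<in> ?S x"
      if "f \<in> sqi lebesgue" "g \<in> sqi lebesgue" "AE x in torus_measure. \<Gamma> f x \<in> ?S x"
        "AE x in torus_measure. \<Gamma> g x \<in> ?S x" for a b and f g :: "real ^ 'k \<Rightarrow> complex"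
      using \<Gamma>_linear[OF that(1,2), of a b] that(3,4)
      by eventually_elim (simp add: cfun.span_add cfun.span_scale)
    have "AE x in torus_measure. \<Gamma> 0 x \<in> ?S x"
      using \<Gamma>_linear[OF sqi_zero(1) sqi_zero(1), of 0 0] by eventually_elim (simp add: cfun.span_zero)
    moreover have "f + g \<in> sqi lebesgue \<and> (AE x in torus_measure. \<Gamma> (f + g) x \<in> ?S x)"
      if "f \<in> sqi lebesgue \<and> (AE x in torus_measure. \<Gamma> f x \<in> ?S x)"
        "g \<in> sqi lebesgue \<and> (AE x in torus_measure. \<Gamma> g x \<in> ?S x)" for f g
      using lin[of f g 1 1] that by (simp only: cfun.scale_one sqi_add)
    moreover have "cscale c f \<in> sqi lebesgue \<and> (AE x in torus_measure. \<Gamma> (cscale c f) x \<in> ?S x)"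
      if "f \<in> sqi lebesgue \<and> (AE x in torus_measure. \<Gamma> f x \<in> ?S x)" for c f
      using lin[of f f c 0] that by (simp only: cfun.scale_zero_left sqi_cscale add_0_right)
    ultimately show ?case unfolding cfun.subspace_def mem_Collect_eq by (intro conjI sqi_zero(1)) blast+
  next
    case (step g)
    then obtain l f where f: "g = translate (of_int_vec l) f" "f \<in> H" by blast
    then have fs: "f \<in> sqi lebesgue" using H by (auto simp: L2_eq)
    have "AE x in torus_measure. \<Gamma> g x \<in> ?S x"
      unfolding f(1) using \<Gamma>_translate[OF fs, of l]
      by eventually_elim (use f(2) in \<open>simp add: cfun.span_scale cfun.span_base\<close>)
    then show ?case using f(1) translate_sqi[OF fs] by blast
  qed
  then show ?thesis by blast
qed

text \<open>The squared distance of \<open>\<Gamma> f x\<close> from the span of the generators'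
  fibers is at most its squared distance from \<open>\<Gamma> g x\<close>, for every
  \<open>g\<close> in the span of the translates. Integrated, it is at most the squared distance of
  \<open>f\<close> from \<open>g\<close>, hence 0 because \<open>f\<close> lies in the
  closure.\<close>

lemma SI_span_fibers:
  fixes H :: "(real ^ 'k \<Rightarrow> complex) set"
  assumes H: "finite H" "H \<subseteq> L2" and f: "f \<in> SI_span H"
  shows "AE x in torus_measure. \<Gamma> f x \<in> cfun.span ((\<lambda>h. \<Gamma> h x) ` H)"
proof -
  obtain h0 where h0: "bij_betw h0 {..<card H} H"
    using ex_bij_betw_nat_finite[OF H(1)] by (auto simp: atLeast0LessThan)
  \<comment> \<open>Continued by 0 beyond the generators, since the Gram--Schmidt process takes a
    whole sequence.\<close>
  define h where "h i = (if i < card H then h0 i else 0)" for i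
  have H_eq: "H = h ` {..<card H}" using h0 by (auto simp: bij_betw_def h_def)
  have hs: "h i \<in> sqi lebesgue" for i
    using h0 H(2) by (auto simp: h_def bij_betw_def L2_eq)
  have im: "(\<lambda>h. \<Gamma> h x) ` H = (\<lambda>i. \<Gamma> (h i) x) ` {..<card H}" for x
    by (subst H_eq) (simp add: image_image)
  have fs: "f \<in> sqi lebesgue" using f by (auto simp: SI_span_def L2_closure_def L2_eq)
  have hAE: "AE x in torus_measure. \<forall>i. \<Gamma> (h i) x \<in> sqi cs"
    unfolding AE_all_countable using AE_fiber_sqi[OF \<Gamma>_sqi[OF hs]] by blast
  let ?r = "\<lambda>x. \<Gamma> f x - gs_proj (\<lambda>i. \<Gamma> (h i) x) (card H) (\<Gamma> f x)"
  have rm: "case_prod ?r \<in> borel_measurable fib_measure"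
    by (intro measurable_fib_diff measurable_proj sqi_measurable \<Gamma>_sqi hs fs)
  let ?R = "\<lambda>x. nsq cs (?r x)"
  have Rm: "?R \<in> borel_measurable torus_measure" by (rule measurable_nsq_fibers[OF rm rm])
  have le: "AE x in torus_measure. ?R x \<le> nsq cs (\<Gamma> f x - \<Gamma> g x)" if "g \<in> cfun.span (translates H)" for g
    using fibers_span_translates[OF H(2) that] hAE AE_fiber_sqi[OF \<Gamma>_sqi[OF fs]]
  proof eventually_elim
    case (elim x)
    then show ?case unfolding im by (intro nsq_residual_le) auto
  qed
  have "\<exists>g. g \<in> cfun.span (translates H) \<and> nsq lebesgue (f - g) < e" if e: "e > 0" for e
  proof -
    have "\<exists>g\<in>cfun.span (translates H). L2_norm (f - g) < sqrt e"
      using f e by (auto simp: SI_span_def L2_closure_def)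
    then show ?thesis by (auto simp: L2_norm_eq)
  qed
  note approx = this
  have bd: "integrable torus_measure ?R \<and> (LINT x|torus_measure. ?R x) \<le> e" if e: "e > 0" for e
  proof -
    obtain g where g: "g \<in> cfun.span (translates H)" "nsq lebesgue (f - g) < e" using approx[OF e] by blast
    have gs: "g \<in> sqi lebesgue" by (rule span_translates_sqi[OF H(2) g(1)])
    have ds: "case_prod (\<lambda>x. \<Gamma> f x - \<Gamma> g x) \<in> sqi fib_measure"
    proof -
      have "case_prod (\<lambda>x. \<Gamma> f x - \<Gamma> g x) = case_prod (\<Gamma> f) - case_prod (\<Gamma> g)" by (auto simp: fun_eq_iff)
      then show ?thesis by (simp only:) (intro sqi_diff \<Gamma>_sqi fs gs)
    qed
    have di: "integrable torus_measure (\<lambda>x. nsq cs (\<Gamma> f x - \<Gamma> g x))"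
      by (rule nsq_fibers_integrable[OF ds])
    have int: "integrable torus_measure ?R"
      by (rule Bochner_Integration.integrable_bound[OF di Rm]) (use le[OF g(1)] in auto)
    have "(LINT x|torus_measure. ?R x) \<le> (LINT x|torus_measure. nsq cs (\<Gamma> f x - \<Gamma> g x))"
      by (rule integral_mono_AE[OF int di le[OF g(1)]])
    also have "\<dots> = nsq fib_measure (case_prod (\<lambda>x. \<Gamma> f x - \<Gamma> g x))"
      by (rule nsq_fibers[OF ds, symmetric])
    also have "case_prod (\<lambda>x. \<Gamma> f x - \<Gamma> g x) = case_prod (\<Gamma> f) - case_prod (\<Gamma> g)" by (auto simp: fun_eq_iff)
    also have "nsq fib_measure \<dots> = nsq lebesgue (f - g)" by (rule nsq_\<Gamma>_diff[OF fs gs])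
    finally have "(LINT x|torus_measure. ?R x) \<le> nsq lebesgue (f - g)" .
    with g(2) have "(LINT x|torus_measure. ?R x) \<le> e" by linarith
    with int show ?thesis by blast
  qed
  have "(LINT x|torus_measure. ?R x) \<le> 0" by (rule field_le_epsilon) (use bd in auto)
  moreover have "0 \<le> (LINT x|torus_measure. ?R x)" by simp
  ultimately have "(LINT x|torus_measure. ?R x) = 0" by linarith
  then have "AE x in torus_measure. ?R x = 0"
    using integral_nonneg_eq_0_iff_AE[of torus_measure ?R] bd[of 1] by simp
  then show ?thesis using hAE AE_fiber_sqi[OF \<Gamma>_sqi[OF fs]]
  proof eventually_elim
    case (elim x)
    then have "gs_proj (\<lambda>i. \<Gamma> (h i) x) (card H) (\<Gamma> f x) = \<Gamma> f x"
      using nsq_cs_eq_0_iff[of "?r x"] gs_proj_sqi[of "\<lambda>i. \<Gamma> (h i) x"] by auto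
    then show ?case unfolding im using gs_proj_eq_iff[of "\<lambda>i. \<Gamma> (h i) x" "\<Gamma> f x"] elim by auto
  qed
qed

text \<open>Translation acts on the fibers as
  multiplication by a character, so by density of trigonometric polynomials this set is stable under
  multiplication by measurable functions.\<close>

definition SI_fibers :: "(real ^ 'k \<Rightarrow> complex) set \<Rightarrow> ((real ^ 'k) \<times> (int ^ 'k) \<Rightarrow> complex) set" where
  "SI_fibers H = {\<Phi> \<in> sqi fib_measure. \<exists>g :: nat \<Rightarrow> _. (\<forall>n. g n \<in> cfun.span (translates H)) \<and>
     (\<lambda>n. nsq fib_measure (case_prod (\<Gamma> (g n)) - \<Phi>)) \<longlonglongrightarrow> 0}"

lemma SI_fibersI:
  assumes "\<Phi> \<in> sqi fib_measure" "\<And>n. g n \<in> cfun.span (translates H)"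
    "(\<lambda>n. nsq fib_measure (case_prod (\<Gamma> (g n)) - \<Phi>)) \<longlonglongrightarrow> 0"
  shows "\<Phi> \<in> SI_fibers H"
  using assms unfolding SI_fibers_def by blast

lemma SI_fibers_sqi: "\<Phi> \<in> SI_fibers H \<Longrightarrow> \<Phi> \<in> sqi fib_measure"
  by (simp add: SI_fibers_def)

lemma AE_fib_fst:
  assumes "AE x in torus_measure. P x"
  shows "AE z in (fib_measure :: ((real ^ 'k) \<times> (int ^ 'k)) measure). P (fst z)"
proof -
  obtain N where N: "{x \<in> space torus_measure. \<not> P x} \<subseteq> N" "N \<in> null_sets torus_measure"
    using assms by (elim AE_E) (auto simp: null_sets_def)
  have "AE z in (fib_measure :: ((real ^ 'k) \<times> (int ^ 'k)) measure). fst z \<notin> N"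
    unfolding fib_measure_def
  proof (rule fib.AE_pair_measure)
    have [measurable]: "N \<in> sets torus_measure" using N(2) by auto
    show "{z \<in> space (torus_measure \<Otimes>\<^sub>M (cs :: (int ^ 'k) measure)). fst z \<notin> N}
      \<in> sets (torus_measure \<Otimes>\<^sub>M (cs :: (int ^ 'k) measure))" by measurable
    show "AE x in torus_measure. AE y in (cs :: (int ^ 'k) measure). fst (x, y) \<notin> N"
      using AE_not_in[OF N(2)] by eventually_elim simp
  qed
  then show ?thesis using AE_fib_torus by eventually_elim (use N(1) in auto)
qed

context
  fixes H :: "(real ^ 'k \<Rightarrow> complex) set"
  assumes H: "H \<subseteq> L2"
begin

lemma span_\<Gamma>_sqi: "g \<in> cfun.span (translates H) \<Longrightarrow> case_prod (\<Gamma> g) \<in> sqi fib_measure"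
  by (intro \<Gamma>_sqi span_translates_sqi[OF H])

text \<open>Diagonal argument: one combination of translates is chosen within squared distance 1 /
  Suc n of the n-th function.\<close>

lemma SI_fibers_limit:
  assumes F: "\<And>n. F n \<in> SI_fibers H" and \<Phi>: "\<Phi> \<in> sqi fib_measure"
    and lim: "(\<lambda>n. nsq fib_measure (F n - \<Phi>)) \<longlonglongrightarrow> 0"
  shows "\<Phi> \<in> SI_fibers H"
proof -
  have "\<exists>g. g \<in> cfun.span (translates H) \<and> nsq fib_measure (case_prod (\<Gamma> g) - F n) < 1 / Suc n" for n
  proof -
    obtain g where g: "\<And>m. g m \<in> cfun.span (translates H)"
      "(\<lambda>m. nsq fib_measure (case_prod (\<Gamma> (g m)) - F n)) \<longlonglongrightarrow> 0"
      using F[of n] unfolding SI_fibers_def by blast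
    have "\<forall>\<^sub>F m in sequentially. nsq fib_measure (case_prod (\<Gamma> (g m)) - F n) < 1 / Suc n"
      by (rule order_tendstoD(2)[OF g(2)]) simp
    then obtain m where "nsq fib_measure (case_prod (\<Gamma> (g m)) - F n) < 1 / Suc n"
      by (meson eventually_sequentially order_refl)
    then show ?thesis using g(1) by blast
  qed
  then have "\<exists>g. \<forall>n. g n \<in> cfun.span (translates H) \<and> nsq fib_measure (case_prod (\<Gamma> (g n)) - F n) < 1 / Suc n"
    by (intro choice allI)
  then obtain g where g: "\<And>n. g n \<in> cfun.span (translates H)"
    "\<And>n. nsq fib_measure (case_prod (\<Gamma> (g n)) - F n) < 1 / Suc n" by blast
  show ?thesis
  proof (rule SI_fibersI[OF \<Phi> g(1)])
    show "(\<lambda>n. nsq fib_measure (case_prod (\<Gamma> (g n)) - \<Phi>)) \<longlonglongrightarrow> 0"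
    proof (rule tendsto_sandwich[OF _ _ tendsto_const])
      have "(\<lambda>n. 2 * (1 / Suc n) + 2 * nsq fib_measure (F n - \<Phi>)) \<longlonglongrightarrow> 2 * 0 + 2 * 0"
        by (intro tendsto_intros lim LIMSEQ_Suc[OF lim_1_over_n])
      then show "(\<lambda>n. 2 * (1 / Suc n) + 2 * nsq fib_measure (F n - \<Phi>)) \<longlonglongrightarrow> 0" by simp
      show "\<forall>\<^sub>F n in sequentially. nsq fib_measure (case_prod (\<Gamma> (g n)) - \<Phi>) \<le> 2 * (1 / Suc n) + 2 * nsq fib_measure (F n - \<Phi>)"
      proof (intro always_eventually allI)
        fix n
        have "nsq fib_measure (case_prod (\<Gamma> (g n)) - \<Phi>)
          \<le> 2 * nsq fib_measure (case_prod (\<Gamma> (g n)) - F n) + 2 * nsq fib_measure (F n - \<Phi>)"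
          by (intro nsq_diff_triangle span_\<Gamma>_sqi g SI_fibers_sqi[OF F] \<Phi>)
        then show "nsq fib_measure (case_prod (\<Gamma> (g n)) - \<Phi>) \<le> 2 * (1 / Suc n) + 2 * nsq fib_measure (F n - \<Phi>)"
          using g(2)[of n] by linarith
      qed
    qed simp
  qed
qed

text \<open>An instance of closedness: the constant sequence \<open>F\<close> converges to
  \<open>G\<close>.\<close>

lemma SI_fibers_cong:
  assumes F: "F \<in> SI_fibers H" and G: "G \<in> borel_measurable fib_measure" and eq: "AE z in fib_measure. F z = G z"
  shows "G \<in> SI_fibers H"
proof (rule SI_fibers_limit[of "\<lambda>_. F"])
  show Gs: "G \<in> sqi fib_measure" by (rule sqi_cong_AE[OF SI_fibers_sqi[OF F] G eq])
  have "nsq fib_measure (F - G) = 0"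
    using nsq_eq_0_iff[of "F - G" fib_measure] SI_fibers_sqi[OF F] Gs eq by simp
  then show "(\<lambda>n. nsq fib_measure (F - G)) \<longlonglongrightarrow> 0" by simp
qed (rule F)

lemma SI_fibers_lincomb:
  assumes F: "F \<in> SI_fibers H" and G: "G \<in> SI_fibers H"
  shows "cscale a F + cscale b G \<in> SI_fibers H"
proof -
  obtain f where f: "\<And>n. f n \<in> cfun.span (translates H)"
    "(\<lambda>n. nsq fib_measure (case_prod (\<Gamma> (f n)) - F)) \<longlonglongrightarrow> 0" using F unfolding SI_fibers_def by blast
  obtain g where g: "\<And>n. g n \<in> cfun.span (translates H)"
    "(\<lambda>n. nsq fib_measure (case_prod (\<Gamma> (g n)) - G)) \<longlonglongrightarrow> 0" using G unfolding SI_fibers_def by blast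
  let ?h = "\<lambda>n. cscale a (f n) + cscale b (g n)"
  have h: "?h n \<in> cfun.span (translates H)" for n
    by (intro cfun.span_add cfun.span_scale f g)
  have S: "cscale a F + cscale b G \<in> sqi fib_measure"
    by (intro sqi_add sqi_cscale SI_fibers_sqi[OF F] SI_fibers_sqi[OF G])
  have "nsq fib_measure (case_prod (\<Gamma> (?h n)) - (cscale a F + cscale b G))
    = nsq fib_measure ((cscale a (case_prod (\<Gamma> (f n))) + cscale b (case_prod (\<Gamma> (g n)))) - (cscale a F + cscale b G))" for n
  proof (rule nsq_cong_AE)
    show "AE z in fib_measure. (case_prod (\<Gamma> (?h n)) - (cscale a F + cscale b G)) z
      = ((cscale a (case_prod (\<Gamma> (f n))) + cscale b (case_prod (\<Gamma> (g n)))) - (cscale a F + cscale b G)) z"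
      using \<Gamma>_lincomb_fib[OF span_translates_sqi[OF H f(1)] span_translates_sqi[OF H g(1)], of a n b n]
      by eventually_elim simp
  qed (intro sqi_measurable sqi_diff sqi_add sqi_cscale span_\<Gamma>_sqi h f g SI_fibers_sqi[OF F] SI_fibers_sqi[OF G])+
  moreover have "(\<lambda>n. nsq fib_measure ((cscale a (case_prod (\<Gamma> (f n))) + cscale b (case_prod (\<Gamma> (g n)))) - (cscale a F + cscale b G))) \<longlonglongrightarrow> 0"
    by (intro nsq_tendsto_lincomb span_\<Gamma>_sqi f g SI_fibers_sqi[OF F] SI_fibers_sqi[OF G])
  ultimately show ?thesis by (intro SI_fibersI[OF S h]) simp
qed

lemma SI_fibers_0: "0 \<in> SI_fibers H"
proof (rule SI_fibersI[of _ "\<lambda>_. 0"])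
  have "nsq fib_measure (case_prod (\<Gamma> (0 :: real ^ 'k \<Rightarrow> complex)) - 0) = 0"
    using \<Gamma>_isometry[OF sqi_zero(1)] by (simp only: diff_0_right nsq_zero(1))
  then show "(\<lambda>n. nsq fib_measure (case_prod (\<Gamma> (0 :: real ^ 'k \<Rightarrow> complex)) - 0)) \<longlonglongrightarrow> 0"
    by (simp only: tendsto_const)
qed (auto intro: cfun.span_zero)

lemma SI_fibers_add: "F \<in> SI_fibers H \<Longrightarrow> G \<in> SI_fibers H \<Longrightarrow> F + G \<in> SI_fibers H"
  using SI_fibers_lincomb[of F G 1 1] by simp

lemma SI_fibers_diff: "F \<in> SI_fibers H \<Longrightarrow> G \<in> SI_fibers H \<Longrightarrow> F - G \<in> SI_fibers H"
  using SI_fibers_lincomb[of F G 1 "-1"] by simp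

lemma SI_fibers_sum: "(\<And>i. i \<in> I \<Longrightarrow> F i \<in> SI_fibers H) \<Longrightarrow> (\<Sum>i\<in>I. F i) \<in> SI_fibers H"
  by (induction I rule: infinite_finite_induct) (auto intro: SI_fibers_0 SI_fibers_add)

lemma SI_fibers_span: "g \<in> cfun.span (translates H) \<Longrightarrow> case_prod (\<Gamma> g) \<in> SI_fibers H"
  by (rule SI_fibersI[of _ "\<lambda>_. g"]) (auto intro: span_\<Gamma>_sqi)

lemma translate_span:
  assumes "g \<in> cfun.span (translates H)"
  shows "translate (of_int_vec l) g \<in> cfun.span (translates H)"
  using assms
proof (induction g rule: cfun.span_induct)
  case base
  have "translate (of_int_vec l) (f + g) = translate (of_int_vec l) f + translate (of_int_vec l) g"
    "translate (of_int_vec l) (cscale c f) = cscale c (translate (of_int_vec l) f)"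
    "translate (of_int_vec l) 0 = (0 :: real ^ 'k \<Rightarrow> complex)" for f g :: "real ^ 'k \<Rightarrow> complex" and c
    by (auto simp: translate_def fun_eq_iff)
  then have "cfun.subspace {g. translate (of_int_vec l) g \<in> cfun.span (translates H)}"
    by (simp add: cfun.subspace_def cfun.span_zero cfun.span_add cfun.span_scale)
  then show ?case .
next
  case (step g)
  then obtain m f where f: "g = translate (of_int_vec m) f" "f \<in> H" by blast
  have "translate (of_int_vec l) g = translate (of_int_vec (l + m)) f"
    by (simp add: f(1) translate_def of_int_vec_add fun_eq_iff algebra_simps)
  then have "translate (of_int_vec l) g \<in> translates H" using f(2) by blast
  then show ?case by (rule cfun.span_base)
qed

text \<open>Translation by \<open>- l\<close> multiplies the fibers by \<open>chr l\<close>. No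
  limit is involved, so the product again comes from a finite combination of translates.\<close>

lemma trig_poly_multiplier:
  assumes g: "g \<in> cfun.span (translates H)" and p: "p \<in> trig_poly"
  shows "\<exists>g'\<in>cfun.span (translates H). AE x in torus_measure. \<Gamma> g' x = cscale (p x) (\<Gamma> g x)"
  using p
proof (induction p rule: trig_poly_induct)
  case (chr l)
  have "AE x in torus_measure. \<Gamma> (translate (of_int_vec (- l)) g) x = cscale (chr l x) (\<Gamma> g x)"
    using \<Gamma>_translate[OF span_translates_sqi[OF H g], of "- l"] by (simp add: chr_minus)
  then show ?case using translate_span[OF g, of "- l"] by blast
next
  case zero
  have "AE x in torus_measure. \<Gamma> 0 x = cscale 0 (\<Gamma> g x)"
    using \<Gamma>_linear[OF sqi_zero(1) sqi_zero(1), of 0 0] by eventually_elim simp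
  then show ?case using cfun.span_zero by blast
next
  case (add p q)
  then obtain f f' where f: "f \<in> cfun.span (translates H)" "AE x in torus_measure. \<Gamma> f x = cscale (p x) (\<Gamma> g x)"
    and f': "f' \<in> cfun.span (translates H)" "AE x in torus_measure. \<Gamma> f' x = cscale (q x) (\<Gamma> g x)" by blast
  have "AE x in torus_measure. \<Gamma> (cscale 1 f + cscale 1 f') x = cscale (p x + q x) (\<Gamma> g x)"
    using f(2) f'(2) \<Gamma>_linear[OF span_translates_sqi[OF H f(1)] span_translates_sqi[OF H f'(1)], of 1 1]
    by eventually_elim (simp add: cfun.scale_left_distrib)
  then show ?case using cfun.span_add[OF cfun.span_scale[OF f(1)] cfun.span_scale[OF f'(1)]] by blast
next
  case (scale c p)
  then obtain f where f: "f \<in> cfun.span (translates H)" "AE x in torus_measure. \<Gamma> f x = cscale (p x) (\<Gamma> g x)" by blast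
  have "AE x in torus_measure. \<Gamma> (cscale c f + cscale 0 f) x = cscale (c * p x) (\<Gamma> g x)"
    using f(2) \<Gamma>_linear[OF span_translates_sqi[OF H f(1)] span_translates_sqi[OF H f(1)], of c 0]
    by eventually_elim simp
  then show ?case using cfun.span_add[OF cfun.span_scale[OF f(1)] cfun.span_scale[OF f(1)]] by blast
qed

text \<open>Two limits in turn. For a finite combination of translates, the multiplier is
  approximated by uniformly bounded trigonometric polynomials; then the combination tends to \<Phi>
  with the multiplier fixed, at the cost of a factor \<open>B\<^sup>2\<close>.\<close>

lemma SI_fibers_bounded_mult:
  assumes \<Phi>: "\<Phi> \<in> SI_fibers H" and c: "c \<in> borel_measurable torus_measure" and B: "\<And>x. x \<in> torus \<Longrightarrow> cmod (c x) \<le> B"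
  shows "(\<lambda>z. c (fst z) * \<Phi> z) \<in> SI_fibers H"
proof -
  have "(0 :: real ^ 'k) \<in> torus" by (simp add: torus_def)
  then have B0: "B \<ge> 0" using B norm_ge_zero order_trans by blast
  have "\<exists>p. (\<forall>n. p n \<in> trig_poly) \<and> (\<forall>n. \<forall>x\<in>torus. cmod (p n x) \<le> B + 1) \<and>
      (AE x in torus_measure. (\<lambda>n. p n x) \<longlonglongrightarrow> c x)"
  proof (rule trig_poly_bounded_approx[of c B])
    show "c \<in> borel_measurable torus_measure" by (rule c)
    show "cmod (c x) \<le> B" if "x \<in> torus" for x using B that .
  qed blast
  then obtain p where p: "\<And>n. p n \<in> trig_poly" "\<And>n x. x \<in> torus \<Longrightarrow> cmod (p n x) \<le> B + 1"
    "AE x in torus_measure. (\<lambda>n::nat. p n x) \<longlonglongrightarrow> c x" by blast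
  have plim: "AE z in (fib_measure :: ((real ^ 'k) \<times> (int ^ 'k)) measure). (\<lambda>n. p n (fst z)) \<longlonglongrightarrow> c (fst z)"
    by (rule AE_fib_fst[OF p(3)])
  have span: "(\<lambda>z. c (fst z) * case_prod (\<Gamma> g) z) \<in> SI_fibers H" if g: "g \<in> cfun.span (translates H)" for g
  proof -
    have gs: "case_prod (\<Gamma> g) \<in> sqi fib_measure" by (rule span_\<Gamma>_sqi[OF g])
    have "\<exists>g'. \<forall>n. g' n \<in> cfun.span (translates H) \<and> (AE x in torus_measure. \<Gamma> (g' n) x = cscale (p n x) (\<Gamma> g x))"
      using trig_poly_multiplier[OF g p(1)] by (intro choice allI) blast
    then obtain g' where g': "\<And>n. g' n \<in> cfun.span (translates H)" "\<And>n. AE x in torus_measure. \<Gamma> (g' n) x = cscale (p n x) (\<Gamma> g x)"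
      by blast
    let ?P = "\<lambda>n z. p n (fst z) * case_prod (\<Gamma> g) z"
    have P: "?P n \<in> sqi fib_measure" for n
      by (rule sqi_fib_bounded_mult[OF gs trig_poly_measurable[OF p(1)] p(2)])
    have C: "(\<lambda>z. c (fst z) * case_prod (\<Gamma> g) z) \<in> sqi fib_measure"
      by (rule sqi_fib_bounded_mult[OF gs c B])
    have PF: "?P n \<in> SI_fibers H" for n
    proof (rule SI_fibers_cong[OF SI_fibers_span[OF g'(1)]])
      show "?P n \<in> borel_measurable fib_measure" by (rule sqi_measurable[OF P])
      have Pc: "?P n = case_prod (\<lambda>x. cscale (p n x) (\<Gamma> g x))" by (auto simp: fun_eq_iff)
      have "AE z in fib_measure. case_prod (\<Gamma> (g' n)) z = case_prod (\<lambda>x. cscale (p n x) (\<Gamma> g x)) z"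
        by (rule AE_fibI[OF sqi_measurable[OF span_\<Gamma>_sqi[OF g'(1)]] _ g'(2)])
          (use sqi_measurable[OF P[of n]] in \<open>simp only: Pc\<close>)
      then show "AE z in fib_measure. case_prod (\<Gamma> (g' n)) z = ?P n z"
        by eventually_elim (simp add: split_beta)
    qed
    have "(\<lambda>n. nsq fib_measure (?P n - (\<lambda>z. c (fst z) * case_prod (\<Gamma> g) z))) \<longlonglongrightarrow> 0"
    proof (rule nsq_dominated_tendsto[OF sqi_measurable[OF P] sqi_measurable[OF C], of "cscale (complex_of_real (B + 1)) (case_prod (\<Gamma> g))"])
      show "cscale (complex_of_real (B + 1)) (case_prod (\<Gamma> g)) \<in> sqi fib_measure" by (intro sqi_cscale gs)
      show "AE z in fib_measure. (\<lambda>n. ?P n z) \<longlonglongrightarrow> c (fst z) * case_prod (\<Gamma> g) z"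
        using plim by eventually_elim (intro tendsto_mult tendsto_const)
      show "AE z in fib_measure. cmod (?P n z) \<le> cmod (cscale (complex_of_real (B + 1)) (case_prod (\<Gamma> g)) z)" for n
        using AE_fib_torus
      proof eventually_elim
        case (elim z)
        have "cmod (complex_of_real (B + 1)) = B + 1" unfolding norm_of_real using B0 by simp
        then show ?case
          unfolding cscale_apply norm_mult using p(2)[OF elim, of n] by (intro mult_right_mono) auto
      qed
    qed
    then show ?thesis by (rule SI_fibers_limit[OF PF C])
  qed
  obtain g where g: "\<And>n. g n \<in> cfun.span (translates H)"
    "(\<lambda>n. nsq fib_measure (case_prod (\<Gamma> (g n)) - \<Phi>)) \<longlonglongrightarrow> 0" using \<Phi> unfolding SI_fibers_def by blast
  have C: "(\<lambda>z. c (fst z) * \<Phi> z) \<in> sqi fib_measure"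
    by (rule sqi_fib_bounded_mult[OF SI_fibers_sqi[OF \<Phi>] c B])
  show ?thesis
  proof (rule SI_fibers_limit[OF span[OF g(1)] C])
    show "(\<lambda>n. nsq fib_measure ((\<lambda>z. c (fst z) * case_prod (\<Gamma> (g n)) z) - (\<lambda>z. c (fst z) * \<Phi> z))) \<longlonglongrightarrow> 0"
    proof (rule tendsto_sandwich[OF _ _ tendsto_const])
      show "(\<lambda>n. B\<^sup>2 * nsq fib_measure (case_prod (\<Gamma> (g n)) - \<Phi>)) \<longlonglongrightarrow> 0"
        using tendsto_mult_right_zero[OF g(2)] by simp
      show "\<forall>\<^sub>F n in sequentially. nsq fib_measure ((\<lambda>z. c (fst z) * case_prod (\<Gamma> (g n)) z) - (\<lambda>z. c (fst z) * \<Phi> z))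
        \<le> B\<^sup>2 * nsq fib_measure (case_prod (\<Gamma> (g n)) - \<Phi>)"
      proof (intro always_eventually allI)
        fix n
        have d: "case_prod (\<Gamma> (g n)) - \<Phi> \<in> sqi fib_measure"
          by (intro sqi_diff span_\<Gamma>_sqi g SI_fibers_sqi[OF \<Phi>])
        have "nsq fib_measure ((\<lambda>z. c (fst z) * case_prod (\<Gamma> (g n)) z) - (\<lambda>z. c (fst z) * \<Phi> z))
          \<le> nsq fib_measure (cscale (complex_of_real B) (case_prod (\<Gamma> (g n)) - \<Phi>))"
        proof (rule nsq_mono)
          show "(\<lambda>z. c (fst z) * case_prod (\<Gamma> (g n)) z) - (\<lambda>z. c (fst z) * \<Phi> z) \<in> sqi fib_measure"
            by (intro sqi_diff C sqi_fib_bounded_mult[OF span_\<Gamma>_sqi[OF g(1)] c B])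
          show "cscale (complex_of_real B) (case_prod (\<Gamma> (g n)) - \<Phi>) \<in> sqi fib_measure"
            by (intro sqi_cscale d)
          show "AE z in fib_measure. cmod (((\<lambda>z. c (fst z) * case_prod (\<Gamma> (g n)) z) - (\<lambda>z. c (fst z) * \<Phi> z)) z)
            \<le> cmod (cscale (complex_of_real B) (case_prod (\<Gamma> (g n)) - \<Phi>) z)"
            using AE_fib_torus
          proof eventually_elim
            case (elim z)
            have "c (fst z) * case_prod (\<Gamma> (g n)) z - c (fst z) * \<Phi> z = c (fst z) * (case_prod (\<Gamma> (g n)) z - \<Phi> z)"
              by (simp add: algebra_simps)
            then show ?case
              unfolding cscale_apply minus_apply using B[OF elim] B0 by (simp add: norm_mult mult_right_mono)
          qed
        qed
        then show "nsq fib_measure ((\<lambda>z. c (fst z) * case_prod (\<Gamma> (g n)) z) - (\<lambda>z. c (fst z) * \<Phi> z))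
          \<le> B\<^sup>2 * nsq fib_measure (case_prod (\<Gamma> (g n)) - \<Phi>)" by (simp only: nsq_cscale norm_of_real power2_abs)
      qed
    qed simp
  qed
qed

text \<open>Truncations of \<open>c\<close> are bounded multipliers, and their products are
  dominated by the full product, which is square integrable.\<close>

lemma SI_fibers_mult:
  assumes \<Phi>: "\<Phi> \<in> SI_fibers H" and c: "c \<in> borel_measurable torus_measure"
    and s: "(\<lambda>z. c (fst z) * \<Phi> z) \<in> sqi fib_measure"
  shows "(\<lambda>z. c (fst z) * \<Phi> z) \<in> SI_fibers H"
proof -
  define d where "d n x = (if cmod (c x) \<le> real n then c x else 0)" for n x
  have dm: "d n \<in> borel_measurable torus_measure" for n unfolding d_def using c by measurable
  have dB: "cmod (d n x) \<le> real n" for n x by (simp add: d_def)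
  have dF: "(\<lambda>z. d n (fst z) * \<Phi> z) \<in> SI_fibers H" for n
    by (rule SI_fibers_bounded_mult[OF \<Phi> dm dB])
  show ?thesis
  proof (rule SI_fibers_limit[OF dF s])
    show "(\<lambda>n. nsq fib_measure ((\<lambda>z. d n (fst z) * \<Phi> z) - (\<lambda>z. c (fst z) * \<Phi> z))) \<longlonglongrightarrow> 0"
    proof (rule nsq_dominated_tendsto[OF sqi_measurable[OF SI_fibers_sqi[OF dF]] sqi_measurable[OF s] s])
      have "(\<lambda>n. d n x) \<longlonglongrightarrow> c x" for x
      proof (rule tendsto_eventually)
        obtain m :: nat where "cmod (c x) \<le> real m" using real_arch_simple by blast
        then show "\<forall>\<^sub>F n in sequentially. d n x = c x"
          by (auto simp: eventually_sequentially d_def intro!: exI[of _ m])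
      qed
      then show "AE z in fib_measure. (\<lambda>n. d n (fst z) * \<Phi> z) \<longlonglongrightarrow> c (fst z) * \<Phi> z"
        by (intro AE_I2 tendsto_mult tendsto_const)
      show "AE z in fib_measure. cmod (d n (fst z) * \<Phi> z) \<le> cmod (c (fst z) * \<Phi> z)" for n
        by (rule AE_I2) (simp add: d_def)
    qed
  qed
qed

end

lemma SI_span_if_SI_fibers:
  fixes H :: "(real ^ 'k \<Rightarrow> complex) set"
  assumes H: "H \<subseteq> L2" and f: "f \<in> sqi lebesgue" and F: "case_prod (\<Gamma> f) \<in> SI_fibers H"
  shows "f \<in> SI_span H"
proof -
  obtain g where g: "\<And>n. g n \<in> cfun.span (translates H)"
    "(\<lambda>n. nsq fib_measure (case_prod (\<Gamma> (g n)) - case_prod (\<Gamma> f))) \<longlonglongrightarrow> 0" using F unfolding SI_fibers_def by blast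
  have "\<exists>h\<in>cfun.span (translates H). L2_norm (f - h) < e" if e: "e > 0" for e
  proof -
    have "\<forall>\<^sub>F n in sequentially. nsq fib_measure (case_prod (\<Gamma> (g n)) - case_prod (\<Gamma> f)) < e\<^sup>2"
      by (rule order_tendstoD(2)[OF g(2)]) (use e in simp)
    then obtain n where "nsq fib_measure (case_prod (\<Gamma> (g n)) - case_prod (\<Gamma> f)) < e\<^sup>2"
      by (meson eventually_sequentially order_refl)
    then have "nsq lebesgue (f - g n) < e\<^sup>2"
      using nsq_\<Gamma>_diff[OF span_translates_sqi[OF H g(1)[of n]] f] nsq_minus_commute[of lebesgue f "g n"] by simp
    then have "sqrt (nsq lebesgue (f - g n)) < e"
      using real_sqrt_less_mono[of "nsq lebesgue (f - g n)" "e\<^sup>2"] e by simp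
    then show ?thesis using g(1) by (auto simp: L2_norm_eq)
  qed
  then show ?thesis using f by (simp add: SI_span_def L2_closure_def L2_eq)
qed

section \<open>Gram--Schmidt vectors as fibers of elements of the space\<close>

context
  fixes H :: "(real ^ 'k \<Rightarrow> complex) set" and \<phi> :: "nat \<Rightarrow> real ^ 'k \<Rightarrow> int ^ 'k \<Rightarrow> complex"
  assumes H: "H \<subseteq> L2" and \<phi>: "\<And>i. case_prod (\<phi> i) \<in> SI_fibers H"
begin

abbreviation gsf :: "nat \<Rightarrow> real ^ 'k \<Rightarrow> int ^ 'k \<Rightarrow> complex" where
  "gsf i x \<equiv> gram_schmidt (\<lambda>i. \<phi> i x) i"

lemma \<phi>_sqi: "case_prod (\<phi> i) \<in> sqi fib_measure"
  by (rule SI_fibers_sqi[OF \<phi>])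

lemma gsf_measurable: "case_prod (gsf i) \<in> borel_measurable fib_measure"
  by (intro measurable_gram_schmidt sqi_measurable \<phi>_sqi)

lemma AE_\<phi>: "AE x in torus_measure. \<forall>i. \<phi> i x \<in> sqi cs"
  unfolding AE_all_countable using AE_fiber_sqi[OF \<phi>_sqi] by blast

text \<open>The coefficient is measurable but possibly unbounded. By Cauchy--Schwarz against a
  vector of norm 0 or 1, the component is no longer than \<psi> on each fiber, which gives the
  square integrability that \<open>SI_fibers_mult\<close> asks for.\<close>

lemma gsf_component:
  assumes E: "case_prod (gsf j) \<in> SI_fibers H" and \<psi>: "case_prod \<psi> \<in> sqi fib_measure"
  shows "case_prod (\<lambda>x. cscale (ip cs (\<psi> x) (gsf j x)) (gsf j x)) \<in> SI_fibers H"
proof -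
  define c where "c x = ip cs (\<psi> x) (gsf j x)" for x
  have c: "c \<in> borel_measurable torus_measure"
    unfolding c_def by (intro measurable_ip_fibers sqi_measurable \<psi> gsf_measurable)
  let ?\<chi> = "\<lambda>x. cscale (c x) (gsf j x)"
  have m: "case_prod ?\<chi> \<in> borel_measurable fib_measure"
    by (intro measurable_fib_cscale gsf_measurable c)
  have eq: "case_prod ?\<chi> = (\<lambda>z. c (fst z) * case_prod (gsf j) z)" by (auto simp: fun_eq_iff)
  have AE: "AE x in torus_measure. ?\<chi> x \<in> sqi cs \<and> nsq cs (?\<chi> x) \<le> nsq cs (\<psi> x)"
    using AE_\<phi> AE_fiber_sqi[OF \<psi>]
  proof eventually_elim
    case (elim x)
    have g: "gsf j x \<in> sqi cs" by (rule gram_schmidt_sqi) (use elim in blast)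
    have "(cmod (c x))\<^sup>2 \<le> nsq cs (\<psi> x) * nsq cs (gsf j x)"
      unfolding c_def by (rule cauchy_schwarz[OF elim(2) g])
    then have "(cmod (c x))\<^sup>2 * nsq cs (gsf j x) \<le> nsq cs (\<psi> x)"
      using nsq_gram_schmidt[of "\<lambda>i. \<phi> i x" j] by auto
    then have "nsq cs (?\<chi> x) \<le> nsq cs (\<psi> x)" by (simp only: nsq_cscale)
    then show ?case using sqi_cscale[OF g] by blast
  qed
  have "case_prod ?\<chi> \<in> sqi fib_measure"
  proof (rule sqi_fibI[OF m])
    show "AE x in torus_measure. ?\<chi> x \<in> sqi cs" using AE by eventually_elim blast
    show "integrable torus_measure (\<lambda>x. nsq cs (?\<chi> x))"
    proof (rule Bochner_Integration.integrable_bound[OF nsq_fibers_integrable[OF \<psi>]])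
      show "(\<lambda>x. nsq cs (?\<chi> x)) \<in> borel_measurable torus_measure" by (rule measurable_nsq_fibers[OF m m])
      show "AE x in torus_measure. norm (nsq cs (?\<chi> x)) \<le> norm (nsq cs (\<psi> x))"
        using AE by eventually_elim (simp only: real_norm_def abs_of_nonneg nsq_nonneg)
    qed
  qed
  then have "case_prod ?\<chi> \<in> SI_fibers H"
    unfolding eq by (rule SI_fibers_mult[OF H E c])
  then show ?thesis unfolding c_def .
qed

lemma case_prod_sum: "case_prod (\<lambda>x. \<Sum>i\<in>I. f i x) = (\<Sum>i\<in>I. case_prod (f i))"
  for f :: "nat \<Rightarrow> real ^ 'k \<Rightarrow> int ^ 'k \<Rightarrow> complex"
  by (auto simp: fun_eq_iff sum_fun_apply)

lemma case_prod_diff: "case_prod (\<lambda>x. f x - g x) = case_prod f - case_prod g"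
  for f g :: "real ^ 'k \<Rightarrow> int ^ 'k \<Rightarrow> complex"
  by (auto simp: fun_eq_iff)

text \<open>The normalising factor blows up where the residual is small. The normalised vectors
  nevertheless have norm at most 1 over a torus of finite measure, so the product is square
  integrable.\<close>

lemma gsf_SI_fibers: "case_prod (gsf i) \<in> SI_fibers H"
proof (induction i rule: less_induct)
  case (less i)
  define r where "r x = \<phi> i x - (\<Sum>j\<in>{..<i}. cscale (ip cs (\<phi> i x) (gsf j x)) (gsf j x))" for x
  have r: "case_prod r \<in> SI_fibers H"
    unfolding r_def case_prod_diff case_prod_sum
    by (intro SI_fibers_diff[OF H] SI_fibers_sum[OF H] gsf_component \<phi> \<phi>_sqi less.IH) simp
  define c where "c x = complex_of_real (1 / sqrt (nsq cs (r x)))" for x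
  have rm: "case_prod r \<in> borel_measurable fib_measure" by (intro sqi_measurable SI_fibers_sqi[OF r])
  have c: "c \<in> borel_measurable torus_measure"
    unfolding c_def using measurable_nsq_fibers[OF rm rm] by measurable
  have gs: "gsf i x = cscale (c x) (r x)" for x
    unfolding gram_schmidt.simps[of _ i] unit_vec_def r_def c_def ..
  have eq: "case_prod (gsf i) = (\<lambda>z. c (fst z) * case_prod r z)"
    unfolding gs by (auto simp: fun_eq_iff)
  have "case_prod (gsf i) \<in> sqi fib_measure"
  proof (rule sqi_fibI[OF gsf_measurable])
    show "AE x in torus_measure. gsf i x \<in> sqi cs"
      using AE_\<phi> by eventually_elim (intro gram_schmidt_sqi, blast)
    show "integrable torus_measure (\<lambda>x. nsq cs (gsf i x))"
    proof (rule torus.integrable_const_bound[of _ 1])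
      have "norm (nsq cs (gsf i x)) \<le> 1" for x
        using nsq_gram_schmidt[of "\<lambda>i. \<phi> i x" i] by auto
      then show "AE x in torus_measure. norm (nsq cs (gsf i x)) \<le> 1" by (intro AE_I2)
    qed (rule measurable_nsq_fibers[OF gsf_measurable gsf_measurable])
  qed
  then show ?case unfolding eq by (rule SI_fibers_mult[OF H r c])
qed

text \<open>The projection of \<psi> is a finite sum of components already known to lie in the set,
  and it agrees with \<psi> almost everywhere.\<close>

lemma SI_fibers_if_in_span:
  assumes \<psi>: "case_prod \<psi> \<in> sqi fib_measure"
    and span: "AE x in torus_measure. \<psi> x \<in> cfun.span ((\<lambda>i. \<phi> i x) ` {..<m})"
  shows "case_prod \<psi> \<in> SI_fibers H"
proof -
  let ?p = "\<lambda>x. gs_proj (\<lambda>i. \<phi> i x) m (\<psi> x)"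
  have p: "case_prod ?p \<in> SI_fibers H"
    unfolding gs_proj_def case_prod_sum
    by (intro SI_fibers_sum[OF H] gsf_component gsf_SI_fibers \<psi>)
  have "AE x in torus_measure. ?p x = \<psi> x"
    using AE_\<phi> AE_fiber_sqi[OF \<psi>] span
    by eventually_elim (subst gs_proj_eq_iff, auto)
  then have "AE z in fib_measure. case_prod ?p z = case_prod \<psi> z"
    by (intro AE_fibI sqi_measurable SI_fibers_sqi[OF p] \<psi>)
  then show ?thesis by (intro SI_fibers_cong[OF H p] sqi_measurable \<psi>)
qed

end

theorem SI_span_if_fibers:
  fixes H :: "(real ^ 'k \<Rightarrow> complex) set"
  assumes H: "finite H" "H \<subseteq> L2" and f: "f \<in> sqi lebesgue"
    and span: "AE x in torus_measure. \<Gamma> f x \<in> cfun.span ((\<lambda>h. \<Gamma> h x) ` H)"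
  shows "f \<in> SI_span H"
proof -
  obtain h0 where h0: "bij_betw h0 {..<card H} H"
    using ex_bij_betw_nat_finite[OF H(1)] by (auto simp: atLeast0LessThan)
  define h where "h i = (if i < card H then h0 i else 0)" for i
  have H_eq: "H = h ` {..<card H}" using h0 by (auto simp: bij_betw_def h_def)
  have "h i \<in> cfun.span (translates H)" for i
  proof (cases "i < card H")
    case True
    then have "h i \<in> H" using h0 by (auto simp: h_def bij_betw_def)
    moreover have "h i = translate (of_int_vec 0) (h i)" by (simp add: translate_def)
    ultimately have "\<exists>l f. h i = translate (of_int_vec l) f \<and> f \<in> H" by blast
    then have "h i \<in> translates H" by (simp only: mem_Collect_eq)
    then show ?thesis by (rule cfun.span_base)
  qed (simp add: h_def cfun.span_zero)
  then have F: "case_prod (\<Gamma> (h i)) \<in> SI_fibers H" for i by (rule SI_fibers_span[OF H(2)])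
  have im: "(\<lambda>h. \<Gamma> h x) ` H = (\<lambda>i. \<Gamma> (h i) x) ` {..<card H}" for x
    by (subst H_eq) (simp add: image_image)
  have "case_prod (\<Gamma> f) \<in> SI_fibers H"
    by (rule SI_fibers_if_in_span[where \<phi> = "\<lambda>i. \<Gamma> (h i)", OF H(2) F \<Gamma>_sqi[OF f] span[unfolded im]])
  then show ?thesis by (rule SI_span_if_SI_fibers[OF H(2) f])
qed

section \<open>Eigenvalues of frame operators\<close>

text \<open>Indexed from 0, whereas the generators \<open>F\<close> in
  \<open>frame_operator_fiber\<close> are numbered from 1.\<close>

definition frame_op :: "nat \<Rightarrow> (nat \<Rightarrow> int ^ 'k \<Rightarrow> complex) \<Rightarrow> (int ^ 'k \<Rightarrow> complex) \<Rightarrow> int ^ 'k \<Rightarrow> complex" where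
  "frame_op n g \<xi> = (\<Sum>j<n. cscale (ip cs \<xi> (g j)) (g j))"

lemma eigenvalue_seq_cong:
  assumes "\<And>\<xi>. \<xi> \<in> ell2 \<Longrightarrow> T \<xi> = T' \<xi>"
  shows "eigenvalue_seq T = eigenvalue_seq T'"
proof -
  have "ell2_eigenspace T = ell2_eigenspace T'"
    using assms by (auto simp: ell2_eigenspace_def fun_eq_iff)
  then show ?thesis by (simp add: eigenvalue_seq_def nonzero_eigenvalues_def fun_eq_iff)
qed

lemma orthogonal_independent:
  assumes J: "finite J" and g: "\<And>j. j \<in> J \<Longrightarrow> g j \<in> sqi cs" and nz: "\<And>j. j \<in> J \<Longrightarrow> nsq cs (g j) \<noteq> 0"
    and orth: "\<And>i j. i \<in> J \<Longrightarrow> j \<in> J \<Longrightarrow> i \<noteq> j \<Longrightarrow> ip cs (g i) (g j) = 0"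
  shows "inj_on g J" "cfun.independent (g ` J)"
proof -
  show inj: "inj_on g J"
  proof (rule inj_onI, rule ccontr)
    fix i j assume "i \<in> J" "j \<in> J" "g i = g j" "i \<noteq> j"
    then show False using orth[of i j] nz[of j] by (simp add: ip_self)
  qed
  show "cfun.independent (g ` J)"
  proof (rule cfun.independent_if_scalars_zero)
    fix f x assume s: "(\<Sum>x\<in>g ` J. cscale (f x) x) = 0" and "x \<in> g ` J"
    then obtain j where j: "j \<in> J" "x = g j" by blast
    have s': "(\<Sum>i\<in>J. cscale (f (g i)) (g i)) = 0"
      using s by (simp add: sum.reindex[OF inj] o_def)
    have "0 = ip cs (\<Sum>i\<in>J. cscale (f (g i)) (g i)) (g j)" unfolding s' by simp
    also have "\<dots> = (\<Sum>i\<in>J. f (g i) * ip cs (g i) (g j))"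
      using g j by (simp add: ip_sum_left)
    also have "\<dots> = (\<Sum>i\<in>J. if i = j then f (g j) * nsq cs (g j) else 0)"
      by (rule sum.cong) (use orth j in \<open>auto simp: ip_self\<close>)
    finally show "f x = 0" using j J nz by simp
  qed (use J in simp)
qed

lemma sorted_concat_replicate:
  fixes L :: "real list"
  assumes "sorted L"
  shows "sorted (concat (map (\<lambda>\<mu>. replicate (c \<mu>) \<mu>) L))"
  using assms by (induction L) (auto simp: sorted_append)

text \<open>\<open>nonzero_eigenvalues\<close> repeats each distinct value according to its
  multiplicity. When the multiplicities are those of a list, this amounts to sorting the
  list.\<close>

lemma sort_eq_concat_replicate:
  fixes xs :: "real list"
  shows "concat (map (\<lambda>\<mu>. replicate (count (mset xs) \<mu>) \<mu>) (sorted_list_of_set (set xs))) = sort xs"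
proof (rule properties_for_sort[symmetric])
  have "count (mset (concat (map (\<lambda>\<mu>. replicate (c \<mu>) \<mu>) L))) x = (if x \<in> set L then c x else 0)"
    if "distinct L" for c :: "real \<Rightarrow> nat" and L x
    using that by (induction L) auto
  then show "mset (concat (map (\<lambda>\<mu>. replicate (count (mset xs) \<mu>) \<mu>) (sorted_list_of_set (set xs)))) = mset xs"
    by (intro multiset_eqI) (auto simp: count_eq_zero_iff)
qed (simp add: sorted_concat_replicate)

text \<open>In a non-increasing list of nonnegative numbers the zeros form the tail, so completing
  with zeros undoes their removal.\<close>

lemma nth_filter_pos:
  fixes zs :: "real list"
  assumes "sorted_wrt (\<ge>) zs" "\<And>z. z \<in> set zs \<Longrightarrow> z \<ge> 0"
  shows "(if j < length (filter (\<lambda>z. z > 0) zs) then filter (\<lambda>z. z > 0) zs ! j else 0)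
    = (if j < length zs then zs ! j else 0)"
  using assms
proof (induction zs arbitrary: j)
  case (Cons z zs)
  show ?case
  proof (cases "z > 0")
    case True
    have IH: "(if i < length (filter (\<lambda>z. z > 0) zs) then filter (\<lambda>z. z > 0) zs ! i else 0)
      = (if i < length zs then zs ! i else 0)" for i
      by (rule Cons.IH) (use Cons.prems in auto)
    show ?thesis
    proof (cases j)
      case 0
      then show ?thesis using True by simp
    next
      case (Suc i)
      then show ?thesis using True IH[of i] by (auto split: if_splits)
    qed
  next
    case False
    then have "z = 0" using Cons.prems(2)[of z] by auto
    then have "y = 0" if "y \<in> set zs" for y using Cons.prems that by (auto intro: antisym)
    then have zero: "y = 0" if "y \<in> set (z # zs)" for y using \<open>z = 0\<close> that by auto
    then have "filter (\<lambda>z. z > 0) (z # zs) = []" unfolding filter_empty_conv by (metis less_irrefl)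
    moreover have "(z # zs) ! j = 0" if "j < length (z # zs)" using zero nth_mem[OF that] by blast
    ultimately show ?thesis by (simp only: list.size if_cancel) simp
  qed
qed simp

text \<open>Each nonzero \<open>g i\<close> is an eigenvector whose eigenvalue is its squared norm,
  and the eigenspace of a positive \<mu> is spanned by the \<open>g i\<close> of squared norm \<mu>.
  As nonzero orthogonal vectors are independent, multiplicities count repetitions among the
  norms.\<close>

theorem eigenvalue_seq_orthogonal:
  fixes g :: "nat \<Rightarrow> int ^ 'k \<Rightarrow> complex"
  assumes g: "\<And>j. j < n \<Longrightarrow> g j \<in> sqi cs"
    and orth: "\<And>i j. i < n \<Longrightarrow> j < n \<Longrightarrow> i \<noteq> j \<Longrightarrow> ip cs (g i) (g j) = 0"
  shows "eigenvalue_seq (frame_op n g) j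
    = (if 1 \<le> j \<and> j \<le> n then rev (sort (map (\<lambda>i. nsq cs (g i)) [0..<n])) ! (j - 1) else 0)"
proof -
  let ?N = "\<lambda>i. nsq cs (g i)"
  let ?xs = "map ?N [0..<n]"
  have T: "frame_op n g (g i) = cscale (?N i) (g i)" if "i < n" for i
  proof -
    have "frame_op n g (g i) = (\<Sum>j<n. if j = i then cscale (?N i) (g i) else 0)"
      unfolding frame_op_def by (rule sum.cong) (use orth that in \<open>auto simp: ip_self\<close>)
    then show ?thesis using that by simp
  qed
  have eig: "ell2_eigenspace (frame_op n g) \<mu> = cfun.span (g ` {i\<in>{..<n}. ?N i = \<mu>})" if \<mu>: "\<mu> > 0" for \<mu>
  proof
    have "cfun.subspace (ell2_eigenspace (frame_op n g) \<mu>)"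
    proof (rule cfun.subspaceI)
      show "0 \<in> ell2_eigenspace (frame_op n g) \<mu>"
        by (simp add: ell2_eigenspace_def ell2_eq frame_op_def)
    next
      fix x y assume "x \<in> ell2_eigenspace (frame_op n g) \<mu>" "y \<in> ell2_eigenspace (frame_op n g) \<mu>"
      moreover have "frame_op n g (x + y) = frame_op n g x + frame_op n g y" if "x \<in> sqi cs" "y \<in> sqi cs"
        unfolding frame_op_def sum.distrib[symmetric]
        by (rule sum.cong) (use that g in \<open>auto simp: ip_add_left cfun.scale_left_distrib\<close>)
      ultimately show "x + y \<in> ell2_eigenspace (frame_op n g) \<mu>"
        by (simp add: ell2_eigenspace_def ell2_eq cfun.scale_right_distrib)
    next
      fix c x assume x: "x \<in> ell2_eigenspace (frame_op n g) \<mu>"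
      have "frame_op n g (cscale c x) = cscale c (frame_op n g x)"
        unfolding frame_op_def by (simp add: cfun.scale_sum_right)
      then show "cscale c x \<in> ell2_eigenspace (frame_op n g) \<mu>"
        using x by (simp add: ell2_eigenspace_def ell2_eq mult.commute)
    qed
    moreover have "g ` {i\<in>{..<n}. ?N i = \<mu>} \<subseteq> ell2_eigenspace (frame_op n g) \<mu>"
      using T g by (auto simp: ell2_eigenspace_def ell2_eq)
    ultimately show "cfun.span (g ` {i\<in>{..<n}. ?N i = \<mu>}) \<subseteq> ell2_eigenspace (frame_op n g) \<mu>"
      by (intro cfun.span_minimal)
  next
    show "ell2_eigenspace (frame_op n g) \<mu> \<subseteq> cfun.span (g ` {i\<in>{..<n}. ?N i = \<mu>})"
    proof
      fix \<xi> assume "\<xi> \<in> ell2_eigenspace (frame_op n g) \<mu>"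
      then have \<xi>: "\<xi> \<in> sqi cs" "frame_op n g \<xi> = cscale \<mu> \<xi>"
        by (auto simp: ell2_eigenspace_def ell2_eq)
      \<comment> \<open>The eigenvalue equation paired with \<open>g i\<close>. Vanishing vectors
        fall under this case, since their squared norm 0 differs from \<mu>.\<close>
      have zero: "ip cs \<xi> (g i) = 0" if "i < n" "?N i \<noteq> \<mu>" for i
      proof -
        have "\<mu> * ip cs \<xi> (g i) = ip cs (frame_op n g \<xi>) (g i)" by (simp add: \<xi>(2))
        also have "\<dots> = (\<Sum>j<n. ip cs \<xi> (g j) * ip cs (g j) (g i))"
          unfolding frame_op_def by (subst ip_sum_left) (use g that in auto)
        also have "\<dots> = (\<Sum>j<n. if j = i then ip cs \<xi> (g i) * ?N i else 0)"
          by (rule sum.cong) (use orth that in \<open>auto simp: ip_self\<close>)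
        also have "\<dots> = ip cs \<xi> (g i) * ?N i" using that by simp
        finally have "(complex_of_real \<mu> - complex_of_real (?N i)) * ip cs \<xi> (g i) = 0"
          by (simp add: algebra_simps)
        then show ?thesis using that(2) by simp
      qed
      have "frame_op n g \<xi> \<in> cfun.span (g ` {i\<in>{..<n}. ?N i = \<mu>})"
        unfolding frame_op_def
      proof (rule cfun.span_sum)
        fix i assume "i \<in> {..<n}"
        show "cscale (ip cs \<xi> (g i)) (g i) \<in> cfun.span (g ` {i\<in>{..<n}. ?N i = \<mu>})"
        proof (cases "?N i = \<mu>")
          case True
          then show ?thesis using \<open>i \<in> {..<n}\<close> by (intro cfun.span_scale cfun.span_base imageI) simp
        next
          case False
          then show ?thesis using zero[of i] \<open>i \<in> {..<n}\<close> by (simp add: cfun.span_zero)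
        qed
      qed
      then have "cscale (1 / \<mu>) (cscale \<mu> \<xi>) \<in> cfun.span (g ` {i\<in>{..<n}. ?N i = \<mu>})"
        unfolding \<xi>(2) by (rule cfun.span_scale)
      then show "\<xi> \<in> cfun.span (g ` {i\<in>{..<n}. ?N i = \<mu>})" using \<mu> by simp
    qed
  qed
  have dim: "cfun.dim (ell2_eigenspace (frame_op n g) \<mu>) = count (mset ?xs) \<mu>" if \<mu>: "\<mu> > 0" for \<mu>
  proof -
    let ?J = "{i\<in>{..<n}. ?N i = \<mu>}"
    have ind: "inj_on g ?J" "cfun.independent (g ` ?J)"
      by (rule orthogonal_independent; use g orth \<mu> in auto)+
    then have "cfun.dim (cfun.span (g ` ?J)) = card ?J"
      by (intro trans[OF cfun.dim_span_eq_card_independent card_image])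
    also have "\<dots> = length (filter (\<lambda>i. \<mu> = ?N i) [0..<n])"
      by (subst distinct_card[symmetric]) (auto intro: arg_cong[of _ _ card])
    also have "\<dots> = count (mset ?xs) \<mu>"
      unfolding count_mset count_list_eq_length_filter by (simp add: filter_map o_def)
    finally show ?thesis by (simp only: eig[OF \<mu>])
  qed
  have S: "{\<mu>. \<mu> > 0 \<and> ell2_eigenspace (frame_op n g) \<mu> \<noteq> {0}} = set (filter (\<lambda>z. z > 0) ?xs)"
  proof (intro set_eqI iffI)
    fix \<mu> assume "\<mu> \<in> {\<mu>. \<mu> > 0 \<and> ell2_eigenspace (frame_op n g) \<mu> \<noteq> {0}}"
    then have \<mu>: "\<mu> > 0" "cfun.span (g ` {i\<in>{..<n}. ?N i = \<mu>}) \<noteq> {0}" using eig by auto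
    then have "{i\<in>{..<n}. ?N i = \<mu>} \<noteq> {}" by (metis cfun.span_empty image_empty)
    then show "\<mu> \<in> set (filter (\<lambda>z. z > 0) ?xs)" using \<mu>(1) by auto
  next
    fix \<mu> assume "\<mu> \<in> set (filter (\<lambda>z. z > 0) ?xs)"
    then obtain i where i: "i < n" "\<mu> = ?N i" "\<mu> > 0" by auto
    then have "g i \<in> ell2_eigenspace (frame_op n g) \<mu>" using T g by (simp add: ell2_eigenspace_def ell2_eq)
    moreover have "g i \<noteq> 0" using i nsq_zero(1) by fastforce
    ultimately show "\<mu> \<in> {\<mu>. \<mu> > 0 \<and> ell2_eigenspace (frame_op n g) \<mu> \<noteq> {0}}" using i by blast
  qed
  let ?ys = "filter (\<lambda>z. z > 0) ?xs"
  have "nonzero_eigenvalues (frame_op n g)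
    = concat (map (\<lambda>\<mu>. replicate (count (mset ?ys) \<mu>) \<mu>) (rev (sorted_list_of_set (set ?ys))))"
    unfolding nonzero_eigenvalues_def S
    by (intro arg_cong[of _ _ concat] map_cong refl) (auto simp: dim)
  also have "\<dots> = rev (concat (map (\<lambda>\<mu>. replicate (count (mset ?ys) \<mu>) \<mu>) (sorted_list_of_set (set ?ys))))"
    by (simp add: rev_concat rev_map o_def)
  also have "\<dots> = rev (sort ?ys)" by (simp only: sort_eq_concat_replicate)
  also have "\<dots> = filter (\<lambda>z. z > 0) (rev (sort ?xs))" by (simp only: rev_filter[symmetric] filter_sort)
  finally have ne: "nonzero_eigenvalues (frame_op n g) = filter (\<lambda>z. z > 0) (rev (sort ?xs))" .
  have "(if j - 1 < length (filter (\<lambda>z. z > 0) (rev (sort ?xs))) then filter (\<lambda>z. z > 0) (rev (sort ?xs)) ! (j - 1) else 0)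
    = (if j - 1 < length (rev (sort ?xs)) then rev (sort ?xs) ! (j - 1) else 0)"
    by (rule nth_filter_pos) (auto simp: sorted_wrt_rev)
  then show ?thesis
    unfolding eigenvalue_seq_def ne by (cases j) (auto simp: Suc_le_eq split: if_splits)
qed

section \<open>Orthogonalisation by a unitary mixing\<close>

text \<open>Matrices of size \<open>n\<close>, extended by zero, with orthonormal columns; the entry \<open>U (j, i)\<close> is in
  row \<open>j\<close>.\<close>

definition orth_cols :: "nat \<Rightarrow> (nat \<times> nat \<Rightarrow> complex) set" where
  "orth_cols n = {U. (\<forall>p. fst p \<ge> n \<or> snd p \<ge> n \<longrightarrow> U p = 0) \<and>
     (\<forall>i<n. \<forall>i'<n. (\<Sum>r<n. U (r, i) * cnj (U (r, i'))) = (if i = i' then 1 else 0))}"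

definition mix :: "nat \<Rightarrow> (nat \<times> nat \<Rightarrow> complex) \<Rightarrow> (nat \<Rightarrow> int ^ 'k \<Rightarrow> complex) \<Rightarrow> nat \<Rightarrow> int ^ 'k \<Rightarrow> complex" where
  "mix n U v j = (\<Sum>i<n. cscale (U (j, i)) (v i))"

lemma orth_cols_col_norm:
  assumes "U \<in> orth_cols n" "i < n"
  shows "(\<Sum>r<n. (cmod (U (r, i)))\<^sup>2) = 1"
proof -
  have "complex_of_real (\<Sum>r<n. (cmod (U (r, i)))\<^sup>2) = (\<Sum>r<n. U (r, i) * cnj (U (r, i)))"
    by (simp only: of_real_sum complex_norm_square)
  also have "\<dots> = 1" using assms by (simp add: orth_cols_def)
  finally show ?thesis using of_real_eq_1_iff by blast
qed

lemma orth_cols_norm_le: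
  assumes "U \<in> orth_cols n" shows "cmod (U p) \<le> 1"
proof (cases "fst p < n \<and> snd p < n")
  case True
  have "(cmod (U (fst p, snd p)))\<^sup>2 \<le> (\<Sum>r<n. (cmod (U (r, snd p)))\<^sup>2)"
    using True by (intro member_le_sum) auto
  then have "(cmod (U p))\<^sup>2 \<le> 1" using orth_cols_col_norm[OF assms, of "snd p"] True by simp
  then show ?thesis by (simp add: power_le_one_iff)
next
  case False
  then have "fst p \<ge> n \<or> snd p \<ge> n" by auto
  then have "U p = 0" using assms unfolding orth_cols_def by blast
  then show ?thesis by simp
qed

text \<open>Extension by zero fixes the entries outside the block, so the set is a closed part of a
  product of compact discs and points, and Tychonoff's theorem applies.\<close>

lemma compact_orth_cols: "compact (orth_cols n)"
proof -
  let ?B = "\<lambda>p :: nat \<times> nat. if fst p \<ge> n \<or> snd p \<ge> n then {0} else cball (0 :: complex) 1"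
  let ?C = "\<lambda>i i'. {U :: nat \<times> nat \<Rightarrow> complex. (\<Sum>r<n. U (r, i) * cnj (U (r, i'))) = (if i = i' then 1 else 0)}"
  have "compactin (product_topology (\<lambda>p :: nat \<times> nat. (euclidean :: complex topology)) UNIV) (PiE UNIV ?B)"
    unfolding compactin_PiE by simp
  then have "compact (PiE UNIV ?B)" by (simp add: euclidean_product_topology)
  moreover have "closed (\<Inter>i\<in>{..<n}. \<Inter>i'\<in>{..<n}. ?C i i')"
    by (intro closed_INT ballI closed_Collect_eq continuous_on_sum continuous_on_mult continuous_on_cnj
        continuous_on_const continuous_on_product_coordinates)
  ultimately have "compact (PiE UNIV ?B \<inter> (\<Inter>i\<in>{..<n}. \<Inter>i'\<in>{..<n}. ?C i i'))" by (rule compact_Int_closed)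
  also have "PiE UNIV ?B \<inter> (\<Inter>i\<in>{..<n}. \<Inter>i'\<in>{..<n}. ?C i i') = orth_cols n"
  proof (intro set_eqI iffI)
    fix U assume "U \<in> PiE UNIV ?B \<inter> (\<Inter>i\<in>{..<n}. \<Inter>i'\<in>{..<n}. ?C i i')"
    then have B: "U p \<in> ?B p" and C: "i < n \<Longrightarrow> i' < n \<Longrightarrow> U \<in> ?C i i'" for p i i'
      by (auto simp only: PiE_iff Int_iff INT_iff lessThan_iff)
    have "U p = 0" if "fst p \<ge> n \<or> snd p \<ge> n" for p using B[of p] that by simp
    then show "U \<in> orth_cols n" using C unfolding orth_cols_def by blast
  next
    fix U assume U: "U \<in> orth_cols n"
    then show "U \<in> PiE UNIV ?B \<inter> (\<Inter>i\<in>{..<n}. \<Inter>i'\<in>{..<n}. ?C i i')"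
      using orth_cols_norm_le[OF U] by (simp add: orth_cols_def PiE_iff)
  qed
  finally show ?thesis .
qed

lemma orth_cols_nonempty: "orth_cols n \<noteq> {}"
proof -
  have "(\<lambda>p. if fst p = snd p \<and> fst p < n then 1 else 0) \<in> orth_cols n"
    by (auto simp: orth_cols_def if_distrib[of "\<lambda>x. x * _"] cong: if_cong)
  then show ?thesis by blast
qed

lemma sum_change_two:
  fixes f :: "'a \<Rightarrow> 'b::ab_group_add"
  assumes "finite S" "j \<in> S" "k \<in> S" "j \<noteq> k" "\<And>r. r \<in> S \<Longrightarrow> r \<noteq> j \<Longrightarrow> r \<noteq> k \<Longrightarrow> f' r = f r"
  shows "sum f' S = sum f S + (f' j + f' k - f j - f k)"
proof -
  have split: "sum h S = h j + (h k + sum h (S - {j} - {k}))" for h :: "'a \<Rightarrow> 'b"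
    using assms(1-4) by (simp add: sum.remove[of S j] sum.remove[of "S - {j}" k])
  have "sum f' (S - {j} - {k}) = sum f (S - {j} - {k})" by (rule sum.cong) (use assms(5) in auto)
  then show ?thesis by (simp add: split[of f'] split[of f])
qed

text \<open>Maximising a weighted sum of the squared norms with strictly decreasing weights: if two mixed
  vectors were not orthogonal, a rotation in their plane would shift norm to the heavier one.\<close>

theorem orthogonalising_mix:
  fixes v :: "nat \<Rightarrow> int ^ 'k \<Rightarrow> complex"
  assumes v: "\<And>i. i < n \<Longrightarrow> v i \<in> sqi cs"
  obtains U where "U \<in> orth_cols n" "\<And>j k. j < n \<Longrightarrow> k < n \<Longrightarrow> j \<noteq> k \<Longrightarrow> ip cs (mix n U v j) (mix n U v k) = 0"
proof -
  define \<Phi> where "\<Phi> U = (\<Sum>j<n. (real n - real j) * nsq cs (mix n U v j))" for U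
  have mix_sqi: "mix n U v j \<in> sqi cs" for U j
    unfolding mix_def by (intro sqi_sum sqi_cscale v) simp
  have nsq_mix: "nsq cs (mix n U v j) = Re (\<Sum>i<n. \<Sum>i'<n. U (j, i) * (cnj (U (j, i')) * ip cs (v i) (v i')))" for U j
  proof -
    have "ip cs (mix n U v j) (mix n U v j) = (\<Sum>i<n. U (j, i) * ip cs (v i) (mix n U v j))"
      by (subst (1) mix_def, subst ip_sum_left) (use v mix_sqi in auto)
    also have "\<dots> = (\<Sum>i<n. \<Sum>i'<n. U (j, i) * (cnj (U (j, i')) * ip cs (v i) (v i')))"
    proof (rule sum.cong[OF refl])
      fix i assume "i \<in> {..<n}"
      then have "ip cs (v i) (mix n U v j) = (\<Sum>i'<n. cnj (U (j, i')) * ip cs (v i) (v i'))"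
        unfolding mix_def by (subst ip_sum_right) (use v in auto)
      then show "U (j, i) * ip cs (v i) (mix n U v j) = (\<Sum>i'<n. U (j, i) * (cnj (U (j, i')) * ip cs (v i) (v i')))"
        by (simp add: sum_distrib_left)
    qed
    finally show ?thesis unfolding ip_self by (metis Re_complex_of_real)
  qed
  have "continuous_on (orth_cols n) \<Phi>"
    unfolding \<Phi>_def nsq_mix
    by (intro continuous_on_sum continuous_on_mult continuous_on_Re continuous_on_cnj
        continuous_on_const continuous_on_subset[OF continuous_on_product_coordinates] subset_UNIV)
  then obtain U where U: "U \<in> orth_cols n" and max: "\<And>U'. U' \<in> orth_cols n \<Longrightarrow> \<Phi> U' \<le> \<Phi> U"
    using continuous_attains_sup[OF compact_orth_cols orth_cols_nonempty] by blast
  let ?g = "mix n U v"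
  have orth: "ip cs (?g j) (?g k) = 0" if jk: "j < k" "k < n" for j k
  proof (rule ccontr)
    define w where "w = ip cs (?g j) (?g k)"
    define A where "A = nsq cs (?g j)"
    define B where "B = nsq cs (?g k)"
    assume "ip cs (?g j) (?g k) \<noteq> 0"
    then have w: "cmod w > 0" by (simp add: w_def)
    \<comment> \<open>Chosen so small that the first order gain 2 t |w| outweighs a possible second
      order loss t^2 |B - A|; the summand 1 keeps the denominator positive.\<close>
    define t where "t = cmod w / (\<bar>B - A\<bar> + 1)"
    have t: "t > 0" "t * \<bar>B - A\<bar> < cmod w"
      using w by (auto simp: t_def field_simps add_pos_nonneg)
    define s where "s = sqrt (1 + t\<^sup>2)"
    have s: "s > 0" "s\<^sup>2 = 1 + t\<^sup>2" by (auto simp: s_def add_pos_nonneg)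
    define a where "a = complex_of_real (1 / s)"
    \<comment> \<open>The phase of \<open>w\<close> makes the cross term of the rotated vector real
      and positive.\<close>
    define b where "b = complex_of_real (t / s) * (w / cmod w)"
    have na: "(cmod a)\<^sup>2 = 1 / s\<^sup>2" using s by (simp add: a_def norm_divide power_divide)
    have nb: "(cmod b)\<^sup>2 = t\<^sup>2 / s\<^sup>2" using s w t by (simp add: b_def norm_mult norm_divide power_divide)
    have ab: "(cmod a)\<^sup>2 + (cmod b)\<^sup>2 = 1"
      unfolding na nb add_divide_distrib[symmetric] s(2)[symmetric] using s(1) by simp
    then have ab': "a * cnj a + b * cnj b = 1"
      by (metis complex_norm_square of_real_add of_real_1)
    define U' where "U' p = (if fst p = j then a * U (j, snd p) + b * U (k, snd p)
      else if fst p = k then - cnj b * U (j, snd p) + cnj a * U (k, snd p) else U p)" for p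
    have U': "U' \<in> orth_cols n"
    proof -
      have "(\<Sum>r<n. U' (r, i) * cnj (U' (r, i'))) = (\<Sum>r<n. U (r, i) * cnj (U (r, i')))" for i i'
      proof -
        have "U' (j, i) * cnj (U' (j, i')) + U' (k, i) * cnj (U' (k, i'))
          = (a * cnj a + b * cnj b) * (U (j, i) * cnj (U (j, i')) + U (k, i) * cnj (U (k, i')))"
          using jk by (simp add: U'_def algebra_simps)
        also have "\<dots> = U (j, i) * cnj (U (j, i')) + U (k, i) * cnj (U (k, i'))" by (simp only: ab' mult_1)
        finally show ?thesis
          using jk by (subst sum_change_two[of "{..<n}" j k _ "\<lambda>r. U (r, i) * cnj (U (r, i'))"]) (auto simp: U'_def[of "(_, _)"] algebra_simps)
      qed
      then show ?thesis using U jk by (auto simp: orth_cols_def U'_def)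
    qed
    have gj: "mix n U' v j = cscale a (?g j) + cscale b (?g k)"
      unfolding mix_def
      by (simp add: U'_def cfun.scale_sum_right cfun.scale_left_distrib sum.distrib)
    have gk: "mix n U' v k = cscale (- cnj b) (?g j) + cscale (cnj a) (?g k)"
      unfolding mix_def
      using jk by (simp add: U'_def cfun.scale_sum_right cfun.scale_left_distrib cfun.scale_left_diff_distrib sum.distrib sum_subtractf sum_negf)
    have gr: "mix n U' v r = ?g r" if "r \<noteq> j" "r \<noteq> k" for r
      unfolding mix_def using that by (simp add: U'_def)
    have Rew: "Re (a * cnj b * w) = t * cmod w / s\<^sup>2"
    proof -
      have "a * cnj b * w = complex_of_real (t / s\<^sup>2) * ((cnj w * w) / cmod w)"
        by (simp add: a_def b_def power2_eq_square mult_ac)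
      also have "cnj w * w = complex_of_real ((cmod w)\<^sup>2)" using complex_norm_square[of w] by (simp add: mult.commute)
      finally have "a * cnj b * w = complex_of_real (t / s\<^sup>2 * ((cmod w)\<^sup>2 / cmod w))" by simp
      then have "Re (a * cnj b * w) = t / s\<^sup>2 * ((cmod w)\<^sup>2 / cmod w)" by (metis Re_complex_of_real)
      then show ?thesis using w by (simp add: power2_eq_square)
    qed
    have nj: "nsq cs (mix n U' v j) = (A + 2 * t * cmod w + t\<^sup>2 * B) / s\<^sup>2"
    proof -
      have "nsq cs (mix n U' v j) = (cmod a)\<^sup>2 * A + 2 * Re (a * cnj b * w) + (cmod b)\<^sup>2 * B"
        unfolding gj using mix_sqi by (simp add: nsq_add A_def B_def w_def mult_ac)
      then show ?thesis unfolding na nb Rew by (simp add: add_divide_distrib)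
    qed
    have nk: "nsq cs (mix n U' v k) = (t\<^sup>2 * A - 2 * t * cmod w + B) / s\<^sup>2"
    proof -
      have "nsq cs (mix n U' v k) = (cmod b)\<^sup>2 * A + 2 * Re (- cnj b * a * w) + (cmod a)\<^sup>2 * B"
        unfolding gk using mix_sqi by (simp add: nsq_add A_def B_def w_def mult_ac del: cfun.scale_minus_left)
      also have "- cnj b * a * w = - (a * cnj b * w)" by simp
      finally show ?thesis unfolding na nb uminus_complex.sel Rew by (simp add: add_divide_distrib diff_divide_distrib)
    qed
    have sum_eq: "nsq cs (mix n U' v j) + nsq cs (mix n U' v k) = A + B"
    proof -
      have "(A + 2 * t * cmod w + t\<^sup>2 * B) + (t\<^sup>2 * A - 2 * t * cmod w + B) = (A + B) * s\<^sup>2"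
        unfolding s(2) by (simp add: algebra_simps)
      then show ?thesis unfolding nj nk add_divide_distrib[symmetric] using s(1) by simp
    qed
    have gain: "nsq cs (mix n U' v j) > A"
    proof -
      have "- (t * (B - A)) \<le> t * \<bar>B - A\<bar>" using t(1) by (metis abs_ge_minus_self minus_mult_right mult_le_cancel_left_pos)
      then have "0 < t * (2 * cmod w + t * (B - A))" using t w by (intro mult_pos_pos) linarith+
      then have "A * s\<^sup>2 < A + 2 * t * cmod w + t\<^sup>2 * B" unfolding s(2) by (simp add: algebra_simps power2_eq_square)
      moreover have "s\<^sup>2 > 0" using s(1) by simp
      ultimately show ?thesis unfolding nj by (simp only: pos_less_divide_eq)
    qed
    \<comment> \<open>The sum of the two squared norms is preserved, so \<Phi> changes by the gain
      times the difference of the two weights.\<close>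
    have "\<Phi> U' = \<Phi> U + ((real n - real j) * nsq cs (mix n U' v j) + (real n - real k) * nsq cs (mix n U' v k)
        - (real n - real j) * A - (real n - real k) * B)"
      unfolding \<Phi>_def A_def B_def using jk by (intro sum_change_two) (auto simp: gr)
    also have "nsq cs (mix n U' v k) = A + B - nsq cs (mix n U' v j)" using sum_eq by simp
    finally have "\<Phi> U' = \<Phi> U + (real k - real j) * (nsq cs (mix n U' v j) - A)" by (simp add: algebra_simps)
    moreover have "(real k - real j) * (nsq cs (mix n U' v j) - A) > 0" using gain jk by (intro mult_pos_pos) auto
    ultimately show False using max[OF U'] by linarith
  qed
  have "ip cs (?g j) (?g k) = 0" if "j < n" "k < n" "j \<noteq> k" for j k
  proof (cases "j < k")
    case False
    then have "ip cs (?g k) (?g j) = 0" using orth[of k j] that by simp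
    then show ?thesis using ip_commute[of cs "?g j" "?g k"] by simp
  qed (use orth that in simp)
  then show ?thesis by (rule that[OF U])
qed

section \<open>Mixing matrices and their doubly stochastic weights\<close>

lemma ip_count_finite: "ip (count_space {..<n}) f g = (\<Sum>r<(n::nat). f r * cnj (g r))"
  by (simp add: ip_def lebesgue_integral_count_space_finite)

lemma sqi_count_finite: "f \<in> sqi (count_space {..<(n::nat)})"
  by (simp add: sqi_def integrable_count_space)

text \<open>Bessel's inequality for the j-th coordinate vector against the orthonormal
  columns.\<close>

lemma row_norm_le:
  assumes U: "U \<in> orth_cols n" and j: "j < n"
  shows "(\<Sum>i<n. (cmod (U (j, i)))\<^sup>2) \<le> 1"
proof -
  let ?M = "count_space {..<n}"
  let ?e = "\<lambda>i r. U (r, i)"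
  let ?d = "\<lambda>r. if r = j then 1 else 0 :: complex"
  have c: "ip ?M ?d (?e i) = cnj (U (j, i))" for i
    using j by (simp add: ip_count_finite if_distrib[of "\<lambda>x. x * _"] cong: if_cong)
  have on: "ip ?M (?e i) (?e i') = (if i = i' then 1 else 0)" if "i \<in> {..<n}" "i' \<in> {..<n}" for i i'
    using U that by (simp add: ip_count_finite orth_cols_def)
  have d: "nsq ?M ?d = 1"
    using j ip_self[of ?M ?d] by (simp add: ip_count_finite if_distrib[of "\<lambda>x. x * _"] cong: if_cong)
  show ?thesis
    using orthonormal_expansion[of ?d ?M "{..<n}" ?e "\<lambda>i. ip ?M ?d (?e i)", OF sqi_count_finite sqi_count_finite _ on]
      nsq_nonneg[of ?M "?d - (\<Sum>l<n. cscale (ip ?M ?d (?e l)) (?e l))"] unfolding d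
    by (simp add: c)
qed

text \<open>The defects 1 - (row sum) are nonnegative, and they add up to n - n = 0 because every
  column has norm 1.\<close>

lemma row_norm:
  assumes U: "U \<in> orth_cols n" and j: "j < n"
  shows "(\<Sum>i<n. (cmod (U (j, i)))\<^sup>2) = 1"
proof -
  have "(\<Sum>j<n. 1 - (\<Sum>i<n. (cmod (U (j, i)))\<^sup>2)) = real n - (\<Sum>i<n. \<Sum>j<n. (cmod (U (j, i)))\<^sup>2)"
    unfolding sum_subtractf by (subst (2) sum.swap) simp
  also have "\<dots> = 0" by (simp add: orth_cols_col_norm[OF U])
  finally have "\<forall>j\<in>{..<n}. 1 - (\<Sum>i<n. (cmod (U (j, i)))\<^sup>2) = 0"
    using row_norm_le[OF U] by (subst sum_nonneg_eq_0_iff[symmetric]) auto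
  then show ?thesis using j by auto
qed

context
  fixes n and U and v :: "nat \<Rightarrow> int ^ 'k \<Rightarrow> complex"
  assumes U: "U \<in> orth_cols n" and v: "\<And>i. i < n \<Longrightarrow> v i \<in> sqi cs"
begin

lemma mix_sqi: "mix n U v j \<in> sqi cs"
  unfolding mix_def by (intro sqi_sum sqi_cscale v) simp

lemma unmix: "i < n \<Longrightarrow> v i = (\<Sum>j<n. cscale (cnj (U (j, i))) (mix n U v j))"
proof -
  assume i: "i < n"
  have "(\<Sum>j<n. cscale (cnj (U (j, i))) (mix n U v j)) = (\<Sum>j<n. \<Sum>i'<n. cscale (U (j, i') * cnj (U (j, i))) (v i'))"
    unfolding mix_def by (simp add: cfun.scale_sum_right mult.commute)
  also have "\<dots> = (\<Sum>i'<n. cscale (\<Sum>j<n. U (j, i') * cnj (U (j, i))) (v i'))"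
    by (subst sum.swap) (simp add: cfun.scale_sum_left)
  also have "\<dots> = (\<Sum>i'<n. if i' = i then v i else 0)"
    by (rule sum.cong) (use U i in \<open>auto simp: orth_cols_def\<close>)
  finally show ?thesis using i by simp
qed

text \<open>Regrouped by \<open>v i\<close>, the coefficient is the inner product of \<xi> with the
  unmixed vector, which is \<open>v i\<close> again.\<close>

lemma frame_op_mix: "\<xi> \<in> sqi cs \<Longrightarrow> frame_op n (mix n U v) \<xi> = frame_op n v \<xi>"
proof -
  assume \<xi>: "\<xi> \<in> sqi cs"
  have "frame_op n (mix n U v) \<xi> = (\<Sum>j<n. \<Sum>i<n. cscale (ip cs \<xi> (mix n U v j) * U (j, i)) (v i))"
    unfolding frame_op_def by (subst (2) mix_def) (simp add: cfun.scale_sum_right)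
  also have "\<dots> = (\<Sum>i<n. cscale (\<Sum>j<n. ip cs \<xi> (mix n U v j) * U (j, i)) (v i))"
    by (subst sum.swap) (simp add: cfun.scale_sum_left)
  also have "\<dots> = frame_op n v \<xi>"
    unfolding frame_op_def
  proof (rule sum.cong[OF refl])
    fix i assume "i \<in> {..<n}"
    then have "ip cs \<xi> (v i) = (\<Sum>j<n. ip cs \<xi> (mix n U v j) * U (j, i))"
      by (subst unmix, simp, subst ip_sum_right) (use mix_sqi \<xi> in \<open>auto simp: mult.commute\<close>)
    then show "cscale (\<Sum>j<n. ip cs \<xi> (mix n U v j) * U (j, i)) (v i) = cscale (ip cs \<xi> (v i)) (v i)" by simp
  qed
  finally show ?thesis .
qed

text \<open>Orthogonality removes the cross terms. The weights form a doubly stochastic matrix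
  carrying the eigenvalues to the norms, the source of Schur's inequality.\<close>

lemma nsq_unmix:
  assumes orth: "\<And>j k. j < n \<Longrightarrow> k < n \<Longrightarrow> j \<noteq> k \<Longrightarrow> ip cs (mix n U v j) (mix n U v k) = 0" and i: "i < n"
  shows "nsq cs (v i) = (\<Sum>j<n. (cmod (U (j, i)))\<^sup>2 * nsq cs (mix n U v j))"
proof -
  have *: "ip cs (mix n U v j) (v i) = U (j, i) * nsq cs (mix n U v j)" if "j < n" for j
  proof -
    have "ip cs (mix n U v j) (v i) = (\<Sum>k<n. U (k, i) * ip cs (mix n U v j) (mix n U v k))"
      by (subst unmix[OF i], subst ip_sum_right) (use mix_sqi in auto)
    also have "\<dots> = (\<Sum>k<n. if k = j then U (j, i) * nsq cs (mix n U v j) else 0)"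
      by (rule sum.cong) (use orth that in \<open>auto simp: ip_self\<close>)
    finally show ?thesis using that by simp
  qed
  have "complex_of_real (nsq cs (v i)) = ip cs (v i) (v i)" by (simp add: ip_self)
  also have "\<dots> = (\<Sum>j<n. cnj (U (j, i)) * ip cs (mix n U v j) (v i))"
    by (subst (1) unmix[OF i], subst ip_sum_left) (use mix_sqi v i in auto)
  also have "\<dots> = (\<Sum>j<n. complex_of_real ((cmod (U (j, i)))\<^sup>2 * nsq cs (mix n U v j)))"
    by (rule sum.cong) (auto simp: * complex_norm_square mult_ac simp del: of_real_power)
  finally show ?thesis by (simp only: of_real_sum[symmetric] of_real_eq_iff)
qed

end

section \<open>Majorization\<close>

abbreviation rsort :: "real list \<Rightarrow> real list" where
  "rsort xs \<equiv> rev (sort xs)"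

lemma rsort_nth_mono: "i \<le> j \<Longrightarrow> j < length xs \<Longrightarrow> rsort xs ! j \<le> rsort xs ! i"
  by (simp add: rev_nth sorted_nth_mono)

lemma rsort_permutation:
  obtains \<pi> where "bij_betw \<pi> {..<length xs} {..<length xs}" "\<And>i. i < length xs \<Longrightarrow> rsort xs ! \<pi> i = xs ! i"
proof -
  have "mset xs = mset (rsort xs)" by simp
  then obtain p where p: "p permutes {..<length (rsort xs)}" "permute_list p (rsort xs) = xs"
    by (rule mset_eq_permutation)
  show ?thesis
  proof (rule that)
    show "bij_betw p {..<length xs} {..<length xs}" using permutes_imp_bij[OF p(1)] by simp
    show "rsort xs ! p i = xs ! i" if "i < length xs" for i
      using permute_list_nth[OF p(1), of i] p(2) that by simp
  qed
qed

lemma sum_list_take: "k \<le> length xs \<Longrightarrow> sum_list (take k xs) = (\<Sum>i<k. xs ! i :: real)"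
  by (simp add: sum_list_sum_nth atLeast0LessThan)

text \<open>The k-th largest entry serves as threshold. Once it is subtracted, the top
  \<open>k\<close> entries are nonnegative and the others nonpositive, so full weight on the former
  and none on the latter is best; the prescribed total weight makes the threshold cancel.\<close>

lemma weighted_sum_le_top:
  assumes "\<And>j. j < length xs \<Longrightarrow> 0 \<le> t j \<and> t j \<le> 1" "(\<Sum>j<length xs. t j) = real k" "k \<le> length xs"
  shows "(\<Sum>j<length xs. t j * xs ! j) \<le> (\<Sum>j<k. rsort xs ! j)"
proof (cases k)
  case 0
  then have "\<forall>j\<in>{..<length xs}. t j = 0"
    using assms by (subst sum_nonneg_eq_0_iff[symmetric]) auto
  then show ?thesis using 0 by simp
next
  case (Suc k')
  let ?n = "length xs" and ?z = "\<lambda>j. rsort xs ! j"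
  obtain \<pi> where \<pi>: "bij_betw \<pi> {..<?n} {..<?n}" "\<And>i. i < ?n \<Longrightarrow> ?z (\<pi> i) = xs ! i"
    using rsort_permutation[of xs] by blast
  define c where "c = ?z k'"
  have ge: "?z j \<ge> c" if "j < k" for j
    unfolding c_def by (rule rsort_nth_mono) (use that Suc assms(3) in auto)
  have le: "?z j \<le> c" if "j \<ge> k" "j < ?n" for j
    unfolding c_def by (rule rsort_nth_mono) (use that Suc in auto)
  have "(\<Sum>j<?n. t j * (xs ! j - c)) \<le> (\<Sum>j<?n. if \<pi> j < k then ?z (\<pi> j) - c else 0)"
  proof (rule sum_mono)
    fix j assume "j \<in> {..<?n}"
    then have j: "j < ?n" "\<pi> j < ?n" using \<pi>(1) by (auto simp: bij_betw_def)
    show "t j * (xs ! j - c) \<le> (if \<pi> j < k then ?z (\<pi> j) - c else 0)"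
    proof (cases "\<pi> j < k")
      case True
      then show ?thesis using assms(1)[OF j(1)] ge[OF True] \<pi>(2)[OF j(1)]
        mult_right_mono[of "t j" 1 "xs ! j - c"] by simp
    next
      case False
      then show ?thesis using assms(1)[OF j(1)] le[of "\<pi> j"] j \<pi>(2)[OF j(1)]
        by (simp add: mult_nonneg_nonpos)
    qed
  qed
  also have "\<dots> = (\<Sum>j<?n. if j < k then ?z j - c else 0)"
    using sum.reindex_bij_betw[OF \<pi>(1), of "\<lambda>j. if j < k then ?z j - c else 0"] by simp
  also have "\<dots> = (\<Sum>j\<in>{..<?n} \<inter> {j. j < k}. ?z j - c)" by (simp add: sum.inter_restrict)
  also have "{..<?n} \<inter> {j. j < k} = {..<k}" using assms(3) by auto
  finally have "(\<Sum>j<?n. t j * xs ! j) - (\<Sum>j<?n. t j) * c \<le> (\<Sum>j<k. ?z j) - real k * c"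
    by (simp add: sum_subtractf right_diff_distrib sum_distrib_right)
  then show ?thesis using assms(2) by simp
qed

lemma sum_subset_le_top:
  assumes "K \<subseteq> {..<length xs}"
  shows "(\<Sum>i\<in>K. xs ! i) \<le> (\<Sum>j<card K. rsort xs ! j)"
proof -
  let ?t = "\<lambda>j. if j \<in> K then 1 else 0 :: real"
  have fin: "finite K" using assms finite_subset by blast
  have "(\<Sum>j<length xs. ?t j * xs ! j) \<le> (\<Sum>j<card K. rsort xs ! j)"
  proof (rule weighted_sum_le_top)
    show "(\<Sum>j<length xs. ?t j) = real (card K)"
      using assms by (simp add: sum.If_cases Int_absorb1)
    show "card K \<le> length xs" using card_mono[OF _ assms] by simp
  qed auto
  moreover have "(\<Sum>j<length xs. ?t j * xs ! j) = (\<Sum>i\<in>K. xs ! i)"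
    using assms by (simp add: if_distrib[of "\<lambda>x. x * _"] sum.If_cases Int_absorb1 cong: if_cong)
  ultimately show ?thesis by simp
qed

lemma sum_top_eq_subset:
  assumes "k \<le> length xs"
  obtains K where "K \<subseteq> {..<length xs}" "card K = k" "(\<Sum>j<k. rsort xs ! j) = (\<Sum>i\<in>K. xs ! i)"
proof -
  let ?n = "length xs"
  obtain \<pi> where \<pi>: "bij_betw \<pi> {..<?n} {..<?n}" "\<And>i. i < ?n \<Longrightarrow> rsort xs ! \<pi> i = xs ! i"
    using rsort_permutation[of xs] by blast
  define K where "K = {i\<in>{..<?n}. \<pi> i < k}"
  have im: "\<pi> ` K = {..<k}"
  proof
    show "{..<k} \<subseteq> \<pi> ` K"
    proof
      fix j assume "j \<in> {..<k}"
      then have "j < k" "j \<in> \<pi> ` {..<?n}" using \<pi>(1) assms by (auto simp: bij_betw_def)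
      then show "j \<in> \<pi> ` K" by (auto simp: K_def)
    qed
  qed (auto simp: K_def)
  have inj: "inj_on \<pi> K" using \<pi>(1) by (auto simp: bij_betw_def K_def inj_on_def)
  have "card K = k" using card_image[OF inj] im by simp
  moreover have "(\<Sum>j<k. rsort xs ! j) = (\<Sum>i\<in>K. rsort xs ! \<pi> i)"
    unfolding im[symmetric] by (simp add: sum.reindex[OF inj])
  moreover have "\<dots> = (\<Sum>i\<in>K. xs ! i)" by (rule sum.cong) (auto simp: K_def \<pi>(2))
  moreover have "K \<subseteq> {..<?n}" by (auto simp: K_def)
  ultimately show ?thesis using that by simp
qed

lemma rsort_id:
  assumes "\<And>i j. i \<le> j \<Longrightarrow> j < length xs \<Longrightarrow> xs ! j \<le> xs ! i"
  shows "rsort xs = xs"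
proof -
  have "sorted (rev xs)" unfolding sorted_iff_nth_mono by (auto simp: rev_nth intro!: assms)
  then have "sort (rev xs) = rev xs" by (rule sorted_sort_id)
  moreover have "sort (rev xs) = sort xs" by (rule properties_for_sort[symmetric]) auto
  ultimately show ?thesis by simp
qed

text \<open>The sum of the k largest entries of \<open>a\<close> is the largest sum over a k-element
  set of indices. Quantifying over index sets avoids sorting \<open>a\<close>, so that later the
  prescribed norms can be treated in their given order at every point.\<close>

lemma majorized_by_map_iff:
  fixes a l :: "nat \<Rightarrow> real"
  assumes mono: "\<And>i j. i \<le> j \<Longrightarrow> j < d \<Longrightarrow> l j \<le> l i"
  shows "majorized_by (map a [0..<n]) (map l [0..<d]) \<longleftrightarrow>
    (\<forall>K\<subseteq>{..<n}. card K \<le> d \<longrightarrow> sum a K \<le> sum l {..<card K}) \<and> sum a {..<n} = sum l {..<d}"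
proof -
  let ?a = "map a [0..<n]" and ?l = "map l [0..<d]"
  have l: "rsort ?l = ?l" by (rule rsort_id) (use mono in auto)
  have suml: "sum_list ?l = sum l {..<d}" "sum_list ?a = sum a {..<n}"
    by (simp_all add: sum_list_sum_nth atLeast0LessThan)
  have nth: "(\<Sum>i\<in>K. ?a ! i) = sum a K" if "K \<subseteq> {..<n}" for K
    by (rule sum.cong) (use that in auto)
  have takel: "sum_list (take k (rsort ?l)) = sum l {..<k}" if "k \<le> d" for k
    unfolding l using that by (simp add: sum_list_take)
  have takea: "sum_list (take k (rsort ?a)) = (\<Sum>j<k. rsort ?a ! j)" if "k \<le> n" for k
    using that by (intro sum_list_take) simp
  have "(\<forall>k. 1 \<le> k \<and> k \<le> min n d \<longrightarrow> (\<Sum>j<k. rsort ?a ! j) \<le> sum l {..<k}) \<longleftrightarrow>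
    (\<forall>K\<subseteq>{..<n}. card K \<le> d \<longrightarrow> sum a K \<le> sum l {..<card K})" (is "?L \<longleftrightarrow> ?R")
  proof
    assume L: ?L
    show ?R
    proof (intro allI impI)
      fix K assume K: "K \<subseteq> {..<n}" "card K \<le> d"
      then have "card K \<le> n" using card_mono[of "{..<n}" K] by simp
      have "sum a K \<le> (\<Sum>j<card K. rsort ?a ! j)"
        using sum_subset_le_top[of K ?a] K nth[OF K(1)] by simp
      also have "\<dots> \<le> sum l {..<card K}"
        using L K \<open>card K \<le> n\<close> by (cases "card K = 0") (auto simp del: card_eq_0_iff card_0_eq)
      finally show "sum a K \<le> sum l {..<card K}" .
    qed
  next
    assume R: ?R
    show ?L
    proof (intro allI impI)
      fix k assume k: "1 \<le> k \<and> k \<le> min n d"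
      obtain K where K: "K \<subseteq> {..<length ?a}" "card K = k" "(\<Sum>j<k. rsort ?a ! j) = (\<Sum>i\<in>K. ?a ! i)"
        by (rule sum_top_eq_subset[of k ?a]) (use k in auto)
      have Kn: "K \<subseteq> {..<n}" using K(1) by simp
      have "sum a K \<le> sum l {..<card K}" using R Kn K(2) k by auto
      then show "(\<Sum>j<k. rsort ?a ! j) \<le> sum l {..<k}"
        unfolding K(3) nth[OF Kn] using K(2) by simp
    qed
  qed
  then show ?thesis
    unfolding majorized_by_def suml using takel takea by auto
qed

theorem frame_op_admissible:
  fixes v :: "nat \<Rightarrow> int ^ 'k \<Rightarrow> complex"
  assumes v: "\<And>i. i < n \<Longrightarrow> v i \<in> sqi cs" and S: "finite S" "\<And>i. i < n \<Longrightarrow> v i \<in> cfun.span S"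
    and l: "\<And>j. l j = eigenvalue_seq (frame_op n v) (Suc j)"
  shows "\<And>j. j \<ge> min (cfun.dim (cfun.span S)) n \<Longrightarrow> l j = 0"
    and "majorized_by (map (\<lambda>i. nsq cs (v i)) [0..<n]) (map l [0..<cfun.dim (cfun.span S)])"
proof -
  define d where "d = cfun.dim (cfun.span S)"
  obtain U where U: "U \<in> orth_cols n"
    and orth: "\<And>j k. j < n \<Longrightarrow> k < n \<Longrightarrow> j \<noteq> k \<Longrightarrow> ip cs (mix n U v j) (mix n U v k) = 0"
    using orthogonalising_mix[of n v] v by blast
  let ?g = "mix n U v"
  let ?N = "\<lambda>j. nsq cs (?g j)"
  let ?xs = "map ?N [0..<n]"
  have gs: "?g j \<in> sqi cs" for j by (rule mix_sqi[OF U v])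
  have "eigenvalue_seq (frame_op n v) = eigenvalue_seq (frame_op n ?g)"
    by (rule eigenvalue_seq_cong) (use frame_op_mix[OF U v] in \<open>simp add: ell2_eq\<close>)
  then have l_eq: "l j = (if j < n then rsort ?xs ! j else 0)" for j
    unfolding l using eigenvalue_seq_orthogonal[of n ?g "Suc j"] gs orth by (simp add: Suc_le_eq)
  have nonneg: "rsort ?xs ! j \<ge> 0" if "j < n" for j
  proof -
    have "rsort ?xs ! j \<in> set (rsort ?xs)" using that by (intro nth_mem) simp
    then show ?thesis by auto
  qed
  \<comment> \<open>The nonvanishing mixed vectors are orthogonal, hence independent, and lie in a
    space of dimension \<open>d\<close>.\<close>
  have card: "card {j\<in>{..<n}. ?N j \<noteq> 0} \<le> d"
  proof -
    let ?J = "{j\<in>{..<n}. ?N j \<noteq> 0}"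
    have ind: "inj_on ?g ?J" "cfun.independent (?g ` ?J)"
      by (rule orthogonal_independent; use gs orth in auto)+
    have "?g j \<in> cfun.span S" for j
      unfolding mix_def by (intro cfun.span_sum cfun.span_scale S(2)) simp
    then have sub: "?g ` ?J \<subseteq> cfun.span S" by blast
    obtain B where B: "B \<subseteq> cfun.span S" "cfun.independent B" "cfun.span S \<subseteq> cfun.span B" "card B = d"
      unfolding d_def by (rule cfun.basis_exists)
    have "finite B" using cfun.independent_span_bound[OF S(1) B(2,1)] by blast
    then have "card (?g ` ?J) \<le> card B" using cfun.independent_span_bound[OF _ ind(2), of B] sub B(3) by blast
    then show ?thesis using card_image[OF ind(1)] B(4) by simp
  qed
  \<comment> \<open>If the sorted entry at \<open>j\<close> were nonzero, so would be the
    \<open>Suc j\<close> leading entries, more than \<open>d\<close> of them.\<close>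
  have zero: "rsort ?xs ! j = 0" if j: "j < n" "d \<le> j" for j
  proof (rule ccontr)
    assume "rsort ?xs ! j \<noteq> 0"
    then have pos: "rsort ?xs ! j > 0" using nonneg[OF j(1)] by simp
    have "{..j} \<subseteq> {i. i < length (rsort ?xs) \<and> rsort ?xs ! i \<noteq> 0}"
    proof
      fix i assume "i \<in> {..j}"
      then have "rsort ?xs ! j \<le> rsort ?xs ! i" using j by (intro rsort_nth_mono) auto
      then show "i \<in> {i. i < length (rsort ?xs) \<and> rsort ?xs ! i \<noteq> 0}" using pos j \<open>i \<in> {..j}\<close> by auto
    qed
    then have "Suc j \<le> card {i. i < length (rsort ?xs) \<and> rsort ?xs ! i \<noteq> 0}"
      using card_mono[of "{i. i < length (rsort ?xs) \<and> rsort ?xs ! i \<noteq> 0}" "{..j}"] by simp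
    also have "\<dots> = length (filter (\<lambda>x. x \<noteq> 0) (rsort ?xs))" by (simp only: length_filter_conv_card)
    also have "\<dots> = length (filter (\<lambda>x. x \<noteq> 0) ?xs)"
      by (metis mset_filter mset_rev mset_sort size_mset)
    also have "\<dots> = card {i. i < length ?xs \<and> ?xs ! i \<noteq> 0}" by (simp only: length_filter_conv_card)
    also have "{i. i < length ?xs \<and> ?xs ! i \<noteq> 0} = {j\<in>{..<n}. ?N j \<noteq> 0}" by auto
    finally show False using card j(2) by simp
  qed
  show l0: "\<And>j. j \<ge> min (cfun.dim (cfun.span S)) n \<Longrightarrow> l j = 0"
    unfolding l_eq d_def[symmetric] using zero by auto
  have mono: "l j \<le> l i" if "i \<le> j" for i j
    using rsort_nth_mono[OF that, of ?xs] nonneg[of i] that by (auto simp: l_eq)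
  \<comment> \<open>The weights collected from the columns in \<open>K\<close> lie between 0 and 1
    by the row sums, and their total is \<open>card K\<close> by the column sums.\<close>
  have schur: "(\<Sum>i\<in>K. nsq cs (v i)) \<le> (\<Sum>j<card K. l j)" if K: "K \<subseteq> {..<n}" for K
  proof -
    have finK: "finite K" using K finite_subset by blast
    have cK: "card K \<le> n" using card_mono[OF _ K] by simp
    let ?t = "\<lambda>j. \<Sum>i\<in>K. (cmod (U (j, i)))\<^sup>2"
    have "(\<Sum>i\<in>K. nsq cs (v i)) = (\<Sum>i\<in>K. \<Sum>j<n. (cmod (U (j, i)))\<^sup>2 * ?N j)"
      by (rule sum.cong[OF refl], rule nsq_unmix[OF U v orth]) (use K in auto)
    also have "\<dots> = (\<Sum>j<n. ?t j * ?N j)" by (subst sum.swap) (simp add: sum_distrib_right)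
    also have "\<dots> = (\<Sum>j<length ?xs. ?t j * ?xs ! j)" by simp
    also have "\<dots> \<le> (\<Sum>j<card K. rsort ?xs ! j)"
    proof (rule weighted_sum_le_top)
      fix j assume "j < length ?xs"
      then have j: "j < n" by simp
      have "?t j \<le> (\<Sum>i<n. (cmod (U (j, i)))\<^sup>2)" using K by (intro sum_mono2) auto
      then show "0 \<le> ?t j \<and> ?t j \<le> 1" using row_norm_le[OF U j] by (auto intro: sum_nonneg)
    next
      have "(\<Sum>j<length ?xs. ?t j) = (\<Sum>i\<in>K. \<Sum>j<n. (cmod (U (j, i)))\<^sup>2)" by simp (rule sum.swap)
      also have "\<dots> = (\<Sum>i\<in>K. 1)" by (rule sum.cong[OF refl], rule orth_cols_col_norm[OF U]) (use K in auto)
      finally show "(\<Sum>j<length ?xs. ?t j) = real (card K)" by simp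
    qed (use cK in simp)
    also have "\<dots> = (\<Sum>j<card K. l j)" by (rule sum.cong) (use cK in \<open>auto simp: l_eq\<close>)
    finally show ?thesis .
  qed
  have "(\<Sum>i<n. nsq cs (v i)) = (\<Sum>i<n. \<Sum>j<n. (cmod (U (j, i)))\<^sup>2 * ?N j)"
    by (rule sum.cong[OF refl], rule nsq_unmix[OF U v orth]) auto
  also have "\<dots> = (\<Sum>j<n. (\<Sum>i<n. (cmod (U (j, i)))\<^sup>2) * ?N j)" by (subst sum.swap) (simp add: sum_distrib_right)
  also have "\<dots> = (\<Sum>j<n. ?N j)" by (rule sum.cong) (use row_norm[OF U] in auto)
  also have "\<dots> = sum_list ?xs" by (simp add: sum_list_sum_nth atLeast0LessThan)
  also have "\<dots> = sum_list (rsort ?xs)" by (metis mset_rev mset_sort sum_mset_sum_list)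
  also have "\<dots> = (\<Sum>j<n. l j)" by (simp add: sum_list_sum_nth atLeast0LessThan l_eq del: sum_list_rev)
  \<comment> \<open>Eigenvalues vanish from min d n on, so the sums up to n and up to d both agree
    with the sum up to the larger bound.\<close>
  also have "\<dots> = (\<Sum>j<max n d. l j)"
    by (rule sum.mono_neutral_left) (auto simp: l0 d_def)
  also have "\<dots> = (\<Sum>j<d. l j)"
    by (rule sum.mono_neutral_right) (auto simp: l0 d_def)
  finally show "majorized_by (map (\<lambda>i. nsq cs (v i)) [0..<n]) (map l [0..<cfun.dim (cfun.span S)])"
    unfolding d_def[symmetric] by (subst majorized_by_map_iff) (use mono schur in auto)
qed

section \<open>A measurable Schur--Horn construction\<close>

lemma sum_merge:
  fixes f :: "nat \<Rightarrow> 'a::ab_group_add"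
  assumes "p < n"
  shows "(\<Sum>j<n. if j < p then f j else if j = p then y else f (Suc j)) = (\<Sum>j<Suc n. f j) - f p - f (Suc p) + y"
  using assms
proof (induction n)
  case (Suc n)
  show ?case
  proof (cases "p < n")
    case False
    then have [simp]: "p = n" using Suc.prems by simp
    have "(\<Sum>j<n. if j < n then f j else if j = n then y else f (Suc j)) = (\<Sum>j<n. f j)"
      by (rule sum.cong) auto
    then show ?thesis by simp
  qed (use Suc.IH in simp)
qed simp

text \<open>The invariance of the frame operator under a mixing, for one plane: the cross terms
  cancel and \<open>c\<^sup>2 + s\<^sup>2 = 1\<close> collects the rest.\<close>

lemma rotate_frame:
  assumes "x \<in> sqi cs" "y \<in> sqi cs" "\<xi> \<in> sqi cs" and cs1: "c\<^sup>2 + s\<^sup>2 = (1 :: real)"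
  defines "u \<equiv> cscale (complex_of_real c) x + cscale (complex_of_real s) y"
    and "w \<equiv> cscale (complex_of_real c) y - cscale (complex_of_real s) x"
  shows "cscale (ip cs \<xi> w) w + cscale (ip cs \<xi> u) u = cscale (ip cs \<xi> x) x + cscale (ip cs \<xi> y) y"
proof
  fix z
  have u: "ip cs \<xi> u = c * ip cs \<xi> x + s * ip cs \<xi> y"
    unfolding u_def using assms by (simp add: ip_add_right)
  have w: "ip cs \<xi> w = c * ip cs \<xi> y - s * ip cs \<xi> x"
    unfolding w_def using assms by (simp add: ip_diff_right)
  have "complex_of_real (c\<^sup>2 + s\<^sup>2) = 1" unfolding cs1 by simp
  then have c1: "complex_of_real c * complex_of_real c + complex_of_real s * complex_of_real s = 1"
    by (simp add: power2_eq_square)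
  have "ip cs \<xi> w * w z + ip cs \<xi> u * u z
    = (complex_of_real c * complex_of_real c + complex_of_real s * complex_of_real s) * (ip cs \<xi> x * x z + ip cs \<xi> y * y z)"
    unfolding u w by (simp add: u_def w_def algebra_simps)
  then show "(cscale (ip cs \<xi> w) w + cscale (ip cs \<xi> u) u) z = (cscale (ip cs \<xi> x) x + cscale (ip cs \<xi> y) y) z"
    unfolding c1 by simp
qed

lemma measurable_fib_compose_countable:
  fixes g :: "'i::countable \<Rightarrow> real ^ 'k \<Rightarrow> int ^ 'k \<Rightarrow> complex"
  assumes "\<And>i. case_prod (g i) \<in> borel_measurable fib_measure" "p \<in> torus_measure \<rightarrow>\<^sub>M count_space UNIV"
  shows "case_prod (\<lambda>x. g (p x) x) \<in> borel_measurable fib_measure"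
  unfolding measurable_fib_iff
proof
  fix l
  show "(\<lambda>x. g (p x) x l) \<in> borel_measurable torus_measure"
    by (rule measurable_compose_countable[OF _ assms(2)]) (use assms(1) in \<open>simp add: measurable_fib_iff\<close>)
qed

text \<open>One vector is split off at a time: if \<open>a\<close> lies between the consecutive squared norms at
  \<open>p\<close> and \<open>Suc p\<close>, rotating these two vectors produces one of squared norm \<open>a\<close>, and the other one takes
  their place. Orthogonality of the remaining family is preserved, so no normalisation is needed.\<close>

theorem schur_horn_measurable:
  fixes g :: "nat \<Rightarrow> real ^ 'k \<Rightarrow> int ^ 'k \<Rightarrow> complex" and \<alpha> :: "nat \<Rightarrow> real ^ 'k \<Rightarrow> real"
  assumes "\<And>j. case_prod (g j) \<in> borel_measurable fib_measure" "\<And>i. \<alpha> i \<in> borel_measurable torus_measure"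
    and "\<And>j x. x \<in> torus \<Longrightarrow> g j x \<in> sqi cs"
    and "\<And>i j x. x \<in> torus \<Longrightarrow> i < n \<Longrightarrow> j < n \<Longrightarrow> i \<noteq> j \<Longrightarrow> ip cs (g i x) (g j x) = 0"
    and "\<And>i j x. x \<in> torus \<Longrightarrow> i \<le> j \<Longrightarrow> j < n \<Longrightarrow> nsq cs (g j x) \<le> nsq cs (g i x)"
    and "\<And>K x. x \<in> torus \<Longrightarrow> K \<subseteq> {..<n} \<Longrightarrow> (\<Sum>i\<in>K. \<alpha> i x) \<le> (\<Sum>j<card K. nsq cs (g j x))"
    and "\<And>x. x \<in> torus \<Longrightarrow> (\<Sum>i<n. \<alpha> i x) = (\<Sum>j<n. nsq cs (g j x))"
  shows "\<exists>v. (\<forall>i. case_prod (v i) \<in> borel_measurable fib_measure) \<and>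
    (\<forall>x\<in>torus. (\<forall>i<n. v i x \<in> cfun.span ((\<lambda>j. g j x) ` {..<n}) \<and> nsq cs (v i x) = \<alpha> i x) \<and>
      (\<forall>\<xi>\<in>sqi cs. frame_op n (\<lambda>i. v i x) \<xi> = frame_op n (\<lambda>j. g j x) \<xi>))"
  using assms
proof (induction n arbitrary: g)
  case 0
  show ?case by (rule exI[of _ g]) (use 0 in \<open>auto simp: frame_op_def\<close>)
next
  case (Suc n)
  note gm = Suc.prems(1) and am = Suc.prems(2) and gs = Suc.prems(3) and orth = Suc.prems(4)
    and mono = Suc.prems(5) and maj = Suc.prems(6) and total = Suc.prems(7)
  define N where "N j x = nsq cs (g j x)" for j x
  have Nm [measurable]: "N j \<in> borel_measurable torus_measure" for j
    unfolding N_def by (rule measurable_nsq_fibers[OF gm gm])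
  note [measurable] = am
  show ?case
  proof (cases "n = 0")
    case True
    have "N 0 x = \<alpha> 0 x" if "x \<in> torus" for x using total[OF that] True by (simp add: N_def)
    moreover have "g i x \<in> cfun.span ((\<lambda>j. g j x) ` {..<Suc n})" if "i < Suc n" for i x
      using that by (intro cfun.span_base imageI) simp
    ultimately have "(\<forall>i. case_prod (g i) \<in> borel_measurable fib_measure) \<and>
      (\<forall>x\<in>torus. (\<forall>i<Suc n. g i x \<in> cfun.span ((\<lambda>j. g j x) ` {..<Suc n}) \<and> nsq cs (g i x) = \<alpha> i x) \<and>
        (\<forall>\<xi>\<in>sqi cs. frame_op (Suc n) (\<lambda>i. g i x) \<xi> = frame_op (Suc n) (\<lambda>j. g j x) \<xi>))"
      using True gm by (simp add: N_def)
    then show ?thesis by (rule exI[of _ g])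
  next
    case n: False
    \<comment> \<open>The first consecutive pair that brackets the prescribed norm; a least number
      is measurable in \<open>x\<close>. It exists by majorization: comparing the total with the
      bound for the first n prescribed norms leaves the smallest norm at most
      \<open>\<alpha> n x\<close>.\<close>
    define p where "p x = (LEAST p. N (Suc p) x \<le> \<alpha> n x)" for x
    have pm [measurable]: "p \<in> torus_measure \<rightarrow>\<^sub>M count_space UNIV"
      unfolding p_def by measurable
    have p: "p x < n \<and> N (Suc (p x)) x \<le> \<alpha> n x \<and> \<alpha> n x \<le> N (p x) x" if x: "x \<in> torus" for x
    proof -
      have "(\<Sum>i\<in>{..<n}. \<alpha> i x) \<le> (\<Sum>j<card {..<n}. nsq cs (g j x))" by (rule maj[OF x]) auto
      then have last: "N n x \<le> \<alpha> n x" using total[OF x] by (simp add: N_def)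
      then have ex: "N (Suc (n - 1)) x \<le> \<alpha> n x" using n by simp
      then have 1: "N (Suc (p x)) x \<le> \<alpha> n x" unfolding p_def by (rule LeastI)
      have 2: "p x \<le> n - 1" unfolding p_def by (rule Least_le[where P = "\<lambda>p. N (Suc p) x \<le> \<alpha> n x", OF ex])
      \<comment> \<open>Minimality of \<open>p x\<close> gives the upper bound; at 0 there is no
        predecessor, and majorization for a single index replaces it.\<close>
      have 3: "\<alpha> n x \<le> N (p x) x"
      proof (cases "p x")
        case 0
        then show ?thesis using maj[OF x, of "{n}"] by (simp add: N_def)
      next
        case (Suc q)
        then have "\<not> N (Suc q) x \<le> \<alpha> n x" using not_less_Least[of q "\<lambda>p. N (Suc p) x \<le> \<alpha> n x"] by (simp add: p_def)
        then show ?thesis using Suc by simp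
      qed
      show ?thesis using 1 2 3 n by auto
    qed
    \<comment> \<open>The convex weight that combines the two norms to \<open>\<alpha> n x\<close>.
      If they coincide, division by 0 gives the weight 0, which is still correct because
      \<open>\<alpha> n x\<close> has the same value.\<close>
    define q where "q x = (\<alpha> n x - N (Suc (p x)) x) / (N (p x) x - N (Suc (p x)) x)" for x
    have q: "0 \<le> q x \<and> q x \<le> 1 \<and> q x * N (p x) x + (1 - q x) * N (Suc (p x)) x = \<alpha> n x" if x: "x \<in> torus" for x
    proof (cases "N (p x) x = N (Suc (p x)) x")
      case True
      then show ?thesis using p[OF x] by (simp add: q_def)
    next
      case False
      then have pos: "N (p x) x - N (Suc (p x)) x > 0" using p[OF x] by linarith
      have "q x * (N (p x) x - N (Suc (p x)) x) = \<alpha> n x - N (Suc (p x)) x" using pos by (simp add: q_def)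
      then have "q x * N (p x) x + (1 - q x) * N (Suc (p x)) x = \<alpha> n x" by (simp add: algebra_simps)
      then show ?thesis using p[OF x] pos by (simp add: q_def)
    qed
    have Npm: "(\<lambda>x. N (p x) x) \<in> borel_measurable torus_measure" "(\<lambda>x. N (Suc (p x)) x) \<in> borel_measurable torus_measure"
      using measurable_compose_countable[OF Nm pm] measurable_compose_countable[of "\<lambda>i. N (Suc i)", OF Nm pm] by auto
    have qm [measurable]: "q \<in> borel_measurable torus_measure"
      unfolding q_def using Npm by measurable
    define c where "c x = sqrt (q x)" for x
    define s where "s x = sqrt (1 - q x)" for x
    have cs1: "(c x)\<^sup>2 = q x" "(s x)\<^sup>2 = 1 - q x" if "x \<in> torus" for x using q[OF that] by (auto simp: c_def s_def)
    have cm: "(\<lambda>x. complex_of_real (c x)) \<in> borel_measurable torus_measure" "(\<lambda>x. complex_of_real (s x)) \<in> borel_measurable torus_measure"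
      unfolding c_def s_def by measurable
    define gp where "gp x = g (p x) x" for x
    define gq where "gq x = g (Suc (p x)) x" for x
    have gpm: "case_prod gp \<in> borel_measurable fib_measure" "case_prod gq \<in> borel_measurable fib_measure"
      unfolding gp_def gq_def
      using measurable_fib_compose_countable[OF gm pm] measurable_fib_compose_countable[of "\<lambda>i. g (Suc i)", OF gm pm] by auto
    define u where "u x = cscale (complex_of_real (c x)) (gp x) + cscale (complex_of_real (s x)) (gq x)" for x
    define w where "w x = cscale (complex_of_real (c x)) (gq x) - cscale (complex_of_real (s x)) (gp x)" for x
    have um: "case_prod u \<in> borel_measurable fib_measure"
      using measurable_fib_cscale[OF gpm(1) cm(1)] measurable_fib_cscale[OF gpm(2) cm(2)]
      unfolding measurable_fib_iff u_def by (auto intro!: borel_measurable_add)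
    have wm: "case_prod w \<in> borel_measurable fib_measure"
      unfolding w_def by (intro measurable_fib_diff measurable_fib_cscale gpm cm)
    \<comment> \<open>\<open>w\<close> carries what is left of the norms of the pair and takes place
      \<open>p x\<close>; later vectors move down by one. Its squared norm lies between the two it
      replaces, so the order is kept.\<close>
    define g' where "g' j x = (if j < p x then g j x else if j = p x then w x else g (Suc j) x)" for j x
    define N' where "N' j x = nsq cs (g' j x)" for j x
    have gsq: "gp x \<in> sqi cs" "gq x \<in> sqi cs" if "x \<in> torus" for x
      using gs[OF that] by (auto simp: gp_def gq_def)
    have opq: "ip cs (gp x) (gq x) = 0" "ip cs (gq x) (gp x) = 0" if x: "x \<in> torus" for x
      using orth[OF x, of "p x" "Suc (p x)"] orth[OF x, of "Suc (p x)" "p x"] p[OF x] by (auto simp: gp_def gq_def)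
    have nu: "nsq cs (u x) = \<alpha> n x" if x: "x \<in> torus" for x
      unfolding u_def using gsq[OF x] opq[OF x] q[OF x] cs1[OF x]
      by (simp add: nsq_add N_def gp_def gq_def)
    have nw: "nsq cs (w x) = N (p x) x + N (Suc (p x)) x - \<alpha> n x" if x: "x \<in> torus" for x
    proof -
      have "nsq cs (w x) = q x * N (Suc (p x)) x + (1 - q x) * N (p x) x"
        unfolding w_def using gsq[OF x] opq[OF x] cs1[OF x]
        by (simp add: nsq_diff N_def gp_def gq_def)
      then show ?thesis using q[OF x] by (simp add: algebra_simps)
    qed
    have g's: "g' j x \<in> sqi cs" if x: "x \<in> torus" for j x
      using gs[OF x] gsq[OF x] by (simp add: g'_def w_def)
    have N'_eq: "N' j x = (if j < p x then N j x else if j = p x then N (p x) x + N (Suc (p x)) x - \<alpha> n x else N (Suc j) x)"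
      if x: "x \<in> torus" for j x
      using nw[OF x] by (simp add: N'_def g'_def N_def)
    \<comment> \<open>A prefix that contains the merged pair corresponds to an old prefix with one
      more vector, less the norm that was split off.\<close>
    have sumN': "(\<Sum>j<m. N' j x) = (if m \<le> p x then (\<Sum>j<m. N j x) else (\<Sum>j<Suc m. N j x) - \<alpha> n x)"
      if x: "x \<in> torus" for m x
    proof (cases "m \<le> p x")
      case True
      then show ?thesis by (auto simp: N'_eq[OF x] intro!: sum.cong)
    next
      case False
      then show ?thesis unfolding N'_eq[OF x] using sum_merge[of "p x" m "\<lambda>j. N j x"] by simp
    qed
    have "\<exists>v. (\<forall>i. case_prod (v i) \<in> borel_measurable fib_measure) \<and>
      (\<forall>x\<in>torus. (\<forall>i<n. v i x \<in> cfun.span ((\<lambda>j. g' j x) ` {..<n}) \<and> nsq cs (v i x) = \<alpha> i x) \<and>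
        (\<forall>\<xi>\<in>sqi cs. frame_op n (\<lambda>i. v i x) \<xi> = frame_op n (\<lambda>j. g' j x) \<xi>))"
    proof (rule Suc.IH)
      fix j
      show "case_prod (g' j) \<in> borel_measurable fib_measure"
        unfolding measurable_fib_iff
      proof
        fix l
        have [measurable]: "(\<lambda>x. g j x l) \<in> borel_measurable torus_measure" "(\<lambda>x. g (Suc j) x l) \<in> borel_measurable torus_measure"
          "(\<lambda>x. w x l) \<in> borel_measurable torus_measure"
          using gm wm by (auto simp: measurable_fib_iff)
        have "(\<lambda>x. if j < p x then g j x l else if j = p x then w x l else g (Suc j) x l) \<in> borel_measurable torus_measure"
          by measurable
        then show "(\<lambda>x. g' j x l) \<in> borel_measurable torus_measure"
          unfolding g'_def by (rule back_subst[of "\<lambda>f. f \<in> borel_measurable torus_measure"]) auto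
      qed
    next
      fix i show "\<alpha> i \<in> borel_measurable torus_measure" by (rule am)
    next
      fix j and x :: "real ^ 'k" assume "x \<in> torus" then show "g' j x \<in> sqi cs" by (rule g's)
    next
      fix i j and x :: "real ^ 'k" assume x: "x \<in> torus" and ij: "i < n" "j < n" "i \<noteq> j"
      have wr: "ip cs (w x) (g r x) = 0" if "r < Suc n" "r \<noteq> p x" "r \<noteq> Suc (p x)" for r
        unfolding w_def using gsq[OF x] gs[OF x] orth[OF x, of "p x" r] orth[OF x, of "Suc (p x)" r] p[OF x] that
        by (simp add: ip_diff_left gp_def gq_def)
      then have wl: "ip cs (g r x) (w x) = 0" if "r < Suc n" "r \<noteq> p x" "r \<noteq> Suc (p x)" for r
        using that ip_commute[of cs "g r x" "w x"] by simp
      show "ip cs (g' i x) (g' j x) = 0"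
        unfolding g'_def using ij wr wl orth[OF x] by auto
    next
      fix i j and x :: "real ^ 'k" assume x: "x \<in> torus" and ij: "i \<le> j" "j < n"
      have m: "N b x \<le> N a x" if "a \<le> b" "b < Suc n" for a b using mono[OF x that] by (simp add: N_def)
      have b: "N (Suc (p x)) x \<le> N (p x) x + N (Suc (p x)) x - \<alpha> n x" "N (p x) x + N (Suc (p x)) x - \<alpha> n x \<le> N (p x) x"
        using p[OF x] by auto
      have "N' j x \<le> N' i x"
      proof -
        consider "j < p x" | "j = p x" "i < p x" | "j = p x" "i = p x" | "j > p x" "i < p x" | "j > p x" "i = p x" | "j > p x" "i > p x"
          using ij by linarith
        then show ?thesis
        proof cases
          case 2 then show ?thesis unfolding N'_eq[OF x] using b m[of i "p x"] ij by auto
        next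
          case 4 then show ?thesis unfolding N'_eq[OF x] using m[of i "Suc j"] ij by auto
        next
          case 5 then show ?thesis unfolding N'_eq[OF x] using b m[of "Suc (p x)" "Suc j"] ij by auto
        qed (use m ij in \<open>auto simp: N'_eq[OF x]\<close>)
      qed
      then show "nsq cs (g' j x) \<le> nsq cs (g' i x)" by (simp add: N'_def)
    next
      fix K and x :: "real ^ 'k" assume x: "x \<in> torus" and K: "K \<subseteq> {..<n}"
      then have fin: "finite K" "n \<notin> K" using finite_subset by auto
      have "(\<Sum>i\<in>K. \<alpha> i x) \<le> (\<Sum>j<card K. N' j x)"
      proof (cases "card K \<le> p x")
        case True
        have "K \<subseteq> {..<Suc n}" using K by fastforce
        then show ?thesis unfolding sumN'[OF x] using True maj[OF x, of K] by (simp add: N_def)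
      next
        case False
        \<comment> \<open>Past \<open>p x\<close> the inequality for \<open>K\<close> is the old one
          for \<open>K\<close> enlarged by the index that was split off: both sides contain the same
          \<open>\<alpha> n x\<close>.\<close>
        have "(\<Sum>i\<in>insert n K. \<alpha> i x) \<le> (\<Sum>j<card (insert n K). nsq cs (g j x))"
          by (rule maj[OF x]) (use K in auto)
        then show ?thesis unfolding sumN'[OF x] using False fin by (simp add: N_def)
      qed
      then show "(\<Sum>i\<in>K. \<alpha> i x) \<le> (\<Sum>j<card K. nsq cs (g' j x))" by (simp add: N'_def)
    next
      fix x :: "real ^ 'k" assume x: "x \<in> torus"
      have "(\<Sum>i<n. \<alpha> i x) = (\<Sum>j<n. N' j x)"
        unfolding sumN'[OF x] using total[OF x] p[OF x] by (simp add: N_def)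
      then show "(\<Sum>i<n. \<alpha> i x) = (\<Sum>j<n. nsq cs (g' j x))" by (simp add: N'_def)
    qed
    then obtain v where vm: "\<And>i. case_prod (v i) \<in> borel_measurable fib_measure"
      and v: "\<And>i x. x \<in> torus \<Longrightarrow> i < n \<Longrightarrow> v i x \<in> cfun.span ((\<lambda>j. g' j x) ` {..<n}) \<and> nsq cs (v i x) = \<alpha> i x"
      and vf: "\<And>x \<xi>. x \<in> torus \<Longrightarrow> \<xi> \<in> sqi cs \<Longrightarrow> frame_op n (\<lambda>i. v i x) \<xi> = frame_op n (\<lambda>j. g' j x) \<xi>"
      by blast
    define v' where "v' i = (if i < n then v i else u)" for i
    show ?thesis
    proof (intro exI[of _ v'] conjI allI ballI impI)
      fix i show "case_prod (v' i) \<in> borel_measurable fib_measure" using vm um by (simp add: v'_def)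
    next
      fix x :: "real ^ 'k" and i assume x: "x \<in> torus" and i: "i < Suc n"
      let ?S = "cfun.span ((\<lambda>j. g j x) ` {..<Suc n})"
      have base: "g j x \<in> ?S" if "j < Suc n" for j using that by (intro cfun.span_base) auto
      have pq: "gp x \<in> ?S" "gq x \<in> ?S" using base p[OF x] by (auto simp: gp_def gq_def)
      have uw: "u x \<in> ?S" "w x \<in> ?S" unfolding u_def w_def by (intro cfun.span_add cfun.span_diff cfun.span_scale pq)+
      have "(\<lambda>j. g' j x) ` {..<n} \<subseteq> ?S" using uw(2) base by (auto simp: g'_def)
      then have "cfun.span ((\<lambda>j. g' j x) ` {..<n}) \<subseteq> ?S" by (intro cfun.span_minimal) auto
      then show "v' i x \<in> ?S" using v[OF x, of i] uw(1) by (auto simp: v'_def)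
      show "nsq cs (v' i x) = \<alpha> i x" using v[OF x, of i] nu[OF x] i by (auto simp: v'_def less_Suc_eq)
    next
      fix x :: "real ^ 'k" and \<xi> :: "int ^ 'k \<Rightarrow> complex" assume x: "x \<in> torus" and \<xi>: "\<xi> \<in> sqi cs"
      let ?F = "\<lambda>z. cscale (ip cs \<xi> z) z"
      have "frame_op (Suc n) (\<lambda>i. v' i x) \<xi> = frame_op n (\<lambda>i. v i x) \<xi> + ?F (u x)"
        by (simp add: frame_op_def v'_def)
      also have "frame_op n (\<lambda>i. v i x) \<xi> = (\<Sum>j<n. ?F (g' j x))"
        by (rule trans[OF vf[OF x \<xi>] frame_op_def])
      also have "\<dots> = (\<Sum>j<n. if j < p x then ?F (g j x) else if j = p x then ?F (w x) else ?F (g (Suc j) x))"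
        by (rule sum.cong) (auto simp: g'_def)
      also have "\<dots> = (\<Sum>j<Suc n. ?F (g j x)) - ?F (g (p x) x) - ?F (g (Suc (p x)) x) + ?F (w x)"
        by (rule sum_merge) (use p[OF x] in simp)
      finally have A: "frame_op (Suc n) (\<lambda>i. v' i x) \<xi>
        = (\<Sum>j<Suc n. ?F (g j x)) - ?F (gp x) - ?F (gq x) + (?F (w x) + ?F (u x))"
        by (simp only: gp_def gq_def add.assoc)
      have B: "?F (w x) + ?F (u x) = ?F (gp x) + ?F (gq x)"
        unfolding u_def w_def by (rule rotate_frame) (use gsq[OF x] \<xi> cs1[OF x] in auto)
      show "frame_op (Suc n) (\<lambda>i. v' i x) \<xi> = frame_op (Suc n) (\<lambda>j. g j x) \<xi>"
        unfolding A B frame_op_def[of "Suc n" "\<lambda>j. g j x"] by simp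
    qed
  qed
qed

section \<open>Necessity and sufficiency\<close>

lemma frame_operator_fiber_eq: "frame_operator_fiber n F x = frame_op n (\<lambda>i. \<Gamma> (F (Suc i)) x)"
proof
  fix \<xi>
  have "{1..n} = Suc ` {..<n}" by (auto simp: image_Suc_lessThan)
  then have "frame_operator_fiber n F x \<xi>
    = (\<Sum>i\<in>Suc ` {..<n}. cscale (ip cs \<xi> (\<Gamma> (F i) x)) (\<Gamma> (F i) x))"
    by (simp only: frame_operator_fiber_def ell2_inner_eq)
  also have "\<dots> = (\<Sum>i<n. cscale (ip cs \<xi> (\<Gamma> (F (Suc i)) x)) (\<Gamma> (F (Suc i)) x))"
    by (subst sum.reindex) (simp_all add: o_def)
  finally show "frame_operator_fiber n F x \<xi> = frame_op n (\<lambda>i. \<Gamma> (F (Suc i)) x) \<xi>"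
    by (simp only: frame_op_def)
qed

lemma map_Suc_shift: "map f [1..<n + 1] = map (\<lambda>i. f (Suc i)) [0..<n]"
proof -
  have "[1..<n + 1] = map Suc [0..<n]" by (simp add: map_Suc_upt)
  then show ?thesis by (simp only: map_map o_def)
qed

text \<open>Countably many almost everywhere conditions hold simultaneously off one null set; at the
  remaining points the claim concerns finitely many vectors in a finite-dimensional span.\<close>

lemma realization_admissible:
  fixes H :: "(real ^ 'k \<Rightarrow> complex) set"
  assumes H: "finite H" "H \<subseteq> L2"
    and d: "AE x in torus_measure. d x = cfun.dim (cfun.span ((\<lambda>h. \<Gamma> h x) ` H))"
    and real: "has_bessel_realization (SI_span H) n \<alpha> lam"
  shows "admissible d n \<alpha> lam"
proof -
  obtain F where FW: "\<And>j. j \<in> {1..n} \<Longrightarrow> F j \<in> SI_span H"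
    and Fa: "\<And>j. j \<in> {1..n} \<Longrightarrow> AE x in torus_measure. (ell2_norm (\<Gamma> (F j) x))\<^sup>2 = \<alpha> j x"
    and Fl: "\<And>j. j \<ge> 1 \<Longrightarrow> AE x in torus_measure. eigenvalue_seq (frame_operator_fiber n F x) j = lam j x"
    using real unfolding has_bessel_realization_def by blast
  have Fs: "F j \<in> sqi lebesgue" if "j \<in> {1..n}" for j
    using FW[OF that] by (auto simp: SI_span_def L2_closure_def L2_eq)
  have 1: "AE x in torus_measure. \<forall>j\<in>{1..n}. (ell2_norm (\<Gamma> (F j) x))\<^sup>2 = \<alpha> j x"
    using Fa by (intro AE_finite_allI) auto
  have 2: "AE x in torus_measure. \<forall>j\<in>{1..n}. \<Gamma> (F j) x \<in> cfun.span ((\<lambda>h. \<Gamma> h x) ` H)"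
    using SI_span_fibers[OF H FW] by (intro AE_finite_allI) auto
  have 3: "AE x in torus_measure. \<forall>j\<in>{1..n}. \<Gamma> (F j) x \<in> sqi cs"
    using AE_fiber_sqi[OF \<Gamma>_sqi[OF Fs]] by (intro AE_finite_allI) auto
  have 4: "AE x in torus_measure. \<forall>j. lam (Suc j) x = eigenvalue_seq (frame_operator_fiber n F x) (Suc j)"
    unfolding AE_all_countable
  proof
    fix j
    show "AE x in torus_measure. lam (Suc j) x = eigenvalue_seq (frame_operator_fiber n F x) (Suc j)"
      using Fl[of "Suc j"] by simp (erule eventually_mono, simp)
  qed
  have key: "AE x in torus_measure. (\<forall>j \<ge> min (d x) n. lam (Suc j) x = 0) \<and>
    majorized_by (map (\<lambda>i. \<alpha> (Suc i) x) [0..<n]) (map (\<lambda>j. lam (Suc j) x) [0..<d x])"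
    using 1 2 3 4 d
  proof eventually_elim
    case (elim x)
    let ?v = "\<lambda>i. \<Gamma> (F (Suc i)) x"
    have v: "?v i \<in> sqi cs" "?v i \<in> cfun.span ((\<lambda>h. \<Gamma> h x) ` H)" "nsq cs (?v i) = \<alpha> (Suc i) x" if "i < n" for i
      using elim(1-3) that by (auto simp: ell2_norm_sq Suc_le_eq)
    have l: "lam (Suc j) x = eigenvalue_seq (frame_op n ?v) (Suc j)" for j
      using elim(4) by (simp only: frame_operator_fiber_eq)
    note adm = frame_op_admissible[of n ?v "(\<lambda>h. \<Gamma> h x) ` H" "\<lambda>j. lam (Suc j) x", OF v(1) finite_imageI[OF H(1)] v(2) l]
    have "map (\<lambda>i. nsq cs (?v i)) [0..<n] = map (\<lambda>i. \<alpha> (Suc i) x) [0..<n]"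
      by (rule map_cong) (use v(3) in auto)
    with adm(2) have "majorized_by (map (\<lambda>i. \<alpha> (Suc i) x) [0..<n]) (map (\<lambda>j. lam (Suc j) x) [0..<d x])"
      unfolding elim(5) by simp
    then show ?case using adm(1) unfolding elim(5) by blast
  qed
  show ?thesis
    unfolding admissible_def map_Suc_shift
  proof (intro conjI allI impI)
    fix j :: nat assume j: "j \<ge> 1"
    show "AE x in torus_measure. j \<ge> min (d x) n + 1 \<longrightarrow> lam j x = 0"
      using key
    proof eventually_elim
      case (elim x)
      then have "min (d x) n \<le> j - 1 \<Longrightarrow> lam (Suc (j - 1)) x = 0" by blast
      then show ?case using j by auto
    qed
  next
    show "AE x in torus_measure. majorized_by (map (\<lambda>i. \<alpha> (Suc i) x) [0..<n]) (map (\<lambda>j. lam (Suc j) x) [0..<d x])"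
      using key by eventually_elim blast
  qed
qed

text \<open>The inner products of \<open>f\<close> with the translates of \<open>F i\<close> are the
  Fourier coefficients, at \<open>- l\<close>, of the fiberwise inner product \<open>u\<close>.
  Parseval's identity sums them over the lattice, and Cauchy--Schwarz on the fibers bounds the norm
  of \<open>u\<close>.\<close>

lemma bessel_translates_bounded:
  fixes F :: "nat \<Rightarrow> real ^ 'k \<Rightarrow> complex"
  assumes F: "\<And>i. i \<in> {1..n} \<Longrightarrow> F i \<in> sqi lebesgue"
    and b: "b \<ge> 0" "\<And>i. i \<in> {1..n} \<Longrightarrow> AE x in torus_measure. nsq cs (\<Gamma> (F i) x) \<le> b"
  shows "bessel_translates n F"
proof -
  \<comment> \<open>Each generator contributes \<open>b\<close>; the summand 1 keeps the constant
    positive when \<open>b\<close> or \<open>n\<close> is 0.\<close>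
  have main: "(\<lambda>(l :: int ^ 'k, i). (cmod (L2_inner f (translate (of_int_vec l) (F i))))\<^sup>2) summable_on (UNIV \<times> {1..n}) \<and>
     (\<Sum>\<^sub>\<infinity>(l :: int ^ 'k, i)\<in>UNIV \<times> {1..n}. (cmod (L2_inner f (translate (of_int_vec l) (F i))))\<^sup>2) \<le> (real n * b + 1) * nsq lebesgue f"
    if f: "f \<in> sqi lebesgue" for f
  proof -
    let ?c = "\<lambda>l i. (cmod (L2_inner f (translate (of_int_vec l) (F i))))\<^sup>2"
    have sumL: "(\<Sum>l\<in>L. ?c l i) \<le> b * nsq lebesgue f" if L: "finite L" and i: "i \<in> {1..n}" for L and i
    proof -
      define u where "u x = ip cs (\<Gamma> f x) (\<Gamma> (F i) x)" for x
      have um: "u \<in> borel_measurable torus_measure"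
        unfolding u_def by (intro measurable_ip_fibers sqi_measurable \<Gamma>_sqi f F i)
      have uAE: "AE x in torus_measure. (cmod (u x))\<^sup>2 \<le> b * nsq cs (\<Gamma> f x)"
        using AE_fiber_sqi[OF \<Gamma>_sqi[OF f]] AE_fiber_sqi[OF \<Gamma>_sqi[OF F[OF i]]] b(2)[OF i]
      proof eventually_elim
        case (elim x)
        have "(cmod (u x))\<^sup>2 \<le> nsq cs (\<Gamma> f x) * nsq cs (\<Gamma> (F i) x)"
          unfolding u_def by (rule cauchy_schwarz[OF elim(1,2)])
        also have "\<dots> \<le> nsq cs (\<Gamma> f x) * b" by (intro mult_left_mono elim(3)) simp
        finally show ?case by (simp add: mult.commute)
      qed
      have bi: "integrable torus_measure (\<lambda>x. b * nsq cs (\<Gamma> f x))"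
        by (intro integrable_mult_right nsq_fibers_integrable \<Gamma>_sqi f)
      have ui: "integrable torus_measure (\<lambda>x. (cmod (u x))\<^sup>2)"
        by (rule Bochner_Integration.integrable_bound[OF bi])
          (use um uAE in \<open>auto intro: order_trans[OF _ abs_ge_self]\<close>)
      have us: "u \<in> sqi torus_measure" using um ui by (simp add: sqi_def)
      have "nsq torus_measure u \<le> (LINT x|torus_measure. b * nsq cs (\<Gamma> f x))"
        unfolding nsq_def[of torus_measure] by (rule integral_mono_AE[OF ui bi uAE])
      also have "\<dots> = b * nsq lebesgue f"
        using nsq_fibers[OF \<Gamma>_sqi[OF f]] by (simp add: \<Gamma>_isometry[OF f])
      finally have ub: "nsq torus_measure u \<le> b * nsq lebesgue f" .
      have coef: "L2_inner f (translate (of_int_vec l) (F i)) = ip torus_measure u (chr (- l))" for l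
      proof -
        have T: "translate (of_int_vec l) (F i) \<in> sqi lebesgue" by (intro translate_sqi F i)
        have "L2_inner f (translate (of_int_vec l) (F i))
          = ip fib_measure (case_prod (\<Gamma> f)) (case_prod (\<Gamma> (translate (of_int_vec l) (F i))))"
          by (simp only: L2_inner_eq ip_\<Gamma>[OF f T])
        also have "\<dots> = (LINT x|torus_measure. ip cs (\<Gamma> f x) (\<Gamma> (translate (of_int_vec l) (F i)) x))"
          by (rule ip_fibers[OF \<Gamma>_sqi[OF f] \<Gamma>_sqi[OF T]])
        also have "\<dots> = (LINT x|torus_measure. u x * cnj (chr (- l) x))"
        proof (rule integral_cong_AE)
          show "AE x in torus_measure. ip cs (\<Gamma> f x) (\<Gamma> (translate (of_int_vec l) (F i)) x) = u x * cnj (chr (- l) x)"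
            using \<Gamma>_translate[OF F[OF i], of l] by eventually_elim (simp add: u_def chr_minus mult.commute)
          show "(\<lambda>x. ip cs (\<Gamma> f x) (\<Gamma> (translate (of_int_vec l) (F i)) x)) \<in> borel_measurable torus_measure"
            by (intro measurable_ip_fibers sqi_measurable \<Gamma>_sqi f T)
          show "(\<lambda>x. u x * cnj (chr (- l) x)) \<in> borel_measurable torus_measure"
            by (intro borel_measurable_times um borel_measurable_cnj measurable_chr)
        qed
        finally show ?thesis by (simp only: ip_def)
      qed
      have hs: "((\<lambda>l. (cmod (ip torus_measure u (chr l)))\<^sup>2) has_sum nsq torus_measure u) UNIV" by (rule parseval[OF us])
      have "(\<Sum>l\<in>L. ?c l i) = (\<Sum>l\<in>uminus ` L. (cmod (ip torus_measure u (chr l)))\<^sup>2)"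
        by (subst sum.reindex) (simp_all add: coef)
      also have "\<dots> \<le> (\<Sum>\<^sub>\<infinity>l. (cmod (ip torus_measure u (chr l)))\<^sup>2)"
        using hs L by (intro finite_sum_le_infsum) (auto simp: summable_on_def)
      also have "\<dots> = nsq torus_measure u" by (rule infsumI[OF hs])
      finally show ?thesis using ub by linarith
    qed
    \<comment> \<open>A finite set of pairs is enlarged to a rectangle, where the sum splits over
      the generators.\<close>
    have fin: "(\<Sum>(l, i)\<in>P. ?c l i) \<le> (real n * b + 1) * nsq lebesgue f" if P: "finite P" "P \<subseteq> UNIV \<times> {1..n}" for P
    proof -
      have "(\<Sum>(l, i)\<in>P. ?c l i) \<le> (\<Sum>(l, i)\<in>fst ` P \<times> {1..n}. ?c l i)"
        by (rule sum_mono2) (use P in \<open>auto simp: image_iff split_beta, force\<close>)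
      also have "\<dots> = (\<Sum>i\<in>{1..n}. \<Sum>l\<in>fst ` P. ?c l i)"
        by (subst sum.cartesian_product[symmetric]) (rule sum.swap)
      also have "\<dots> \<le> (\<Sum>i\<in>{1..n}. b * nsq lebesgue f)"
        by (intro sum_mono sumL) (use P in auto)
      also have "\<dots> \<le> (real n * b + 1) * nsq lebesgue f" by (simp add: algebra_simps)
      finally show ?thesis .
    qed
    have sm: "(\<lambda>(l, i). ?c l i) summable_on (UNIV \<times> {1..n})"
    proof (rule nonneg_bdd_above_summable_on)
      show "bdd_above (sum (\<lambda>(l, i). ?c l i) ` {P. P \<subseteq> UNIV \<times> {1..n} \<and> finite P})"
        by (rule bdd_aboveI2[where M = "(real n * b + 1) * nsq lebesgue f"]) (rule fin, simp_all)
    qed (simp add: split_beta)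
    then show ?thesis by (rule conjI[OF _ infsum_le_finite_sums[OF sm fin]])
  qed
  have "real n * b + 1 > 0" using b(1) by (simp add: add_nonneg_pos)
  then show ?thesis
    unfolding bessel_translates_def L2_eq L2_norm_eq using main by (intro exI[of _ "real n * b + 1"]) simp
qed

text \<open>Lists of naturals form a countable type, so a list that depends measurably on the point
  amounts to a countable measurable case distinction.\<close>

lemma measurable_filter:
  assumes "\<And>i. i \<in> set xs \<Longrightarrow> Measurable.pred M (\<lambda>x. P x i)"
  shows "(\<lambda>x. filter (P x) xs) \<in> M \<rightarrow>\<^sub>M count_space (UNIV :: nat list set)"
  using assms
proof (induction xs)
  case (Cons a xs)
  have [measurable]: "(\<lambda>x. filter (P x) xs) \<in> M \<rightarrow>\<^sub>M count_space UNIV" "Measurable.pred M (\<lambda>x. P x a)"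
    using Cons by auto
  have "(\<lambda>x. if P x a then a # filter (P x) xs else filter (P x) xs) \<in> M \<rightarrow>\<^sub>M count_space UNIV"
    by measurable
  then show ?case by simp
qed simp

text \<open>The basis consists of the nonzero vectors of the Gram--Schmidt process, listed without gaps.\<close>

lemma measurable_orthonormal_basis:
  fixes \<phi> :: "nat \<Rightarrow> real ^ 'k \<Rightarrow> int ^ 'k \<Rightarrow> complex"
  assumes \<phi>: "\<And>i. case_prod (\<phi> i) \<in> borel_measurable fib_measure"
  obtains e where "\<And>j. case_prod (e j) \<in> borel_measurable fib_measure"
    "\<And>x j. (\<And>i. \<phi> i x \<in> sqi cs) \<Longrightarrow> e j x \<in> sqi cs \<and> e j x \<in> cfun.span ((\<lambda>i. \<phi> i x) ` {..<m}) \<and>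
       nsq cs (e j x) = (if j < cfun.dim (cfun.span ((\<lambda>i. \<phi> i x) ` {..<m})) then 1 else 0)"
    "\<And>x i j. (\<And>i. \<phi> i x \<in> sqi cs) \<Longrightarrow> i \<noteq> j \<Longrightarrow> ip cs (e i x) (e j x) = 0"
proof -
  define G where "G i x = gram_schmidt (\<lambda>i. \<phi> i x) i" for i x
  define L where "L x = filter (\<lambda>i. nsq cs (G i x) \<noteq> 0) [0..<m]" for x
  define e where "e j x = (if j < length (L x) then G (L x ! j) x else 0)" for j x
  have Gm: "case_prod (G i) \<in> borel_measurable fib_measure" for i
    unfolding G_def by (rule measurable_gram_schmidt[OF \<phi>])
  have nm [measurable]: "(\<lambda>x. nsq cs (G i x)) \<in> borel_measurable torus_measure" for i
    by (rule measurable_nsq_fibers[OF Gm Gm])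
  have Lm: "L \<in> torus_measure \<rightarrow>\<^sub>M count_space UNIV"
    unfolding L_def by (rule measurable_filter) measurable
  have em: "case_prod (e j) \<in> borel_measurable fib_measure" for j
  proof -
    \<comment> \<open>With the list of indices held fixed the vector is measurable; composing with
      the countably valued \<open>L\<close> then gives \<open>e j\<close>.\<close>
    define E where "E xs x = (if j < length xs then G (xs ! j) x else 0)" for xs x
    have "case_prod (E xs) \<in> borel_measurable fib_measure" for xs
    proof (cases "j < length xs")
      case True
      then have "E xs = G (xs ! j)" by (simp add: E_def fun_eq_iff)
      then show ?thesis using Gm[of "xs ! j"] by (simp only:)
    next
      case False
      then show ?thesis by (simp add: E_def measurable_fib_iff)
    qed
    from measurable_fib_compose_countable[of E, OF this Lm]
    show ?thesis by (simp add: E_def e_def[abs_def])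
  qed
  have main: "(\<forall>j. e j x \<in> sqi cs \<and> e j x \<in> cfun.span ((\<lambda>i. \<phi> i x) ` {..<m}) \<and>
       nsq cs (e j x) = (if j < cfun.dim (cfun.span ((\<lambda>i. \<phi> i x) ` {..<m})) then 1 else 0)) \<and>
    (\<forall>i j. i \<noteq> j \<longrightarrow> ip cs (e i x) (e j x) = 0)" if \<phi>s: "\<And>i. \<phi> i x \<in> sqi cs" for x
  proof -
    let ?S = "cfun.span ((\<lambda>i. \<phi> i x) ` {..<m})"
    let ?I = "{i\<in>{..<m}. nsq cs (G i x) \<noteq> 0}"
    have Gs: "G i x \<in> sqi cs" for i unfolding G_def by (rule gram_schmidt_sqi[OF \<phi>s])
    have Go: "ip cs (G i x) (G j x) = 0" if "i \<noteq> j" for i j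
      unfolding G_def by (rule gram_schmidt_orth[OF \<phi>s that])
    have G1: "nsq cs (G i x) = 1" if "nsq cs (G i x) \<noteq> 0" for i
      using nsq_gram_schmidt[of "\<lambda>i. \<phi> i x" i] that by (auto simp: G_def)
    have span: "cfun.span ((\<lambda>i. G i x) ` {..<m}) = ?S"
      using span_gram_schmidt[of "\<lambda>i. \<phi> i x" m, OF \<phi>s] by (simp only: G_def)
    have setL: "set (L x) = ?I" "distinct (L x)" by (auto simp: L_def)
    have ind: "inj_on (\<lambda>i. G i x) ?I" "cfun.independent ((\<lambda>i. G i x) ` ?I)"
      by (rule orthogonal_independent; use Gs Go in auto)+
    have "cfun.span ((\<lambda>i. G i x) ` ?I) = ?S"
    proof
      show "cfun.span ((\<lambda>i. G i x) ` ?I) \<subseteq> ?S" unfolding span[symmetric] by (rule cfun.span_mono) auto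
      have "G i x \<in> cfun.span ((\<lambda>i. G i x) ` ?I)" if "i < m" for i
      proof (cases "nsq cs (G i x) = 0")
        case True
        then have "G i x = 0" using nsq_cs_eq_0_iff[OF Gs] by blast
        then show ?thesis by (simp only: cfun.span_zero)
      next
        case False
        then show ?thesis using that by (intro cfun.span_base imageI) simp
      qed
      then show "?S \<subseteq> cfun.span ((\<lambda>i. G i x) ` ?I)"
        unfolding span[symmetric] by (intro cfun.span_minimal) auto
    qed
    then have dim: "cfun.dim ?S = length (L x)"
      using cfun.dim_span_eq_card_independent[OF ind(2)] card_image[OF ind(1)] distinct_card[OF setL(2)] setL(1)
      by metis
    have LI: "L x ! j \<in> ?I" if "j < length (L x)" for j using nth_mem[OF that] setL(1) by simp
    have A: "e j x \<in> sqi cs \<and> e j x \<in> ?S \<and> nsq cs (e j x) = (if j < cfun.dim ?S then 1 else 0)" for j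
    proof (cases "j < length (L x)")
      case True
      then have "e j x = G (L x ! j) x" "L x ! j < m" "nsq cs (G (L x ! j) x) \<noteq> 0" using LI by (auto simp: e_def)
      moreover have "G (L x ! j) x \<in> ?S" unfolding span[symmetric]
        by (intro cfun.span_base imageI) (use LI[OF True] in simp)
      ultimately show ?thesis using Gs G1 True by (simp only: dim if_True simp_thms)
    next
      case False
      then have "e j x = 0" by (simp add: e_def)
      then show ?thesis using False by (simp only: dim if_False simp_thms sqi_zero nsq_zero cfun.span_zero)
    qed
    have B: "ip cs (e i x) (e j x) = 0" if "i \<noteq> j" for i j
      using that Go setL(2) by (auto simp: e_def nth_eq_iff_index_eq)
    show ?thesis by (intro conjI[OF allI[OF A]] allI impI B)
  qed
  show ?thesis
    by (rule that[where e = e, OF em]) (use main in blast)+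
qed

lemma rsort_map_id:
  assumes "\<And>i j. i \<le> j \<Longrightarrow> j < n \<Longrightarrow> l j \<le> (l i :: real)"
  shows "rsort (map l [0..<n]) = map l [0..<n]"
  by (rule rsort_id) (use assms in auto)

text \<open>Basis vectors scaled by the square roots of the eigenvalues have the required frame
  operator, and the Schur--Horn construction exchanges their norms for the prescribed ones. The
  bound on \<alpha> gives square integrable fibers and a Bessel family; the ordering of
  \<open>lam\<close> makes it the eigenvalue sequence itself rather than a rearrangement of
  it.\<close>

lemma admissible_realization:
  fixes H :: "(real ^ 'k \<Rightarrow> complex) set"
  assumes H: "finite H" "H \<subseteq> L2"
    and d: "AE x in torus_measure. d x = cfun.dim (cfun.span ((\<lambda>h. \<Gamma> h x) ` H))"
    and \<alpha>m: "\<And>j. j \<in> {1..n} \<Longrightarrow> \<alpha> j \<in> borel_measurable torus_measure"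
    and lm: "\<And>j. j \<ge> 1 \<Longrightarrow> lam j \<in> borel_measurable torus_measure"
    and \<alpha>0: "\<And>j x. j \<in> {1..n} \<Longrightarrow> x \<in> torus \<Longrightarrow> \<alpha> j x \<ge> 0"
    and l0: "\<And>j x. j \<ge> 1 \<Longrightarrow> x \<in> torus \<Longrightarrow> lam j x \<ge> 0"
    and sorted: "\<And>j. j \<ge> 1 \<Longrightarrow> AE x in torus_measure. lam (j + 1) x \<le> lam j x"
    and bound: "\<And>j. j \<in> {1..n} \<Longrightarrow> AE x in torus_measure. \<alpha> j x \<le> b"
    and adm: "admissible d n \<alpha> lam"
  shows "has_bessel_realization (SI_span H) n \<alpha> lam"
proof -
  obtain h0 where h0: "bij_betw h0 {..<card H} H"
    using ex_bij_betw_nat_finite[OF H(1)] by (auto simp: atLeast0LessThan)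
  define m where "m = card H"
  define h where "h i = (if i < m then h0 i else 0)" for i
  have H_eq: "H = h ` {..<m}" using h0 by (auto simp: bij_betw_def h_def m_def)
  have hs: "h i \<in> sqi lebesgue" for i
    using h0 H(2) by (auto simp: h_def m_def bij_betw_def L2_eq)
  have im: "(\<lambda>h. \<Gamma> h x) ` H = (\<lambda>i. \<Gamma> (h i) x) ` {..<m}" for x
    by (subst H_eq) (simp add: image_image)
  obtain e where em: "\<And>j. case_prod (e j) \<in> borel_measurable fib_measure"
    and e1: "\<And>x j. (\<And>i. \<Gamma> (h i) x \<in> sqi cs) \<Longrightarrow> e j x \<in> sqi cs \<and> e j x \<in> cfun.span ((\<lambda>i. \<Gamma> (h i) x) ` {..<m}) \<and>
       nsq cs (e j x) = (if j < cfun.dim (cfun.span ((\<lambda>i. \<Gamma> (h i) x) ` {..<m})) then 1 else 0)"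
    and e2: "\<And>x i j. (\<And>i. \<Gamma> (h i) x \<in> sqi cs) \<Longrightarrow> i \<noteq> j \<Longrightarrow> ip cs (e i x) (e j x) = 0"
    using measurable_orthonormal_basis[of "\<lambda>i. \<Gamma> (h i)" m, OF sqi_measurable[OF \<Gamma>_sqi[OF hs]]] by blast
  define l where "l j x = lam (Suc j) x" for j x
  \<comment> \<open>Continued by 0 from \<open>n\<close> on, because the construction asks for
    measurability at every index.\<close>
  define a where "a i x = (if i < n then \<alpha> (Suc i) x else 0)" for i x
  define good where "good x \<longleftrightarrow> (\<forall>i. \<Gamma> (h i) x \<in> sqi cs) \<and> d x = cfun.dim (cfun.span ((\<lambda>h. \<Gamma> h x) ` H))
    \<and> (\<forall>j. l (Suc j) x \<le> l j x) \<and> (\<forall>i. a i x \<le> \<bar>b\<bar>) \<and> (\<forall>j \<ge> min (d x) n. l j x = 0)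
    \<and> majorized_by (map (\<lambda>i. a i x) [0..<n]) (map (\<lambda>j. l j x) [0..<d x])" for x
  have "AE x in torus_measure. good x"
  proof -
    have 1: "AE x in torus_measure. \<forall>i. \<Gamma> (h i) x \<in> sqi cs"
      unfolding AE_all_countable using AE_fiber_sqi[OF \<Gamma>_sqi[OF hs]] by blast
    have 2: "AE x in torus_measure. \<forall>j. l (Suc j) x \<le> l j x"
      unfolding AE_all_countable l_def using sorted[of "Suc _"] by simp
    have 3: "AE x in torus_measure. \<forall>i. a i x \<le> \<bar>b\<bar>"
      unfolding AE_all_countable
    proof
      fix i
      show "AE x in torus_measure. a i x \<le> \<bar>b\<bar>"
      proof (cases "i < n")
        case True
        then have "AE x in torus_measure. \<alpha> (Suc i) x \<le> b" by (intro bound) auto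
        then show ?thesis by eventually_elim (use True in \<open>auto simp: a_def\<close>)
      qed (simp add: a_def)
    qed
    have 4: "AE x in torus_measure. \<forall>j. j \<ge> min (d x) n \<longrightarrow> l j x = 0"
      unfolding AE_all_countable
    proof
      fix j
      have "AE x in torus_measure. Suc j \<ge> min (d x) n + 1 \<longrightarrow> lam (Suc j) x = 0"
        using adm unfolding admissible_def by auto
      then show "AE x in torus_measure. j \<ge> min (d x) n \<longrightarrow> l j x = 0"
        by eventually_elim (simp add: l_def)
    qed
    have mapa: "map (\<lambda>i. a i x) [0..<n] = map (\<lambda>i. \<alpha> (Suc i) x) [0..<n]" for x
      by (rule map_cong) (auto simp: a_def)
    have 5: "AE x in torus_measure. majorized_by (map (\<lambda>i. a i x) [0..<n]) (map (\<lambda>j. l j x) [0..<d x])"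
      using adm unfolding admissible_def map_Suc_shift mapa l_def by blast
    show ?thesis using 1 2 3 4 5 d by eventually_elim (simp only: good_def, blast)
  qed
  then obtain N where N: "{x \<in> space torus_measure. \<not> good x} \<subseteq> N" "N \<in> null_sets torus_measure"
    by (elim AE_E) (auto simp: null_sets_def)
  have Nm: "N \<in> sets torus_measure" using N(2) by auto
  have NAE: "AE x in torus_measure. x \<notin> N" by (rule AE_not_in[OF N(2)])
  have good: "good x" if "x \<in> torus" "x \<notin> N" for x using N(1) that by auto
  \<comment> \<open>Multiplication by \<open>z\<close> sets all data to 0 on the exceptional null
    set, where the hypotheses of the construction hold trivially. They then hold at every point of
    the torus, as that construction requires.\<close>
  define z where "z x = (if x \<in> N then 0 else 1 :: real)" for x
  have zm: "z \<in> borel_measurable torus_measure"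
    unfolding z_def using Nm by (intro measurable_If_set) auto
  define c where "c j x = complex_of_real (z x * sqrt (l j x))" for j x
  have lm': "l j \<in> borel_measurable torus_measure" for j
    unfolding l_def using lm[of "Suc j"] by simp
  have cm: "c j \<in> borel_measurable torus_measure" for j
    unfolding c_def using zm lm' by measurable
  define g where "g j x = cscale (c j x) (e j x)" for j x
  define \<beta> where "\<beta> i x = z x * a i x" for i x
  have gm: "case_prod (g j) \<in> borel_measurable fib_measure" for j
    unfolding g_def by (intro measurable_fib_cscale em cm)
  have \<beta>m: "\<beta> i \<in> borel_measurable torus_measure" for i
  proof -
    have "a i \<in> borel_measurable torus_measure"
      using \<alpha>m[of "Suc i"] by (cases "i < n") (simp_all add: a_def[abs_def])
    then show ?thesis unfolding \<beta>_def using zm by measurable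
  qed
  have gN: "g j x = 0" "\<beta> i x = 0" if "x \<in> N" for i j x using that by (auto simp: g_def c_def \<beta>_def z_def)
  have facts: "(\<forall>j. g j x \<in> sqi cs \<and> g j x \<in> cfun.span ((\<lambda>i. \<Gamma> (h i) x) ` {..<m}) \<and> nsq cs (g j x) = l j x)
      \<and> (\<forall>i. \<beta> i x = a i x) \<and> (\<forall>i j. i \<noteq> j \<longrightarrow> ip cs (g i x) (g j x) = 0)"
    if x: "x \<in> torus" "x \<notin> N" for x
  proof -
    have G: "\<And>i. \<Gamma> (h i) x \<in> sqi cs" "d x = cfun.dim (cfun.span ((\<lambda>i. \<Gamma> (h i) x) ` {..<m}))"
      "\<And>j. j \<ge> min (d x) n \<Longrightarrow> l j x = 0"
      using good[OF x] unfolding good_def im by auto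
    have z1: "z x = 1" using x by (simp add: z_def)
    have "g j x \<in> sqi cs \<and> g j x \<in> cfun.span ((\<lambda>i. \<Gamma> (h i) x) ` {..<m}) \<and> nsq cs (g j x) = l j x" for j
    proof (intro conjI)
      note E = e1[where x = x and j = j, OF G(1)]
      show "g j x \<in> sqi cs" unfolding g_def using E by (intro sqi_cscale) blast
      show "g j x \<in> cfun.span ((\<lambda>i. \<Gamma> (h i) x) ` {..<m})" unfolding g_def using E by (intro cfun.span_scale) blast
      have "l j x \<ge> 0" using l0[of "Suc j" x] x by (simp add: l_def)
      then have "(cmod (c j x))\<^sup>2 = l j x" by (simp add: c_def z1)
      then have "nsq cs (g j x) = l j x * nsq cs (e j x)" unfolding g_def by (simp only: nsq_cscale)
      \<comment> \<open>Where the basis has run out, \<open>e j x\<close> is 0, and admissibility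
        makes \<open>l j x\<close> vanish as well.\<close>
      then show "nsq cs (g j x) = l j x" using E G(3)[of j] unfolding G(2)[symmetric] by (cases "j < d x") auto
    qed
    moreover have "\<beta> i x = a i x" for i by (simp add: \<beta>_def z1)
    moreover have "ip cs (g i x) (g j x) = 0" if "i \<noteq> j" for i j :: nat
      unfolding g_def using e2[where x = x, OF G(1) that] by simp
    ultimately show ?thesis by blast
  qed
  have lmono: "l j x \<le> l i x" if x: "x \<in> torus" "x \<notin> N" and "i \<le> j" for i j x
    using good[OF x] unfolding good_def by (intro lift_Suc_antimono_le[OF _ that(3), of "\<lambda>j. l j x"]) blast
  have maj: "(\<Sum>i\<in>K. a i x) \<le> (\<Sum>j<card K. l j x)" "(\<Sum>i<n. a i x) = (\<Sum>j<n. l j x)"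
    if x: "x \<in> torus" "x \<notin> N" and K: "K \<subseteq> {..<n}" for x K
  proof -
    have G: "majorized_by (map (\<lambda>i. a i x) [0..<n]) (map (\<lambda>j. l j x) [0..<d x])"
      "\<And>j. j \<ge> min (d x) n \<Longrightarrow> l j x = 0"
      using good[OF x] unfolding good_def by auto
    have M: "\<And>K. K \<subseteq> {..<n} \<Longrightarrow> card K \<le> d x \<Longrightarrow> (\<Sum>i\<in>K. a i x) \<le> (\<Sum>j<card K. l j x)"
      "(\<Sum>i<n. a i x) = (\<Sum>j<d x. l j x)"
      using G(1) by (subst (asm) majorized_by_map_iff; use lmono[OF x] in blast)+
    \<comment> \<open>Admissibility makes all terms from min (d x) n on vanish, so sums reaching at
      least that far agree.\<close>
    have ext: "(\<Sum>j<d x. l j x) = (\<Sum>j<k. l j x)" if "min (d x) n \<le> k" for k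
    proof -
      have "(\<Sum>j<k'. l j x) = (\<Sum>j<min (d x) n. l j x)" if "min (d x) n \<le> k'" for k'
        by (rule sum.mono_neutral_right) (use G(2) that in auto)
      from this[of k] this[of "d x"] that show ?thesis by simp
    qed
    show "(\<Sum>i<n. a i x) = (\<Sum>j<n. l j x)" using M(2) ext[of n] by simp
    show "(\<Sum>i\<in>K. a i x) \<le> (\<Sum>j<card K. l j x)"
    proof (cases "card K \<le> d x")
      \<comment> \<open>Majorization makes no statement about sets larger than the dimension. There
        nonnegativity of \<alpha> bounds the sum by the total, and the eigenvalues past the
        dimension vanish.\<close>
      case False
      have "(\<Sum>i\<in>K. a i x) \<le> (\<Sum>i<n. a i x)"
        using K \<alpha>0 x by (intro sum_mono2) (auto simp: a_def)
      then show ?thesis using M(2) ext[of "card K"] False by simp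
    qed (use M(1) K in blast)
  qed
  have "\<exists>v. (\<forall>i. case_prod (v i) \<in> borel_measurable fib_measure) \<and>
    (\<forall>x\<in>torus. (\<forall>i<n. v i x \<in> cfun.span ((\<lambda>j. g j x) ` {..<n}) \<and> nsq cs (v i x) = \<beta> i x) \<and>
      (\<forall>\<xi>\<in>sqi cs. frame_op n (\<lambda>i. v i x) \<xi> = frame_op n (\<lambda>j. g j x) \<xi>))"
  proof (rule schur_horn_measurable[OF gm \<beta>m])
    fix j :: nat and x :: "real ^ 'k" assume x: "x \<in> torus"
    show "g j x \<in> sqi cs" using facts[OF x] gN by (cases "x \<in> N") simp_all
  next
    fix i j :: nat and x :: "real ^ 'k" assume x: "x \<in> torus" "i \<noteq> j"
    show "ip cs (g i x) (g j x) = 0" using facts[OF x(1)] gN x(2) by (cases "x \<in> N") simp_all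
  next
    fix i j :: nat and x :: "real ^ 'k" assume x: "x \<in> torus" "i \<le> j"
    show "nsq cs (g j x) \<le> nsq cs (g i x)" using facts[OF x(1)] gN lmono[OF x(1) _ x(2)] by (cases "x \<in> N") simp_all
  next
    fix K and x :: "real ^ 'k" assume x: "x \<in> torus" "K \<subseteq> {..<n}"
    show "(\<Sum>i\<in>K. \<beta> i x) \<le> (\<Sum>j<card K. nsq cs (g j x))"
      using facts[OF x(1)] gN maj(1)[OF x(1) _ x(2)] by (cases "x \<in> N") simp_all
  next
    fix x :: "real ^ 'k" assume x: "x \<in> torus"
    show "(\<Sum>i<n. \<beta> i x) = (\<Sum>j<n. nsq cs (g j x))"
      using facts[OF x] gN maj(2)[OF x _ order_refl] by (cases "x \<in> N") simp_all
  qed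
  then obtain v where vm: "\<And>i. case_prod (v i) \<in> borel_measurable fib_measure"
    and v: "\<And>x i. x \<in> torus \<Longrightarrow> i < n \<Longrightarrow> v i x \<in> cfun.span ((\<lambda>j. g j x) ` {..<n}) \<and> nsq cs (v i x) = \<beta> i x"
    and vf: "\<And>x \<xi>. x \<in> torus \<Longrightarrow> \<xi> \<in> sqi cs \<Longrightarrow> frame_op n (\<lambda>i. v i x) \<xi> = frame_op n (\<lambda>j. g j x) \<xi>"
    by blast
  have vspan: "v i x \<in> cfun.span ((\<lambda>i. \<Gamma> (h i) x) ` {..<m})" if x: "x \<in> torus" "x \<notin> N" "i < n" for x i
  proof -
    have "(\<lambda>j. g j x) ` {..<n} \<subseteq> cfun.span ((\<lambda>i. \<Gamma> (h i) x) ` {..<m})" using facts[OF x(1,2)] by blast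
    from cfun.span_minimal[OF this cfun.subspace_span] show ?thesis using v[OF x(1,3)] by blast
  qed
  have vsqi: "v i x \<in> sqi cs" if x: "x \<in> torus" "x \<notin> N" "i < n" for x i
  proof -
    have "(\<lambda>j. g j x) ` {..<n} \<subseteq> sqi cs" using facts[OF x(1,2)] by blast
    from cfun.span_minimal[OF this subspace_sqi] show ?thesis using v[OF x(1,3)] by blast
  qed
  have vs: "case_prod (v i) \<in> sqi fib_measure" if i: "i < n" for i
  proof (rule sqi_fibI[OF vm])
    show "AE x in torus_measure. v i x \<in> sqi cs" using NAE AE_space by eventually_elim (use vsqi i in auto)
    show "integrable torus_measure (\<lambda>x. nsq cs (v i x))"
    proof (rule torus.integrable_const_bound[of _ "\<bar>b\<bar>"])
      show "(\<lambda>x. nsq cs (v i x)) \<in> borel_measurable torus_measure" by (rule measurable_nsq_fibers[OF vm vm])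
      show "AE x in torus_measure. norm (nsq cs (v i x)) \<le> \<bar>b\<bar>"
        using NAE AE_space
      proof eventually_elim
        case (elim x)
        then have x: "x \<in> torus" "x \<notin> N" by auto
        have "nsq cs (v i x) = a i x" using v[OF x(1) i] facts[OF x] by simp
        also have "\<dots> \<le> \<bar>b\<bar>" using good[OF x] unfolding good_def by blast
        finally show ?case by simp
      qed
    qed
  qed
  have "\<exists>f. f \<in> sqi lebesgue \<and> (AE x in torus_measure. \<Gamma> f x = v i x)" if "i < n" for i
    using \<Gamma>_surj[OF vs[OF that]] by blast
  then have "\<exists>f. \<forall>i. i < n \<longrightarrow> f i \<in> sqi lebesgue \<and> (AE x in torus_measure. \<Gamma> (f i) x = v i x)"
    by (intro choice) blast
  then obtain f where f: "\<And>i. i < n \<Longrightarrow> f i \<in> sqi lebesgue" "\<And>i. i < n \<Longrightarrow> AE x in torus_measure. \<Gamma> (f i) x = v i x"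
    by blast
  define F where "F j = f (j - 1)" for j
  have Fs: "F j \<in> sqi lebesgue" if "j \<in> {1..n}" for j unfolding F_def by (rule f) (use that in auto)
  have FAE: "AE x in torus_measure. \<Gamma> (F j) x = v (j - 1) x \<and> x \<in> torus \<and> x \<notin> N" if "j \<in> {1..n}" for j
  proof -
    have "j - 1 < n" using that by auto
    from f(2)[OF this] NAE AE_space show ?thesis by eventually_elim (auto simp: F_def)
  qed
  have FW: "F j \<in> SI_span H" if j: "j \<in> {1..n}" for j
  proof (rule SI_span_if_fibers[OF H Fs[OF j]])
    have j': "j - 1 < n" using j by auto
    show "AE x in torus_measure. \<Gamma> (F j) x \<in> cfun.span ((\<lambda>h. \<Gamma> h x) ` H)"
      using FAE[OF j]
    proof eventually_elim
      case (elim x)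
      then show ?case unfolding im using vspan[of x "j - 1"] j' by simp
    qed
  qed
  have Fn: "AE x in torus_measure. nsq cs (\<Gamma> (F j) x) = \<alpha> j x \<and> nsq cs (\<Gamma> (F j) x) \<le> \<bar>b\<bar>" if j: "j \<in> {1..n}" for j
    using FAE[OF j]
  proof eventually_elim
    case (elim x)
    have j': "j - 1 < n" "Suc (j - 1) = j" using j by auto
    have "nsq cs (\<Gamma> (F j) x) = a (j - 1) x" using elim v[of x "j - 1"] j'(1) facts[of x] by simp
    moreover have "a (j - 1) x \<le> \<bar>b\<bar>" using good[of x] elim unfolding good_def by blast
    ultimately show ?case using j' by (simp add: a_def)
  qed
  have Fb: "AE x in torus_measure. nsq cs (\<Gamma> (F j) x) \<le> \<bar>b\<bar>" if j: "j \<in> {1..n}" for j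
    using Fn[OF j] by eventually_elim blast
  have bessel: "bessel_translates n F"
    by (rule bessel_translates_bounded[OF Fs abs_ge_zero Fb])
  have eig: "AE x in torus_measure. eigenvalue_seq (frame_operator_fiber n F x) j = lam j x" if j: "j \<ge> 1" for j
  proof -
    have "AE x in torus_measure. \<forall>i\<in>{1..n}. \<Gamma> (F i) x = v (i - 1) x \<and> x \<in> torus \<and> x \<notin> N"
      using FAE by (intro AE_finite_allI) auto
    then show ?thesis using NAE AE_space
    proof eventually_elim
      case (elim x)
      then have x: "x \<in> torus" "x \<notin> N" by auto
      have "frame_operator_fiber n F x = frame_op n (\<lambda>i. v i x)"
        unfolding frame_operator_fiber_eq frame_op_def
        by (rule ext, rule sum.cong) (use elim(1) in auto)
      then have "eigenvalue_seq (frame_operator_fiber n F x) = eigenvalue_seq (frame_op n (\<lambda>j. g j x))"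
        using vf[OF x(1)] by (intro eigenvalue_seq_cong) (simp add: ell2_eq)
      then have "eigenvalue_seq (frame_operator_fiber n F x) j
        = (if 1 \<le> j \<and> j \<le> n then rsort (map (\<lambda>i. nsq cs (g i x)) [0..<n]) ! (j - 1) else 0)"
        using facts[OF x] by (subst eigenvalue_seq_orthogonal[symmetric]) auto
      also have "map (\<lambda>i. nsq cs (g i x)) [0..<n] = map (\<lambda>i. l i x) [0..<n]" using facts[OF x] by simp
      also have "rsort (map (\<lambda>i. l i x) [0..<n]) = map (\<lambda>i. l i x) [0..<n]"
        by (rule rsort_map_id) (rule lmono[OF x])
      finally have "eigenvalue_seq (frame_operator_fiber n F x) j = (if j \<le> n then l (j - 1) x else 0)"
        using j by auto
      moreover have "l (j - 1) x = 0" if "\<not> j \<le> n" using good[OF x] that unfolding good_def by auto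
      moreover have "l (j - 1) x = lam j x" using j by (simp add: l_def)
      ultimately show ?case by auto
    qed
  qed
  show ?thesis
    unfolding has_bessel_realization_def
  proof (intro exI[of _ F] conjI ballI allI impI)
    fix j assume j: "j \<in> {1..n}"
    show "F j \<in> SI_span H" by (rule FW[OF j])
    show "AE x in torus_measure. (ell2_norm (\<Gamma> (F j) x))\<^sup>2 = \<alpha> j x"
      unfolding ell2_norm_sq using Fn[OF j] by eventually_elim blast
  qed (use bessel eig in blast)+
qed

text \<open>A realization forces two properties that admissibility does not contain: the eigenvalues
  are listed in non-increasing order, and a Bessel bound makes the squared fiber norms \<alpha>
  essentially bounded. \<open>majorized_by\<close> sorts its arguments and sets no bound uniform in
  \<open>x\<close>. Accordingly necessity is stated on its own, and the equivalence for ordered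
  \<open>lam\<close> and essentially bounded \<alpha>.\<close>

theorem theorem3p4:
  fixes W :: "(real ^ 'k \<Rightarrow> complex) set"
    and J :: "real ^ 'k \<Rightarrow> (int ^ 'k \<Rightarrow> complex) set"
    and d :: "real ^ 'k \<Rightarrow> nat"
    and n :: nat
    and \<alpha> lam :: "nat \<Rightarrow> real ^ 'k \<Rightarrow> real"
  assumes "FSI W"
    and "is_range_function W J"
    and "\<And>x. x \<in> torus \<Longrightarrow> d x = cfun.dim (J x)"
    and "n \<ge> 1"
    and "\<And>j. j \<in> {1..n} \<Longrightarrow> \<alpha> j \<in> borel_measurable torus_measure"
    and "\<And>j x. j \<in> {1..n} \<Longrightarrow> x \<in> torus \<Longrightarrow> \<alpha> j x \<ge> 0"
    and "\<And>j. j \<ge> 1 \<Longrightarrow> lam j \<in> borel_measurable torus_measure"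
    and "\<And>j x. j \<ge> 1 \<Longrightarrow> x \<in> torus \<Longrightarrow> lam j x \<ge> 0"
  shows "(has_bessel_realization W n \<alpha> lam \<longrightarrow> admissible d n \<alpha> lam) \<and>
    ((\<forall>j\<ge>1. AE x in torus_measure. lam (j + 1) x \<le> lam j x) \<and>
     (\<exists>b. \<forall>j\<in>{1..n}. AE x in torus_measure. \<alpha> j x \<le> b) \<longrightarrow>
       (has_bessel_realization W n \<alpha> lam \<longleftrightarrow> admissible d n \<alpha> lam))"
proof -
  obtain H where H: "finite H" "H \<subseteq> L2" "W = SI_span H"
    and J: "AE x in torus_measure. J x = cfun.span ((\<lambda>h. \<Gamma> h x) ` H)"
    using assms(2) unfolding is_range_function_def by blast
  have d: "AE x in torus_measure. d x = cfun.dim (cfun.span ((\<lambda>h. \<Gamma> h x) ` H))"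
    using J AE_space
  proof eventually_elim
    case (elim x)
    then have "x \<in> torus" by (simp only: space_torus)
    from assms(3)[OF this] show ?case by (simp only: elim(1))
  qed
  have nec: "has_bessel_realization W n \<alpha> lam \<Longrightarrow> admissible d n \<alpha> lam"
    unfolding H(3) by (rule realization_admissible[OF H(1,2) d])
  have suf: "has_bessel_realization W n \<alpha> lam"
    if "\<forall>j\<ge>1. AE x in torus_measure. lam (j + 1) x \<le> lam j x"
      "\<forall>j\<in>{1..n}. AE x in torus_measure. \<alpha> j x \<le> b" "admissible d n \<alpha> lam" for b
    unfolding H(3)
    by (rule admissible_realization[OF H(1,2) d assms(5,7,6,8) _ _ that(3)]) (use that(1,2) in blast)+
  show ?thesis using nec suf by blast
qed

end
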